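(* Let $\Gamma$ be a lower Eulerian poset and $B$ be an Eulerian poset. Let $\phi\colon\Gamma\to B$ be a strong formal subdivision of rank $0$. Then \[\Phi_{\Gamma}=\sum_{x\in B}\ell^{\Phi}_{\Gamma_x}\cdot\Phi_{[x,\hat 1]},\] where $\Gamma_x=\{y\in\Gamma\mid\phi(y)\le x\}$.
   Context: Posets. All posets are finite and graded (all maximal chains have the same length, called the rank) with a unique minimal element $\hat 0$; $\hat 1$ denotes the unique maximal element if it exists; $\rho(x)$ denotes the rank of $[\hat 0,x]$. A subset $I$ is a lower order ideal if $[\hat 0,x]\subset I$ for all $x\in I$. The boundary $\partial P$ of a poset $P$ of rank $n$ is the lower order ideal generated by the rank $n-1$ elements covered by exactly one element (so $\partial P=P\setminus\{\hat 1\}$ if $P$ has $\hat 1$ and positive rank). $P$ is Eulerian if it has $\hat 0,\hat 1$ and every interval of positive rank has as many elements of even rank as of odd rank. $P$ is lower Eulerian if it has $\hat 0$ and every interval $[x,y]$ is Eulerian. A poset $P$ of rank $n$ is near-Eulerian if $P=Q\setminus\{q,\hat 1\}$ for some Eulerian poset $Q$ of rank $n+1$ and some $q\in Q$ of rank $n$. The semisuspension $\widetilde\Sigma P$ of a poset $P$ of rank $n$ is $P\cup\{q\}$ with a new element $q$ of rank $n$ lying above exactly the elements of $\partial P$; if $P$ is near-Eulerian, $\widetilde\Sigma P$ is the boundary of an Eulerian poset. Also, the boundary of a near-Eulerian poset is the boundary of an Eulerian poset. $ab$- and $cd$-index. Let $\mathbf K$ be a field of characteristic $0$ and $P$ a poset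 of rank $n$. For $S\subseteq[n]$ let $\alpha_P(S)$ be the number of chains $\hat 0<x_1<\dots<x_k$ in $P$ with $\{\rho(x_1),\dots,\rho(x_k)\}=S$, and $\beta_P(S)=\sum_{T\subseteq S}(-1)^{\#(S\setminus T)}\alpha_P(T)$. The $ab$-index is $\Psi_P=\sum_{S\subseteq[n]}\beta_P(S)u_S\in\mathbf K\langle a,b\rangle$, where $u_S=u_1\cdots u_n$ with $u_i=b$ if $i\in S$ and $u_i=a$ otherwise. If $Q$ is the boundary of an Eulerian poset (of positive rank), there is a unique noncommutative polynomial $\Phi_Q(c,d)$ with $\Phi_Q(a+b,ab+ba)=\Psi_Q(a,b)$, the $cd$-index of $Q$; in particular the $cd$-index of the singleton poset is $1$. For near-Eulerian $P$, the local $cd$-index is $\ell^\Phi_P:=\Phi_{\widetilde\Sigma P}-\Phi_{\partial P}\cdot c$, and the $cd$-index of $P$ is $\Phi_P:=\ell^\Phi_P+\Phi_{\partial P}$ (a possibly non-homogeneous polynomial). By convention the local $cd$-index of the singleton poset $\{\hat 0\}$ is $1$. Eulerian posets of positive rank are near-Eulerian, and for such a $P$ one has $\Phi_P=\Phi_{\partial P}$. Strong formal subdivisions. Let $\Gamma,B$ be lower Eulerian with natural rank functions $\rho$ (so $\rho(\hat 0)=0$). A strong formal subdivision (of rank $0$, the rank being $\rho_B(\hat 0_B)-\rho_\Gamma(\hat 0_\Gamma)$) is a surjective map $\phi\colon\Gamma\to B$ which is order-preserving, rank-increasing ($\rho_\Gamma(y)\le\rho_B(\phi(y))$ for all $y$),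 and satisfies, for all $y\in\Gamma$, $x\in B$ with $\phi(y)\le x$: (1) there is $y'\ge y$ with $\phi(y')=x$ and $\rho(y')=\rho(x)$; (2) $\sum_{y'\in\phi^{-1}(x),\,y\le y'}(-1)^{\rho(y')}=(-1)^{\rho(x)}$. If $B$ is Eulerian and $\phi$ has rank $0$, then $\Gamma_x$ is near-Eulerian for every $x\ne\hat 0$ and $\Gamma_{\hat 0}=\{\hat 0\}$, so all terms are defined. *)

theory Defs
  imports Complex_Main "HOL-Library.Poly_Mapping"
begin

section \<open>Finite graded posets\<close>

text \<open>
  A poset is given by its reflexive order relation \<open>P\<close>; the underlying set is \<open>Field P\<close>, and
  \<open>(x, y) \<in> P\<close> means \<open>x \<le> y\<close>. The poset induced on a subset \<open>A\<close> is \<open>Restr P A\<close>.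
\<close>

definition maximal_chains :: "'p rel \<Rightarrow> 'p set set" where
  "maximal_chains P = {C \<in> Chains P. \<forall>D \<in> Chains P. C \<subseteq> D \<longrightarrow> D = C}"

definition minimal_in :: "'p rel \<Rightarrow> 'p \<Rightarrow> bool" where
  "minimal_in P z \<longleftrightarrow> z \<in> Field P \<and> (\<forall>y. (y, z) \<in> P \<longrightarrow> y = z)"

definition maximal_in :: "'p rel \<Rightarrow> 'p \<Rightarrow> bool" where
  "maximal_in P z \<longleftrightarrow> z \<in> Field P \<and> (\<forall>y. (z, y) \<in> P \<longrightarrow> y = z)"

definition zero_hat :: "'p rel \<Rightarrow> 'p" where
  "zero_hat P = (THE z. minimal_in P z)"

definition one_hat :: "'p rel \<Rightarrow> 'p" where
  "one_hat P = (THE z. maximal_in P z)"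

definition graded_poset :: "'p rel \<Rightarrow> bool" where
  "graded_poset P \<longleftrightarrow>
     Partial_order P \<and> finite (Field P) \<and>
     (\<forall>C \<in> maximal_chains P. \<forall>D \<in> maximal_chains P. card C = card D) \<and>
     (\<exists>!z. minimal_in P z)"

text \<open>The length of a chain is one less than its number of elements.\<close>

definition poset_rank :: "'p rel \<Rightarrow> nat" where
  "poset_rank P = (THE n. \<forall>C \<in> maximal_chains P. card C = n + 1)"

definition interval :: "'p rel \<Rightarrow> 'p \<Rightarrow> 'p \<Rightarrow> 'p rel" where
  "interval P x y = Restr P {z. (x, z) \<in> P \<and> (z, y) \<in> P}"

definition rho :: "'p rel \<Rightarrow> 'p \<Rightarrow> nat" where
  "rho P x = poset_rank (interval P (zero_hat P) x)"

definition covers :: "'p rel \<Rightarrow> 'p \<Rightarrow> 'p \<Rightarrow> bool" where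
  "covers P y x \<longleftrightarrow>
     (x, y) \<in> P \<and> x \<noteq> y \<and> (\<forall>z. (x, z) \<in> P \<and> (z, y) \<in> P \<longrightarrow> z = x \<or> z = y)"

text \<open>
  The condition \<open>Suc (rho P x) = poset_rank P\<close> avoids truncated subtraction; the boundary of a
  poset of rank 0 is empty.
\<close>

definition boundary :: "'p rel \<Rightarrow> 'p rel" where
  "boundary P = Restr P {y. \<exists>x \<in> Field P.
     Suc (rho P x) = poset_rank P \<and> (\<exists>!z. covers P z x) \<and> (y, x) \<in> P}"

section \<open>Eulerian, lower Eulerian and near-Eulerian posets\<close>

definition Eulerian :: "'p rel \<Rightarrow> bool" where
  "Eulerian P \<longleftrightarrow>
     graded_poset P \<and> (\<exists>!z. maximal_in P z) \<and>
     (\<forall>x y. (x, y) \<in> P \<and> 0 < poset_rank (interval P x y) \<longrightarrow>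
        card {z \<in> Field (interval P x y). even (rho P z)} =
        card {z \<in> Field (interval P x y). odd (rho P z)})"

definition lower_Eulerian :: "'p rel \<Rightarrow> bool" where
  "lower_Eulerian P \<longleftrightarrow>
     graded_poset P \<and> (\<forall>x y. (x, y) \<in> P \<longrightarrow> Eulerian (interval P x y))"

text \<open>
  The type of \<open>P\<close> need not have room for the two extra elements of the Eulerian poset \<open>Q\<close>, so \<open>P\<close>
  is first embedded into a type with two additional elements. No \<open>Q\<close> is lost this way, as \<open>Q\<close> has
  exactly two elements more than \<open>P\<close>.
\<close>

definition near_Eulerian :: "'p rel \<Rightarrow> bool" where
  "near_Eulerian P \<longleftrightarrow>
     graded_poset P \<and>
     (\<exists>(Q :: 'p option option rel) q.
        Eulerian Q \<and> poset_rank Q = poset_rank P + 1 \<and>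
        q \<in> Field Q \<and> rho Q q = poset_rank P \<and>
        dir_image P (\<lambda>y. Some (Some y)) = Restr Q (Field Q - {q, one_hat Q}))"

text \<open>\<open>Some\<close> embeds the elements of \<open>P\<close>; \<open>None\<close> is the new element.\<close>

definition semisuspension :: "'p rel \<Rightarrow> 'p option rel" where
  "semisuspension P =
     dir_image P Some \<union> {(None, None)} \<union> {(Some y, None) | y. y \<in> Field (boundary P)}"

section \<open>Noncommutative polynomials\<close>

text \<open>
  The free monoid over the letters \<open>'x\<close>, written additively, because the ring structure of
  \<open>'m \<Rightarrow>\<^sub>0 'k\<close> is the monoid algebra of an additive (not necessarily commutative) monoid \<open>'m\<close>.
  Hence \<open>('x, 'k) ncpoly\<close> is the free associative algebra over \<open>'k\<close> on the letters \<open>'x\<close>.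
\<close>

datatype 'x free_word = Free_Word (letters: "'x list")

instantiation free_word :: (type) monoid_add
begin

definition zero_free_word :: "'a free_word" where
  "0 = Free_Word []"

definition plus_free_word :: "'a free_word \<Rightarrow> 'a free_word \<Rightarrow> 'a free_word" where
  "u + v = Free_Word (letters u @ letters v)"

instance
  by standard (simp_all add: zero_free_word_def plus_free_word_def)

end

type_synonym ('x, 'k) ncpoly = "'x free_word \<Rightarrow>\<^sub>0 'k"

definition nc_monom :: "'x list \<Rightarrow> ('x, 'k::field_char_0) ncpoly" where
  "nc_monom xs = Poly_Mapping.single (Free_Word xs) 1"

definition nc_const :: "'k \<Rightarrow> ('x, 'k::field_char_0) ncpoly" where
  "nc_const k = Poly_Mapping.single 0 k"

text \<open>The value of \<open>p\<close> when each letter \<open>x\<close> is replaced by \<open>f x\<close>.\<close>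

definition nc_subst ::
  "('x \<Rightarrow> ('y, 'k) ncpoly) \<Rightarrow> ('x, 'k::field_char_0) ncpoly \<Rightarrow> ('y, 'k) ncpoly" where
  "nc_subst f p =
     (\<Sum>w \<in> Poly_Mapping.keys p.
        nc_const (Poly_Mapping.lookup p w) * prod_list (map f (letters w)))"

datatype ab_letter = La | Lb
datatype cd_letter = Lc | Ld

section \<open>The ab-index, the cd-index and the local cd-index\<close>

text \<open>A chain \<open>0\<^sub>P < x\<^sub>1 < \<dots> < x\<^sub>k\<close> is identified with the set of the \<open>x\<^sub>i\<close>.\<close>

definition flag_f :: "'p rel \<Rightarrow> nat set \<Rightarrow> nat" where
  "flag_f P S = card {C \<in> Chains P. zero_hat P \<notin> C \<and> rho P ` C = S}"

definition flag_h :: "'p rel \<Rightarrow> nat set \<Rightarrow> int" where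
  "flag_h P S = (\<Sum>T \<in> Pow S. (- 1) ^ card (S - T) * int (flag_f P T))"

definition ab_word :: "nat \<Rightarrow> nat set \<Rightarrow> ab_letter list" where
  "ab_word n S = map (\<lambda>i. if i \<in> S then Lb else La) [1..<n + 1]"

definition ab_index :: "'p rel \<Rightarrow> (ab_letter, 'k::field_char_0) ncpoly" where
  "ab_index P =
     (\<Sum>S \<in> Pow {1..poset_rank P}.
        nc_const (of_int (flag_h P S)) * nc_monom (ab_word (poset_rank P) S))"

primrec cd_to_ab :: "cd_letter \<Rightarrow> (ab_letter, 'k::field_char_0) ncpoly" where
  "cd_to_ab Lc = nc_monom [La] + nc_monom [Lb]"
| "cd_to_ab Ld = nc_monom [La] * nc_monom [Lb] + nc_monom [Lb] * nc_monom [La]"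

text \<open>Meaningful when \<open>P\<close> is the boundary of an Eulerian poset of positive rank.\<close>

definition cd_index_bd :: "'p rel \<Rightarrow> (cd_letter, 'k::field_char_0) ncpoly" where
  "cd_index_bd P = (THE \<Phi>. nc_subst cd_to_ab \<Phi> = ab_index P)"

text \<open>Meaningful when \<open>P\<close> is near-Eulerian or a singleton; a graded poset of rank 0 is a singleton.\<close>

definition local_cd_index :: "'p rel \<Rightarrow> (cd_letter, 'k::field_char_0) ncpoly" where
  "local_cd_index P =
     (if poset_rank P = 0 then 1
      else cd_index_bd (semisuspension P) - cd_index_bd (boundary P) * nc_monom [Lc])"

text \<open>
  No poset is both near-Eulerian and the boundary of an Eulerian poset. In the latter case
  (including the singleton, the boundary of the Eulerian poset of rank 1) the second branch applies.
\<close>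

definition cd_index :: "'p rel \<Rightarrow> (cd_letter, 'k::field_char_0) ncpoly" where
  "cd_index P =
     (if near_Eulerian P then local_cd_index P + cd_index_bd (boundary P) else cd_index_bd P)"

section \<open>Strong formal subdivisions\<close>

definition strong_formal_subdivision :: "'p rel \<Rightarrow> 'q rel \<Rightarrow> ('p \<Rightarrow> 'q) \<Rightarrow> bool" where
  "strong_formal_subdivision \<Gamma> B \<phi> \<longleftrightarrow>
     \<phi> ` Field \<Gamma> = Field B \<and>
     (\<forall>y y'. (y, y') \<in> \<Gamma> \<longrightarrow> (\<phi> y, \<phi> y') \<in> B) \<and>
     (\<forall>y \<in> Field \<Gamma>. rho \<Gamma> y \<le> rho B (\<phi> y)) \<and>
     (\<forall>y \<in> Field \<Gamma>. \<forall>x \<in> Field B. (\<phi> y, x) \<in> B \<longrightarrow>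
        (\<exists>y'. (y, y') \<in> \<Gamma> \<and> \<phi> y' = x \<and> rho \<Gamma> y' = rho B x) \<and>
        (\<Sum>y' | (y, y') \<in> \<Gamma> \<and> \<phi> y' = x. (- 1 :: int) ^ rho \<Gamma> y') = (- 1) ^ rho B x)"

text \<open>For the natural rank functions used here this is always 0.\<close>

definition subdivision_rank :: "'p rel \<Rightarrow> 'q rel \<Rightarrow> int" where
  "subdivision_rank \<Gamma> B = int (rho B (zero_hat B)) - int (rho \<Gamma> (zero_hat \<Gamma>))"

definition subdivision_part :: "'p rel \<Rightarrow> 'q rel \<Rightarrow> ('p \<Rightarrow> 'q) \<Rightarrow> 'q \<Rightarrow> 'p rel" where
  "subdivision_part \<Gamma> B \<phi> x = Restr \<Gamma> {y \<in> Field \<Gamma>. (\<phi> y, x) \<in> B}"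

end

theory Submission
  imports Defs
begin

text \<open>
  Write \<open>e = a - b\<close> and \<open>c = a + b\<close>. The ab-index of \<open>P\<close> is the sum over the chains of \<open>P\<close> of words
  with \<open>b\<close> at the ranks of the chain and \<open>e\<close> elsewhere, so splitting off the largest or the smallest
  element of a chain gives recursions. As \<open>c \<mapsto> a + b\<close>, \<open>d \<mapsto> a b + b a\<close> is an injective
  homomorphism, the theorem can be checked in the variables \<open>a\<close>, \<open>b\<close>, provided that all the
  cd-indices involved exist. There the local cd-index of \<open>\<Gamma>\<^sub>x\<close> becomes
  \<open>\<Psi>(\<Gamma>\<^sub>x) - \<Psi>(\<partial>\<Gamma>\<^sub>x) a\<close>, and expanding the chains of \<open>\<partial>\<Gamma>\<close> by their largest element and the chains
  of the intervals \<open>(x, 1)\<close> by their smallest one makes both sides agree term by term.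

  The cd-indices exist because the semisuspensions and boundaries of the \<open>\<Gamma>\<^sub>x\<close> are boundaries of Eulerian
  posets: \<open>\<partial>\<Gamma>\<^sub>x\<close> consists of the elements mapped strictly below \<open>x\<close>, and the condition on the fibres
  turns the alternating sums over upper sets of \<open>\<Gamma>\<^sub>x\<close> into alternating sums over intervals of \<open>B\<close>.
\<close>

section \<open>Substitution into noncommutative polynomials\<close>

text \<open>\<open>cd_index_bd\<close> is a definite description, so nothing can be computed from it
  until some polynomial in c and d with the given ab-index is known to exist. That is the main
  obstacle: existence has to be proved for every boundary of an Eulerian poset, and the Eulerian
  relations have to be verified for each boundary and semisuspension that occurs. Working with e
  instead of a removes the signs of the flag h-vector: a chain contributes one product of letters,
  so chains can be cut at any element. The summand of the top of B is the local cd-index of \<Gamma>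
  itself, and the cd-index of \<Gamma> is this local index plus the cd-index of its boundary. What
  has to be shown is therefore a formula for the boundary of \<Gamma> as a sum over the elements
  strictly below the top. There an element y of \<Gamma> may have smaller rank than its image; the
  gap is filled by a power of e, which makes sense because subdivisions are rank-increasing. The
  cd-indices of the intervals of B need no separate treatment, since the identity map of an interval
  is itself a subdivision.\<close>

lemma poly_mapping_sum_induct [case_names single add]:
  assumes single: "\<And>w k. P (Poly_Mapping.single w k)"
    and add: "\<And>p q. P p \<Longrightarrow> P q \<Longrightarrow> P (p + q)"
  shows "P (p :: 'a \<Rightarrow>\<^sub>0 'b::comm_monoid_add)"
proof -
  have p: "p = (\<Sum>w\<in>Poly_Mapping.keys p. Poly_Mapping.single w (Poly_Mapping.lookup p w))"
  proof (rule poly_mapping_eqI)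
    fix w
    show "Poly_Mapping.lookup p w = Poly_Mapping.lookup
        (\<Sum>w\<in>Poly_Mapping.keys p. Poly_Mapping.single w (Poly_Mapping.lookup p w)) w"
      by (simp add: lookup_sum lookup_single when_def in_keys_iff)
  qed
  have "P (\<Sum>w\<in>A. Poly_Mapping.single w (Poly_Mapping.lookup p w))" if "finite A" for A
    using that
  proof induction
    case empty
    show ?case using single[of undefined 0] by simp
  qed (simp add: single add)
  then show ?thesis by (subst p) simp
qed

lemma nc_const_commute: "nc_const k * p = p * nc_const k" for k :: "'k::field_char_0"
  by (induction p rule: poly_mapping_sum_induct)
    (simp_all add: nc_const_def mult_single mult.commute distrib_left distrib_right)

lemma nc_const_simps [simp]:
  "nc_const 0 = 0" "nc_const 1 = 1" "nc_const (of_int i) = of_int i"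
  "nc_const (j + k) = nc_const j + nc_const k" "nc_const (j * k) = nc_const j * nc_const k"
  by (simp_all add: nc_const_def single_add mult_single)

text \<open>Keys may cancel in a sum; additivity is proved by comparing sums over one common finite
  set of words.\<close>

lemma nc_subst_superset:
  assumes "finite A" "Poly_Mapping.keys p \<subseteq> A"
  shows "nc_subst f p =
    (\<Sum>w\<in>A. nc_const (Poly_Mapping.lookup p w) * prod_list (map f (letters w)))"
  unfolding nc_subst_def using assms
  by (intro sum.mono_neutral_left) (auto simp: in_keys_iff)

lemma nc_subst_single:
  "nc_subst f (Poly_Mapping.single w k) = nc_const k * prod_list (map f (letters w))"
  using nc_subst_superset[of "{w}" "Poly_Mapping.single w k" f] by simp

lemma nc_subst_add [simp]: "nc_subst f (p + q) = nc_subst f p + nc_subst f q"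
proof -
  let ?A = "Poly_Mapping.keys p \<union> Poly_Mapping.keys q"
  have "Poly_Mapping.keys (p + q) \<subseteq> ?A" by (rule Poly_Mapping.keys_add)
  then show ?thesis
    by (simp add: nc_subst_superset[of ?A] lookup_add distrib_right sum.distrib)
qed

lemma nc_subst_const [simp]: "nc_subst f (nc_const k) = nc_const k"
  by (simp add: nc_const_def nc_subst_single zero_free_word_def)

lemma nc_subst_0 [simp]: "nc_subst f 0 = 0"
  using nc_subst_const[of f 0] by simp

lemma nc_subst_1 [simp]: "nc_subst f 1 = 1"
  using nc_subst_const[of f 1] by simp

lemma nc_subst_monom [simp]: "nc_subst f (nc_monom [x]) = f x"
  by (simp add: nc_monom_def nc_subst_single)

lemma nc_subst_mult [simp]: "nc_subst f (p * q) = nc_subst f p * nc_subst f q"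
proof (induction p rule: poly_mapping_sum_induct)
  case p: (single w k)
  show ?case
  proof (induction q rule: poly_mapping_sum_induct)
    case (single v l)
    have "nc_const k * nc_const l * (prod_list (map f (letters w)) * prod_list (map f (letters v)))
        = nc_const k * (prod_list (map f (letters w)) * nc_const l) * prod_list (map f (letters v))"
      by (simp only: mult.assoc nc_const_commute[of l "prod_list (map f (letters w))", symmetric])
    then show ?case
      by (simp add: mult_single nc_subst_single plus_free_word_def mult.assoc)
  qed (simp add: distrib_left)
qed (simp add: distrib_right)

lemma nc_subst_uminus [simp]: "nc_subst f (- p) = - nc_subst f p"
proof -
  have "nc_subst f p + nc_subst f (- p) = nc_subst f (p + - p)" by (rule nc_subst_add[symmetric])
  also have "\<dots> = 0" by simp
  finally show ?thesis by (simp add: eq_neg_iff_add_eq_0 add.commute)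
qed

lemma nc_subst_diff [simp]: "nc_subst f (p - q) = nc_subst f p - nc_subst f q"
  using nc_subst_add[of f p "- q"] by simp

lemma nc_subst_sum [simp]: "nc_subst f (sum g A) = (\<Sum>x\<in>A. nc_subst f (g x))"
  by (induction A rule: infinite_finite_induct) auto

text \<open>Strips the leading letter \<open>x\<close> and drops all words that do not begin with
  it. It is \<open>map_key\<close> along the injection that prepends \<open>x\<close>, and allows
  polynomials to be compared letter by letter.\<close>

definition left_quotient :: "'x \<Rightarrow> ('x, 'k::field_char_0) ncpoly \<Rightarrow> ('x, 'k) ncpoly" where
  "left_quotient x p = Poly_Mapping.map_key (\<lambda>w. Free_Word (x # letters w)) p"

lemma lookup_left_quotient [simp]:
  "Poly_Mapping.lookup (left_quotient x p) w = Poly_Mapping.lookup p (Free_Word (x # letters w))"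
  unfolding left_quotient_def by (subst map_key.rep_eq) (auto intro!: injI free_word.expand)

lemma left_quotient_add [simp]:
  "left_quotient x (p + q) = left_quotient x p + left_quotient x q"
  by (rule poly_mapping_eqI) (simp add: lookup_add)

lemma left_quotient_0 [simp]: "left_quotient x 0 = 0"
  by (rule poly_mapping_eqI) simp

lemma left_quotient_monom_mult [simp]:
  "left_quotient x (nc_monom [y] * p) = (if x = y then p else 0)"
proof (induction p rule: poly_mapping_sum_induct)
  case (single w k)
  have "\<And>v. Free_Word (y # letters w) = Free_Word (x # letters v) \<longleftrightarrow> x = y \<and> w = v"
    by (auto intro: free_word.expand)
  then show ?case
    by (intro poly_mapping_eqI) (auto simp: nc_monom_def mult_single lookup_single plus_free_word_def)
qed (auto simp: distrib_left)

lemma left_quotient_const [simp]: "left_quotient x (nc_const k) = 0"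
  by (rule poly_mapping_eqI) (simp add: nc_const_def lookup_single zero_free_word_def)

lemma lookup_monom_mult_0 [simp]: "Poly_Mapping.lookup (nc_monom [x] * p) 0 = 0"
proof (induction p rule: poly_mapping_sum_induct)
  case (single w k)
  show ?case
    by (auto simp: nc_monom_def mult_single lookup_single plus_free_word_def zero_free_word_def)
qed (simp add: distrib_left lookup_add)

lemma cd_poly_decompose:
  "p = nc_const (Poly_Mapping.lookup p 0) +
    (nc_monom [Lc] * left_quotient Lc p + nc_monom [Ld] * left_quotient Ld p)" (is "p = ?q")
proof (rule poly_mapping_eqI)
  fix w
  show "Poly_Mapping.lookup p w = Poly_Mapping.lookup ?q w"
  proof (cases "letters w")
    case Nil
    then have "w = 0" by (simp add: zero_free_word_def free_word.expand)
    then show ?thesis by (simp add: lookup_add nc_const_def)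
  next
    case (Cons x ws)
    then have w: "w = Free_Word (x # letters (Free_Word ws))"
      by (simp add: free_word.expand)
    have "left_quotient x p = left_quotient x ?q"
      by (cases x) simp_all
    then show ?thesis
      unfolding w lookup_left_quotient[symmetric] by simp
  qed
qed

text \<open>Sorted by first letters, the image is a constant plus a(u + b v) + b(u + a v), where u
  and v are the images of the left quotients by c and d. If it vanishes, then u + b v = 0 = u + a v,
  hence b v = a v, so v = 0 and u = 0. The left quotients are then in the kernel too, and induction
  along a word shows that its coefficient is 0.\<close>

lemma nc_subst_cd_to_ab_eq_0:
  fixes p :: "(cd_letter, 'k::field_char_0) ncpoly"
  assumes "nc_subst cd_to_ab p = 0"
  shows "p = 0"
proof -
  have *: "Poly_Mapping.lookup p 0 = 0 \<and> nc_subst cd_to_ab (left_quotient Lc p) = 0 \<and>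
      nc_subst cd_to_ab (left_quotient Ld p) = 0"
    if "nc_subst cd_to_ab p = 0" for p :: "(cd_letter, 'k) ncpoly"
  proof -
    let ?a = "nc_monom [La] :: (ab_letter, 'k) ncpoly"
    let ?b = "nc_monom [Lb] :: (ab_letter, 'k) ncpoly"
    let ?u = "nc_subst cd_to_ab (left_quotient Lc p) :: (ab_letter, 'k) ncpoly"
    let ?v = "nc_subst cd_to_ab (left_quotient Ld p) :: (ab_letter, 'k) ncpoly"
    have "nc_const (Poly_Mapping.lookup p 0) + ((?a + ?b) * ?u + (?a * ?b + ?b * ?a) * ?v) = 0"
      using that by (subst (asm) cd_poly_decompose) simp
    then have 0: "nc_const (Poly_Mapping.lookup p 0) + (?a * (?u + ?b * ?v) + ?b * (?u + ?a * ?v)) = 0"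
      by (simp add: algebra_simps)
    have "Poly_Mapping.lookup p 0 = 0"
      using arg_cong[OF 0, of "\<lambda>q. Poly_Mapping.lookup q 0"]
      by (simp add: lookup_add nc_const_def del: distrib_left)
    moreover have 1: "?u + ?b * ?v = 0" using arg_cong[OF 0, of "left_quotient La"] by simp
    moreover have 2: "?u + ?a * ?v = 0" using arg_cong[OF 0, of "left_quotient Lb"] by simp
    from 1 2 have "?b * ?v = ?a * ?v" by (metis add_left_cancel)
    then have "?v = 0"
      using left_quotient_monom_mult[of La Lb ?v] left_quotient_monom_mult[of La La ?v] by simp
    ultimately show ?thesis by simp
  qed
  have "Poly_Mapping.lookup p (Free_Word ws) = 0" for ws
    using assms
  proof (induction ws arbitrary: p)
    case Nil
    then show ?case using *[of p] by (simp add: zero_free_word_def)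
  next
    case (Cons x ws)
    have "nc_subst cd_to_ab (left_quotient x p) = 0"
      using *[OF Cons.prems] by (cases x) simp_all
    from Cons.IH[OF this] show ?case by simp
  qed
  then show ?thesis by (intro poly_mapping_eqI) (metis free_word.exhaust lookup_zero)
qed

lemma inj_cd_to_ab: "inj (nc_subst (cd_to_ab :: cd_letter \<Rightarrow> (ab_letter, 'k::field_char_0) ncpoly))"
proof (rule injI)
  fix p q :: "(cd_letter, 'k) ncpoly"
  assume "nc_subst cd_to_ab p = nc_subst cd_to_ab q"
  then have "nc_subst cd_to_ab (p - q) = 0" by simp
  then have "p - q = 0" by (rule nc_subst_cd_to_ab_eq_0)
  then show "p = q" by simp
qed

section \<open>The subalgebra generated by c and d\<close>

abbreviation ab_a :: "(ab_letter, 'k::field_char_0) ncpoly" where "ab_a \<equiv> nc_monom [La]"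
abbreviation ab_b :: "(ab_letter, 'k::field_char_0) ncpoly" where "ab_b \<equiv> nc_monom [Lb]"

text \<open>Membership of an ab-index says that the cd-index exists, which is what
  \<open>nc_subst_cd_index_bd\<close> needs to evaluate the description in
  \<open>cd_index_bd\<close>.\<close>

definition cd_polys :: "(ab_letter, 'k::field_char_0) ncpoly set" where
  "cd_polys = range (nc_subst cd_to_ab)"

lemma cd_polys_add: "p \<in> cd_polys \<Longrightarrow> q \<in> cd_polys \<Longrightarrow> p + q \<in> cd_polys"
  unfolding cd_polys_def by (auto simp flip: nc_subst_add)

lemma cd_polys_mult: "p \<in> cd_polys \<Longrightarrow> q \<in> cd_polys \<Longrightarrow> p * q \<in> cd_polys"
  unfolding cd_polys_def by (auto simp flip: nc_subst_mult)

lemma cd_polys_diff: "p \<in> cd_polys \<Longrightarrow> q \<in> cd_polys \<Longrightarrow> p - q \<in> cd_polys"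
  unfolding cd_polys_def by (auto simp flip: nc_subst_diff)

lemma cd_polys_const: "nc_const k \<in> cd_polys"
  unfolding cd_polys_def using nc_subst_const by (metis rangeI)

lemma cd_polys_of_int: "of_int i \<in> cd_polys"
  using cd_polys_const[of "of_int i"] by simp

lemma cd_polys_sum: "(\<And>x. x \<in> A \<Longrightarrow> g x \<in> cd_polys) \<Longrightarrow> sum g A \<in> cd_polys"
  using cd_polys_of_int[of 0]
  by (induction A rule: infinite_finite_induct) (auto intro: cd_polys_add)

lemma cd_polys_c: "ab_a + ab_b \<in> cd_polys"
  unfolding cd_polys_def using nc_subst_monom[of cd_to_ab Lc] by (metis cd_to_ab.simps(1) rangeI)

text \<open>The squares aa - ab - ba + bb of e and aa + ab + ba + bb of c differ by twice d.\<close>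

lemma cd_polys_e_even:
  assumes "even n"
  shows "(ab_a - ab_b :: (ab_letter, 'k::field_char_0) ncpoly) ^ n \<in> cd_polys"
proof -
  have "ab_a * ab_b + ab_b * ab_a \<in> (cd_polys :: (ab_letter, 'k) ncpoly set)"
    unfolding cd_polys_def using nc_subst_monom[of cd_to_ab Ld]
    by (metis cd_to_ab.simps(2) rangeI)
  moreover have "(ab_a - ab_b :: (ab_letter, 'k) ncpoly) ^ 2
      = (ab_a + ab_b) * (ab_a + ab_b) - of_int 2 * (ab_a * ab_b + ab_b * ab_a)"
    by (simp add: power2_eq_square algebra_simps mult_2)
  ultimately have e2: "(ab_a - ab_b :: (ab_letter, 'k) ncpoly) ^ 2 \<in> cd_polys"
    using cd_polys_diff[OF cd_polys_mult[OF cd_polys_c cd_polys_c]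
        cd_polys_mult[OF cd_polys_of_int[of 2]]] by metis
  obtain m where n: "n = 2 * m" using assms by blast
  have "((ab_a - ab_b :: (ab_letter, 'k) ncpoly) ^ 2) ^ m \<in> cd_polys"
    using cd_polys_of_int[of 1] by (induction m) (auto intro!: cd_polys_mult e2 simp del: power2_eq_square)
  then show ?thesis by (simp add: n power_mult)
qed

text \<open>Characteristic 0 is used here: the symmetrised recursion for ab-indices yields only 4
  times the desired polynomial.\<close>

lemma cd_polys_cancel:
  assumes "of_int i * p \<in> cd_polys" "i \<noteq> 0"
  shows "p \<in> (cd_polys :: (ab_letter, 'k::field_char_0) ncpoly set)"
proof -
  have "nc_const (inverse (of_int i)) * nc_const (of_int i) = (1 :: (ab_letter, 'k) ncpoly)"
    using assms(2) by (simp flip: nc_const_simps(5) del: nc_const_simps(3))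
  then have "p = nc_const (inverse (of_int i)) * (of_int i * p)"
    by (simp flip: mult.assoc)
  then show ?thesis by (metis assms(1) cd_polys_const cd_polys_mult)
qed

lemma nc_subst_cd_index_bd:
  assumes "ab_index P \<in> (cd_polys :: (ab_letter, 'k::field_char_0) ncpoly set)"
  shows "nc_subst cd_to_ab (cd_index_bd P) = (ab_index P :: (ab_letter, 'k) ncpoly)"
proof -
  obtain p :: "(cd_letter, 'k) ncpoly" where p: "nc_subst cd_to_ab p = ab_index P"
    using assms unfolding cd_polys_def by auto
  then have "cd_index_bd P = p"
    unfolding cd_index_bd_def by (intro the_equality) (auto intro: injD[OF inj_cd_to_ab])
  then show ?thesis using p by simp
qed

section \<open>Weighted sums over chains\<close>

abbreviation ab_e :: "(ab_letter, 'k::field_char_0) ncpoly" where "ab_e \<equiv> ab_a - ab_b"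

text \<open>The positions form the half-open range \<open>[i..<j]\<close>, so that weights of
  adjacent ranges multiply.\<close>

definition flag_weight :: "nat \<Rightarrow> nat \<Rightarrow> nat set \<Rightarrow> (ab_letter, 'k::field_char_0) ncpoly" where
  "flag_weight i j T = prod_list (map (\<lambda>k. if k \<in> T then ab_b else ab_e) [i..<j])"

definition chain_sum ::
  "'p rel \<Rightarrow> ('p \<Rightarrow> nat) \<Rightarrow> 'p set \<Rightarrow> nat \<Rightarrow> nat \<Rightarrow> (ab_letter, 'k::field_char_0) ncpoly" where
  "chain_sum P r A i j = (\<Sum>C | C \<in> Chains P \<and> C \<subseteq> A. flag_weight i j (r ` C))"

lemma flag_weight_cong:
  "(\<And>k. i \<le> k \<Longrightarrow> k < j \<Longrightarrow> k \<in> S \<longleftrightarrow> k \<in> T) \<Longrightarrow> flag_weight i j S = flag_weight i j T"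
  unfolding flag_weight_def by (intro arg_cong[where f = prod_list] map_cong) auto

lemma flag_weight_empty: "flag_weight i j {} = ab_e ^ (j - i)"
  by (simp add: flag_weight_def map_replicate_const)

lemma flag_weight_split:
  assumes "i \<le> k" "k < j"
  shows "flag_weight i j (insert k T) = flag_weight i k T * ab_b * flag_weight (Suc k) j T"
proof -
  have "[i..<j] = [i..<k] @ k # [Suc k..<j]"
    using assms upt_add_eq_append[of i k "j - k"] by (simp add: upt_conv_Cons)
  then have "flag_weight i j (insert k T)
      = flag_weight i k (insert k T) * ab_b * flag_weight (Suc k) j (insert k T)"
    by (simp add: flag_weight_def mult.assoc)
  also have "flag_weight i k (insert k T) = flag_weight i k T"
    by (auto intro: flag_weight_cong)
  also have "flag_weight (Suc k) j (insert k T) = flag_weight (Suc k) j T"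
    by (auto intro: flag_weight_cong)
  finally show ?thesis .
qed

lemma flag_weight_above: "(\<And>k. k \<in> T \<Longrightarrow> k < i) \<Longrightarrow> flag_weight i j T = ab_e ^ (j - i)"
  unfolding flag_weight_empty[symmetric] by (intro flag_weight_cong) force

lemma flag_weight_below: "(\<And>k. k \<in> T \<Longrightarrow> j \<le> k) \<Longrightarrow> flag_weight i j T = ab_e ^ (j - i)"
  unfolding flag_weight_empty[symmetric] by (intro flag_weight_cong) force

lemma flag_weight_shift:
  "flag_weight (i + m) (j + m) ((\<lambda>k. k + m) ` T) = flag_weight i j T"
proof -
  have "[i + m..<j + m] = map (\<lambda>k. k + m) [i..<j]"
    by (induction j) auto
  then show ?thesis unfolding flag_weight_def
    by (auto simp: comp_def intro!: arg_cong[where f = prod_list])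
qed

text \<open>Multiplying out the factors a - b at the positions outside \<open>T\<close> selects the
  set \<open>S\<close> of positions that carry b; each selected position outside \<open>T\<close>
  brings a minus sign. Elements of \<open>T\<close> beyond \<open>n\<close> do not affect the
  product.\<close>

lemma flag_weight_expand:
  "(flag_weight 1 (Suc n) T :: (ab_letter, 'k::field_char_0) ncpoly) =
    (\<Sum>S | S \<subseteq> {1..n} \<and> T \<inter> {1..n} \<subseteq> S. of_int ((- 1) ^ card (S - T)) * nc_monom (ab_word n S))"
proof (induction n)
  case 0
  have "{S. S \<subseteq> {1..0::nat} \<and> T \<inter> {1..0} \<subseteq> S} = {{}}" by auto
  then show ?case
    by (simp add: flag_weight_def ab_word_def nc_monom_def flip: zero_free_word_def)
next
  case (Suc n)
  let ?I = "\<lambda>n. {S. S \<subseteq> {1..n} \<and> T \<inter> {1..n} \<subseteq> S}"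
  let ?f = "\<lambda>n S. of_int ((- 1) ^ card (S - T)) * nc_monom (ab_word n S)
    :: (ab_letter, 'k) ncpoly"
  have monom_append: "nc_monom (xs @ [x]) = (nc_monom xs * nc_monom [x] :: (ab_letter, 'k) ncpoly)"
    for xs x
    by (simp add: nc_monom_def mult_single plus_free_word_def)
  have fin: "finite (?I n)" for n by simp
  have sub: "S \<subseteq> {1..n}" "Suc n \<notin> S" "finite S" if "S \<in> ?I n" for S
    using that finite_subset[of S "{1..n}"] by auto
  have f0: "?f (Suc n) S = ?f n S * ab_a" if "S \<in> ?I n" for S
    using sub[OF that] by (simp add: ab_word_def monom_append mult.assoc)
  have word: "ab_word (Suc n) (insert (Suc n) S) = ab_word n S @ [Lb]" for S
    by (simp add: ab_word_def)
  have f1: "?f (Suc n) (insert (Suc n) S) = (if Suc n \<in> T then ?f n S else - ?f n S) * ab_b"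
    if "S \<in> ?I n" for S
  proof (cases "Suc n \<in> T")
    case True
    then show ?thesis by (simp add: word monom_append mult.assoc)
  next
    case False
    then have "insert (Suc n) S - T = insert (Suc n) (S - T)" by auto
    then show ?thesis using False sub[OF that] by (simp add: word monom_append mult.assoc)
  qed
  have inj: "inj_on (insert (Suc n)) (?I n)"
    by (rule inj_onI) (metis sub(2) insert_ident)
  \<comment> \<open>The last position may be left out of \<open>S\<close> only if it is not in
    \<open>T\<close>.\<close>
  have split: "S \<in> ?I (Suc n) \<longleftrightarrow> S \<in> (if Suc n \<in> T then {} else ?I n) \<union> insert (Suc n) ` ?I n" for S
  proof (cases "Suc n \<in> S")
    case True
    then have S: "S = insert (Suc n) (S - {Suc n})" by auto
    have "S \<in> ?I (Suc n) \<longleftrightarrow> S - {Suc n} \<in> ?I n"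
      using True by (auto simp: atLeastAtMostSuc_conv)
    also have "\<dots> \<longleftrightarrow> S \<in> insert (Suc n) ` ?I n"
    proof
      assume "S - {Suc n} \<in> ?I n"
      then show "S \<in> insert (Suc n) ` ?I n" by (rule rev_image_eqI) (rule S)
    next
      assume "S \<in> insert (Suc n) ` ?I n"
      then obtain S' where S': "S' \<in> ?I n" "S = insert (Suc n) S'" by blast
      then have "S - {Suc n} = S'" using sub(2)[of S'] by simp
      then show "S - {Suc n} \<in> ?I n" using S'(1) by simp
    qed
    finally show ?thesis using True by auto
  next
    case False
    then have "S \<notin> insert (Suc n) ` ?I n" by auto
    then show ?thesis using False by (auto simp: atLeastAtMostSuc_conv)
  qed
  have I: "?I (Suc n) = (if Suc n \<in> T then {} else ?I n) \<union> insert (Suc n) ` ?I n"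
    by (rule set_eqI) (rule split)
  define J where "J = ?I n"
  define J0 where "J0 = (if Suc n \<in> T then {} else J)"
  have J: "finite J" "finite J0" "J0 \<inter> insert (Suc n) ` J = {}" "inj_on (insert (Suc n)) J"
    using fin[of n] sub(2) inj by (auto simp: J_def J0_def)
  have "(\<Sum>S\<in>?I (Suc n). ?f (Suc n) S) = sum (?f (Suc n)) (J0 \<union> insert (Suc n) ` J)"
    unfolding J_def J0_def by (rule sum.cong[OF I refl])
  also have "\<dots> = (\<Sum>S\<in>J0. ?f (Suc n) S) + (\<Sum>S\<in>J. ?f (Suc n) (insert (Suc n) S))"
    using J by (simp add: sum.union_disjoint sum.reindex)
  also have "(\<Sum>S\<in>J. ?f (Suc n) (insert (Suc n) S)) =
      (\<Sum>S\<in>J. (if Suc n \<in> T then ?f n S else - ?f n S) * ab_b)"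
    by (rule sum.cong[OF refl]) (unfold J_def, rule f1)
  also have "(\<Sum>S\<in>J0. ?f (Suc n) S) = (\<Sum>S\<in>J0. ?f n S * ab_a)"
    by (rule sum.cong[OF refl], rule f0) (simp add: J0_def J_def split: if_splits)
  also have "(\<Sum>S\<in>J0. ?f n S * ab_a) + (\<Sum>S\<in>J. (if Suc n \<in> T then ?f n S else - ?f n S) * ab_b)
      = (\<Sum>S\<in>J. ?f n S) * (if Suc n \<in> T then ab_b else ab_e)"
  proof (cases "Suc n \<in> T")
    case False
    have "(\<Sum>S\<in>J. - ?f n S * ab_b) = - ((\<Sum>S\<in>J. ?f n S) * ab_b)"
      by (simp only: sum_negf minus_mult_left[symmetric] sum_distrib_right)
    then show ?thesis
      using False by (simp only: J0_def if_False sum_distrib_right[symmetric] right_diff_distrib) simp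
  qed (simp add: J0_def flip: sum_distrib_right)
  also have "\<dots> = flag_weight 1 (Suc (Suc n)) T"
    unfolding J_def Suc.IH[symmetric] by (simp add: flag_weight_def)
  finally show ?case by simp
qed

lemma finite_chains_subset: "finite A \<Longrightarrow> finite {C. C \<in> Chains P \<and> C \<subseteq> A}"
  by (rule finite_subset[of _ "Pow A"]) auto

lemma Chains_mono_subset: "C \<in> Chains P \<Longrightarrow> D \<subseteq> C \<Longrightarrow> D \<in> Chains P"
  unfolding Chains_def by blast

text \<open>As \<open>r\<close> increases strictly on \<open>A\<close>, an element of largest rank
  in a nonempty chain lies above all the others; removing it leaves an arbitrary chain strictly
  below it.\<close>

lemma chains_by_Max:
  assumes "finite A" "Refl P" "A \<subseteq> Field P"
    and mono: "\<And>x y. x \<in> A \<Longrightarrow> y \<in> A \<Longrightarrow> (x, y) \<in> P \<Longrightarrow> x \<noteq> y \<Longrightarrow> r x < (r y :: nat)"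
  shows "{C. C \<in> Chains P \<and> C \<subseteq> A} = insert {}
    (\<Union>y\<in>A. insert y ` {C. C \<in> Chains P \<and> C \<subseteq> {w \<in> A. (w, y) \<in> P \<and> w \<noteq> y}})" (is "?X = ?Y")
proof
  show "?X \<subseteq> ?Y"
  proof
    fix C assume C: "C \<in> ?X"
    show "C \<in> ?Y"
    proof (cases "C = {}")
      case False
      have "finite C" using C assms(1) finite_subset by auto
      then obtain y where y: "y \<in> C" "r y = Max (r ` C)"
        using False by (metis (no_types, lifting) Max_in finite_imageI image_iff image_is_empty)
      have "(w, y) \<in> P" if "w \<in> C" for w
      proof -
        have "r w \<le> r y" using that y \<open>finite C\<close> by simp
        then have "\<not> ((y, w) \<in> P \<and> w \<noteq> y)" using mono[of y w] that y C by auto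
        then show ?thesis using C that y by (auto simp: Chains_def)
      qed
      then have "C - {y} \<in> {C. C \<in> Chains P \<and> C \<subseteq> {w \<in> A. (w, y) \<in> P \<and> w \<noteq> y}}"
        using C Chains_mono_subset[of C P "C - {y}"] by auto
      then have "C \<in> insert y ` {C. C \<in> Chains P \<and> C \<subseteq> {w \<in> A. (w, y) \<in> P \<and> w \<noteq> y}}"
        using y by (intro rev_image_eqI[of "C - {y}"]) auto
      then show ?thesis using y C by blast
    qed simp
  qed
  show "?Y \<subseteq> ?X"
  proof
    fix D assume "D \<in> ?Y"
    then consider "D = {}" | y C where "y \<in> A" "D = insert y C" "C \<in> Chains P"
      "C \<subseteq> {w \<in> A. (w, y) \<in> P \<and> w \<noteq> y}" by blast
    then show "D \<in> ?X"
    proof cases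
      case 2
      then have "(y, y) \<in> P" using assms(2,3) by (auto simp: refl_on_def)
      then show ?thesis using 2 by (auto simp: Chains_def)
    qed (simp add: Chains_def)
  qed
qed

text \<open>The decomposition is disjoint: if one chain arose from two different largest elements,
  each would lie below the other.\<close>

lemma sum_chains_by_Max:
  assumes "finite A" "Partial_order P" "A \<subseteq> Field P"
    and mono: "\<And>x y. x \<in> A \<Longrightarrow> y \<in> A \<Longrightarrow> (x, y) \<in> P \<Longrightarrow> x \<noteq> y \<Longrightarrow> r x < (r y :: nat)"
  shows "(\<Sum>C | C \<in> Chains P \<and> C \<subseteq> A. (f C :: 'c::comm_monoid_add)) =
    f {} + (\<Sum>y\<in>A. \<Sum>C | C \<in> Chains P \<and> C \<subseteq> {w \<in> A. (w, y) \<in> P \<and> w \<noteq> y}. f (insert y C))"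
proof -
  define Z where "Z y = {C. C \<in> Chains P \<and> C \<subseteq> {w \<in> A. (w, y) \<in> P \<and> w \<noteq> y}}" for y
  have fin: "finite (Z y)" for y
    unfolding Z_def by (rule finite_chains_subset) (simp add: assms(1))
  have Z: "(w, y) \<in> P \<and> w \<noteq> y" if "C \<in> Z y" "w \<in> C" for C w y
    using that unfolding Z_def by blast
  have "Refl P" "antisym P" using assms(2) unfolding order_on_defs by blast+
  have disj: "insert y ` Z y \<inter> insert y' ` Z y' = {}" if "y \<noteq> y'" for y y'
  proof (rule ccontr)
    assume "insert y ` Z y \<inter> insert y' ` Z y' \<noteq> {}"
    then obtain D where "D \<in> insert y ` Z y" "D \<in> insert y' ` Z y'" by blast
    then obtain C C' where C: "C \<in> Z y" "C' \<in> Z y'" "insert y C = insert y' C'"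
      by (metis imageE)
    then have "y \<in> C'" "y' \<in> C" using that by (metis insertE insertI1)+
    then have "(y, y') \<in> P" "(y', y) \<in> P"
      using Z C by blast+
    then show False using antisymD[OF \<open>antisym P\<close>] that by blast
  qed
  have inj: "inj_on (insert y) (Z y)" for y
  proof (rule inj_onI)
    fix C D assume "C \<in> Z y" "D \<in> Z y" and eq: "insert y C = insert y D"
    then have "y \<notin> C" "y \<notin> D" using Z by blast+
    then show "C = D" using eq by (simp add: insert_ident)
  qed
  have "{C. C \<in> Chains P \<and> C \<subseteq> A} = insert {} (\<Union>y\<in>A. insert y ` Z y)"
    unfolding Z_def using assms(1) \<open>Refl P\<close> assms(3) mono by (rule chains_by_Max)
  then have "(\<Sum>C | C \<in> Chains P \<and> C \<subseteq> A. f C) = sum f (insert {} (\<Union>y\<in>A. insert y ` Z y))"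
    by (rule sum.cong) simp
  also have "\<dots> = f {} + sum f (\<Union>y\<in>A. insert y ` Z y)"
    using assms(1) fin by (intro sum.insert) auto
  also have "sum f (\<Union>y\<in>A. insert y ` Z y) = (\<Sum>y\<in>A. sum f (insert y ` Z y))"
    using assms(1) fin disj by (intro sum.UNION_disjoint) simp_all
  also have "\<dots> = (\<Sum>y\<in>A. \<Sum>C\<in>Z y. f (insert y C))"
    by (simp add: sum.reindex[OF inj])
  finally show ?thesis by (simp add: Z_def)
qed

text \<open>All positions after the rank of the largest element carry e; the leading power of e is
  the weight of the empty chain.\<close>

lemma chain_sum_by_Max:
  assumes "finite A" "Partial_order P" "A \<subseteq> Field P"
    and mono: "\<And>x y. x \<in> A \<Longrightarrow> y \<in> A \<Longrightarrow> (x, y) \<in> P \<Longrightarrow> x \<noteq> y \<Longrightarrow> r x < r y"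
    and bounds: "\<And>y. y \<in> A \<Longrightarrow> i \<le> r y \<and> r y < j"
  shows "chain_sum P r A i j = ab_e ^ (j - i) +
    (\<Sum>y\<in>A. chain_sum P r {w \<in> A. (w, y) \<in> P \<and> w \<noteq> y} i (r y) * ab_b * ab_e ^ (j - Suc (r y)))"
proof -
  have *: "flag_weight i j (r ` insert y C) = flag_weight i (r y) (r ` C) * ab_b * ab_e ^ (j - Suc (r y))"
    if "y \<in> A" "C \<subseteq> {w \<in> A. (w, y) \<in> P \<and> w \<noteq> y}" for y C
  proof -
    have "k < r y" if "k \<in> r ` C" for k
      using that \<open>C \<subseteq> _\<close> mono[OF _ \<open>y \<in> A\<close>] by auto
    then have "\<And>k. k \<in> r ` C \<Longrightarrow> k < Suc (r y)" by (simp add: less_SucI)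
    then show ?thesis
      using bounds[OF that(1)] by (simp add: flag_weight_split flag_weight_above)
  qed
  show ?thesis
    unfolding chain_sum_def
    by (subst sum_chains_by_Max[OF assms(1-3) mono])
      (auto simp: flag_weight_empty sum_distrib_right * simp del: image_insert
        intro!: sum.cong)
qed

lemma chain_sum_by_Min:
  assumes "finite A" "Partial_order P" "A \<subseteq> Field P"
    and mono: "\<And>x y. x \<in> A \<Longrightarrow> y \<in> A \<Longrightarrow> (x, y) \<in> P \<Longrightarrow> x \<noteq> y \<Longrightarrow> r x < r y"
    and bounds: "\<And>y. y \<in> A \<Longrightarrow> i \<le> r y \<and> r y < j"
  shows "chain_sum P r A i j = ab_e ^ (j - i) +
    (\<Sum>y\<in>A. ab_e ^ (r y - i) * ab_b * chain_sum P r {w \<in> A. (y, w) \<in> P \<and> w \<noteq> y} (Suc (r y)) j)"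
proof -
  have *: "flag_weight i j (r ` insert y C) = ab_e ^ (r y - i) * ab_b * flag_weight (Suc (r y)) j (r ` C)"
    if "y \<in> A" "C \<subseteq> {w \<in> A. (y, w) \<in> P \<and> w \<noteq> y}" for y C
  proof -
    have "r y < k" if "k \<in> r ` C" for k
      using that \<open>C \<subseteq> _\<close> mono[OF \<open>y \<in> A\<close>] by auto
    then have "\<And>k. k \<in> r ` C \<Longrightarrow> r y \<le> k" by (simp add: less_imp_le)
    then show ?thesis
      using bounds[OF that(1)] by (simp add: flag_weight_split flag_weight_below)
  qed
  \<comment> \<open>The smallest element is the largest one for the converse order. The reversed
    rank is strictly monotone in spite of truncated subtraction, because \<open>r x < j\<close> on
    \<open>A\<close>.\<close>
  define R where "R x = j - r x" for x
  have R: "R x < R y" if "x \<in> A" "y \<in> A" "(x, y) \<in> P\<inverse>" "x \<noteq> y" for x y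
    using mono[of y x] bounds[of x] bounds[of y] that unfolding R_def by fastforce
  have conv: "Chains (P\<inverse>) = Chains P" by (auto simp: Chains_def)
  have "Partial_order (P\<inverse>)" "A \<subseteq> Field (P\<inverse>)"
    using assms(2,3) by simp_all
  note sum = sum_chains_by_Max[OF assms(1) this R, unfolded conv converse_iff]
  show ?thesis
    unfolding chain_sum_def
    by (subst sum)
      (auto simp: flag_weight_empty sum_distrib_left * simp del: image_insert
        intro!: sum.cong)
qed

lemma chain_sum_shift:
  "(\<And>x. x \<in> A \<Longrightarrow> r x = s x + m) \<Longrightarrow> chain_sum P r A (i + m) (j + m) = chain_sum P s A i j"
proof -
  assume *: "\<And>x. x \<in> A \<Longrightarrow> r x = s x + m"
  have "flag_weight (i + m) (j + m) (r ` C) = flag_weight i j (s ` C)" if "C \<subseteq> A" for C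
  proof -
    have "r ` C = (\<lambda>k. k + m) ` s ` C" using * that by (force simp: image_image)
    then show ?thesis by (simp add: flag_weight_shift)
  qed
  then show ?thesis unfolding chain_sum_def by (intro sum.cong) auto
qed

lemma chain_sum_Restr:
  "A \<subseteq> X \<Longrightarrow> chain_sum (Restr P X) r A i j = chain_sum P r A i j"
  unfolding chain_sum_def by (intro sum.cong) (auto simp: Chains_def)

section \<open>Ranked posets\<close>

locale finite_poset =
  fixes P :: "'p rel"
  assumes po: "Partial_order P" and finite_Field: "finite (Field P)"
begin

lemma rel_refl: "x \<in> Field P \<Longrightarrow> (x, x) \<in> P"
  using po by (simp add: order_on_defs refl_on_def)

lemma antisym: "(x, y) \<in> P \<Longrightarrow> (y, x) \<in> P \<Longrightarrow> x = y"
  using po by (auto simp: order_on_defs dest: antisymD)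

lemma trans: "(x, y) \<in> P \<Longrightarrow> (y, w) \<in> P \<Longrightarrow> (x, w) \<in> P"
  using po by (meson order_on_defs transD)

lemma in_Field: "(x, y) \<in> P \<Longrightarrow> x \<in> Field P" "(x, y) \<in> P \<Longrightarrow> y \<in> Field P"
  by (auto intro: FieldI1 FieldI2)

lemma converse: "finite_poset (P\<inverse>)"
  using po finite_Field by (simp add: finite_poset_def)

lemma finite_below: "finite {v. (v, w) \<in> P}"
  by (rule finite_subset[OF _ finite_Field]) (auto intro: FieldI1)

lemma finite_above: "finite {v. (w, v) \<in> P}"
  by (rule finite_subset[OF _ finite_Field]) (auto intro: FieldI2)

lemma ex_minimal:
  assumes "Q y"
  shows "\<exists>w. Q w \<and> (\<forall>v. Q v \<longrightarrow> (v, w) \<in> P \<longrightarrow> v = w)"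
proof -
  obtain w where w: "Q w" "\<And>v. Q v \<Longrightarrow> card {u. (u, w) \<in> P} \<le> card {u. (u, v) \<in> P}"
    using ex_has_least_nat[of Q y "\<lambda>w. card {u. (u, w) \<in> P}"] assms by auto
  have "v = w" if "Q v" "(v, w) \<in> P" for v
  proof (rule ccontr)
    assume "v \<noteq> w"
    then have "w \<notin> {u. (u, v) \<in> P}" "w \<in> {u. (u, w) \<in> P}"
      using antisym[OF that(2)] rel_refl in_Field[OF that(2)] by auto
    moreover have "{u. (u, v) \<in> P} \<subseteq> {u. (u, w) \<in> P}" using trans that(2) by blast
    ultimately have "card {u. (u, v) \<in> P} < card {u. (u, w) \<in> P}"
      by (intro psubset_card_mono finite_below) blast
    then show False using w(2)[OF that(1)] by simp
  qed
  then show ?thesis using w(1) by blast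
qed

lemma ex_cover:
  assumes "(x, y) \<in> P" "x \<noteq> y"
  obtains w where "covers P w x" "(w, y) \<in> P"
proof -
  obtain w where w: "(x, w) \<in> P" "x \<noteq> w" "(w, y) \<in> P"
    "\<And>v. (x, v) \<in> P \<Longrightarrow> x \<noteq> v \<Longrightarrow> (v, y) \<in> P \<Longrightarrow> (v, w) \<in> P \<Longrightarrow> v = w"
    using ex_minimal[of "\<lambda>w. (x, w) \<in> P \<and> x \<noteq> w \<and> (w, y) \<in> P" y] assms rel_refl in_Field[OF assms(1)]
    by blast
  have "covers P w x" unfolding covers_def using w trans by metis
  then show ?thesis using w(3) that by blast
qed

lemma ex_coatom:
  assumes "(x, y) \<in> P" "x \<noteq> y"
  obtains w where "covers P y w" "(x, w) \<in> P"
proof -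
  interpret c: finite_poset "P\<inverse>" by (rule converse)
  obtain w where "covers (P\<inverse>) w y" "(w, x) \<in> P\<inverse>"
    using c.ex_cover[of y x] assms by auto
  then have "covers P y w" "(x, w) \<in> P" by (auto simp: covers_def)
  then show ?thesis by (rule that)
qed

lemma ex_maximal_above:
  assumes "x \<in> Field P"
  obtains m where "maximal_in P m" "(x, m) \<in> P"
proof -
  interpret c: finite_poset "P\<inverse>" by (rule converse)
  obtain m where m: "(x, m) \<in> P" "\<And>v. (x, v) \<in> P \<Longrightarrow> (m, v) \<in> P \<Longrightarrow> v = m"
    using c.ex_minimal[of "\<lambda>w. (x, w) \<in> P" x] rel_refl[OF assms] by auto
  have "maximal_in P m" unfolding maximal_in_def using m trans in_Field by blast
  then show ?thesis using m(1) that by blast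
qed

lemma ex_minimal_below:
  assumes "x \<in> Field P"
  obtains m where "minimal_in P m" "(m, x) \<in> P"
proof -
  interpret c: finite_poset "P\<inverse>" by (rule converse)
  obtain m where "maximal_in (P\<inverse>) m" "(x, m) \<in> P\<inverse>"
    using c.ex_maximal_above[of x] assms by auto
  then show ?thesis using that by (auto simp: maximal_in_def minimal_in_def)
qed

lemma Chains_subset_Field: "C \<in> Chains P \<Longrightarrow> C \<subseteq> Field P"
  by (auto simp: Chains_def intro: FieldI1)

lemma ex_maximal_chain:
  assumes "C \<in> Chains P"
  obtains D where "D \<in> maximal_chains P" "C \<subseteq> D"
proof -
  have "finite (Chains P)"
    using finite_Field Chains_subset_Field by (intro finite_subset[of "Chains P" "Pow (Field P)"]) auto
  from finite_has_maximal2[OF this assms] obtain D where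
    D: "D \<in> Chains P" "C \<subseteq> D" "\<forall>E\<in>Chains P. D \<subseteq> E \<longrightarrow> D = E" by blast
  then have "D \<in> maximal_chains P" unfolding maximal_chains_def mem_Collect_eq by metis
  then show ?thesis using D(2) by (rule that)
qed

lemma maximal_chain_insert:
  assumes "C \<in> maximal_chains P" "w \<in> Field P" "\<And>x. x \<in> C \<Longrightarrow> (x, w) \<in> P \<or> (w, x) \<in> P"
  shows "w \<in> C"
proof -
  have "insert w C \<in> Chains P"
    using assms rel_refl by (auto simp: maximal_chains_def Chains_def)
  then show ?thesis using assms(1) by (auto simp: maximal_chains_def)
qed

lemma Field_Restr: "X \<subseteq> Field P \<Longrightarrow> Field (Restr P X) = X"
  by (rule Refl_Field_Restr2) (use po in \<open>simp_all add: order_on_defs\<close>)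

lemma finite_poset_Restr: "finite_poset (Restr P X)"
proof
  show "Partial_order (Restr P X)" by (rule Partial_order_Restr[OF po])
  show "finite (Field (Restr P X))"
    by (rule finite_subset[OF _ finite_Field]) (auto simp: Field_def)
qed

lemma Field_interval: "Field (interval P x y) = {w. (x, w) \<in> P \<and> (w, y) \<in> P}"
  unfolding interval_def by (rule Field_Restr) (auto intro: FieldI1)

lemma interval_iff:
  "(u, v) \<in> interval P x y \<longleftrightarrow> (u, v) \<in> P \<and> (x, u) \<in> P \<and> (v, y) \<in> P"
  unfolding interval_def using trans by blast

lemma covers_interval:
  assumes "covers (interval P x y) v u"
  shows "covers P v u"
  using assms unfolding covers_def interval_iff by (meson trans)

lemma minimal_unique_imp_bot:
  assumes "\<exists>!z. minimal_in P z"
  shows "minimal_in P (zero_hat P)" "x \<in> Field P \<Longrightarrow> (zero_hat P, x) \<in> P"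
proof -
  show m: "minimal_in P (zero_hat P)" unfolding zero_hat_def using assms by (rule theI')
  show "(zero_hat P, x) \<in> P" if "x \<in> Field P"
    using ex_minimal_below[OF that] m assms by metis
qed

end

text \<open>\<open>C\<close> and \<open>U\<close> overlap only in \<open>y\<close>, so their sizes
  add up to one more than that of a maximal chain of \<open>P\<close>. Keeping \<open>U\<close>
  fixed, equal lengths in \<open>P\<close> force equal lengths in the lower interval.\<close>

lemma maximal_chains_interval:
  assumes "finite_poset P" "(x, y) \<in> P" "U \<in> maximal_chains (Restr P {w. (y, w) \<in> P})"
    and "C \<in> maximal_chains (interval P x y)" and x: "\<And>w. w \<in> Field P \<Longrightarrow> (x, w) \<in> P"
  shows "C \<union> U \<in> maximal_chains P" "C \<inter> U = {y}"
proof -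
  interpret finite_poset P by fact
  interpret U: finite_poset "Restr P {w. (y, w) \<in> P}" by (rule finite_poset_Restr)
  interpret I: finite_poset "interval P x y" unfolding interval_def by (rule finite_poset_Restr)
  have FU: "Field (Restr P {w. (y, w) \<in> P}) = {w. (y, w) \<in> P}"
    by (rule Field_Restr) (auto intro: FieldI2)
  have U: "U \<subseteq> {w. (y, w) \<in> P}"
    using assms(3) U.Chains_subset_Field unfolding FU maximal_chains_def by blast
  have C: "C \<subseteq> {w. (x, w) \<in> P \<and> (w, y) \<in> P}"
    using assms(4) I.Chains_subset_Field unfolding Field_interval maximal_chains_def by blast
  have yF: "y \<in> Field P" using assms(2) by (rule FieldI2)
  have yU: "y \<in> U"
    using U rel_refl[OF yF] yF by (intro U.maximal_chain_insert[OF assms(3)]) (auto simp: FU)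
  have yC: "y \<in> C"
    using C rel_refl[OF yF] assms(2)
    by (intro I.maximal_chain_insert[OF assms(4)]) (auto simp: Field_interval interval_iff)
  have chU: "U \<in> Chains P" and chC: "C \<in> Chains P"
    using assms(3,4) by (auto simp: maximal_chains_def Chains_def interval_def)
  show "C \<inter> U = {y}" using U C yU yC antisym by blast
  have "(u, v) \<in> P" if "u \<in> C" "v \<in> U" for u v
    using that C U trans by blast
  then have ch: "C \<union> U \<in> Chains P"
    using chU chC unfolding Chains_def by blast
  have "D = C \<union> U" if D: "D \<in> Chains P" "C \<union> U \<subseteq> D" for D
  proof
    show "D \<subseteq> C \<union> U"
    proof
      fix d assume d: "d \<in> D"
      then have dF: "d \<in> Field P" using D Chains_subset_Field by blast
      have cmp: "(w, d) \<in> P \<or> (d, w) \<in> P" if "w \<in> C \<union> U" for w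
        using D d that unfolding Chains_def by blast
      then consider "(y, d) \<in> P" | "(d, y) \<in> P" using yC by blast
      then show "d \<in> C \<union> U"
      proof cases
        case 1
        have "d \<in> U"
          using 1 cmp U by (intro U.maximal_chain_insert[OF assms(3)]) (auto simp: FU)
        then show ?thesis by simp
      next
        case 2
        have "d \<in> C"
          using 2 cmp C x[OF dF]
          by (intro I.maximal_chain_insert[OF assms(4)]) (auto simp: Field_interval interval_iff)
        then show ?thesis by simp
      qed
    qed
  qed (rule D)
  then show "C \<union> U \<in> maximal_chains P" using ch unfolding maximal_chains_def by blast
qed

text \<open>The rank function is a parameter rather than \<open>rho\<close>, so order ideals can
  keep the ambient rank, and semisuspensions and posets with an added top can extend it; only covers
  and maximal elements have to be checked. The facts \<open>graded\<close>,
  \<open>poset_rank_eq\<close> and \<open>rho_eq\<close> recover the defined notions.\<close>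

locale ranked_poset = finite_poset P for P :: "'p rel" +
  fixes r :: "'p \<Rightarrow> nat" and z :: 'p and n :: nat
  assumes bot_in: "z \<in> Field P" and bot: "x \<in> Field P \<Longrightarrow> (z, x) \<in> P" and rank_bot: "r z = 0"
    and rank_cover: "covers P y x \<Longrightarrow> r y = Suc (r x)"
    and rank_max: "maximal_in P x \<Longrightarrow> r x = n"
begin

lemma rank_mono: "(x, y) \<in> P \<Longrightarrow> x \<noteq> y \<Longrightarrow> r x < r y"
proof (induction "card {v. (x, v) \<in> P}" arbitrary: x rule: less_induct)
  case less
  obtain w where w: "covers P w x" "(w, y) \<in> P" using ex_cover less.prems by blast
  then have xw: "(x, w) \<in> P" "x \<noteq> w" "r w = Suc (r x)"
    using rank_cover by (auto simp: covers_def)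
  show ?case
  proof (cases "w = y")
    case False
    have "{v. (w, v) \<in> P} \<subset> {v. (x, v) \<in> P}"
      using xw antisym[of x w] trans[of x w] rel_refl[of x] in_Field by blast
    then have "card {v. (w, v) \<in> P} < card {v. (x, v) \<in> P}"
      by (intro psubset_card_mono finite_above)
    then show ?thesis using less.hyps[OF _ w(2) False] xw by simp
  qed (use xw in simp)
qed

lemma rank_mono_le: "(x, y) \<in> P \<Longrightarrow> r x \<le> r y"
  using rank_mono[of x y] by (cases "x = y") auto

lemma rank_le: "x \<in> Field P \<Longrightarrow> r x \<le> n"
  by (metis ex_maximal_above rank_max rank_mono_le)

lemma rank_0: "x \<in> Field P \<Longrightarrow> r x = 0 \<longleftrightarrow> x = z"
  using rank_mono[OF bot] rank_bot by force

lemma rank_coverI: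
  assumes "(x, y) \<in> P" "r y = Suc (r x)"
  shows "covers P y x"
  unfolding covers_def
proof (intro conjI allI impI)
  show "x \<noteq> y" using assms by auto
  fix w assume w: "(x, w) \<in> P \<and> (w, y) \<in> P"
  show "w = x \<or> w = y"
  proof (rule ccontr)
    assume "\<not> ?thesis"
    then have "r x < r w" "r w < r y" using w rank_mono by auto
    then show False using assms by simp
  qed
qed (rule assms)

text \<open>The rank maps a maximal chain bijectively onto \<open>{..n}\<close>: comparable elements
  have different ranks, and a skipped rank would leave room for another element.\<close>

lemma card_maximal_chain:
  assumes "C \<in> maximal_chains P"
  shows "card C = n + 1"
proof -
  have chC: "C \<in> Chains P" using assms by (simp add: maximal_chains_def)
  then have CF: "C \<subseteq> Field P" by (rule Chains_subset_Field)
  have cmp: "(x, y) \<in> P \<or> (y, x) \<in> P" if "x \<in> C" "y \<in> C" for x y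
    using chC that unfolding Chains_def by blast
  have "inj_on r C"
  proof (rule inj_onI, rule ccontr)
    fix x y assume "x \<in> C" "y \<in> C" "r x = r y" "x \<noteq> y"
    then show False using cmp[of x y] rank_mono[of x y] rank_mono[of y x] by auto
  qed
  moreover have "r ` C = {..n}"
  proof
    show "r ` C \<subseteq> {..n}" using rank_le CF by auto
    have "k \<in> r ` C" if "k \<le> n" for k
      using that
    proof (induction k)
      case 0
      have "z \<in> C" using CF bot by (intro maximal_chain_insert[OF assms bot_in]) auto
      then show ?case using rank_bot by force
    next
      case (Suc k)
      then obtain x where x: "x \<in> C" "r x = k" by auto
      have lt: "\<exists>y\<in>C. (x, y) \<in> P \<and> y \<noteq> x"
      proof (rule ccontr)
        assume no: "\<not> ?thesis"
        have "\<not> maximal_in P x" using rank_max[of x] x Suc.prems by auto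
        then obtain w where w: "(x, w) \<in> P" "w \<noteq> x"
          using x CF unfolding maximal_in_def by blast
        have "w \<in> C"
        proof (rule maximal_chain_insert[OF assms])
          show "w \<in> Field P" using w by (auto intro: FieldI2)
          fix v assume "v \<in> C"
          then have "(v, x) \<in> P" using no cmp[of v x] x(1) by blast
          then show "(v, w) \<in> P \<or> (w, v) \<in> P" using w trans by blast
        qed
        then show False using no w by blast
      qed
      \<comment> \<open>\<open>y\<close> is the successor of \<open>x\<close> in the chain. A cover
        of \<open>x\<close> below \<open>y\<close> is comparable with the whole chain, so by
        maximality it belongs to it and supplies the rank \<open>Suc k\<close>.\<close>
      obtain y where y: "y \<in> C" "(x, y) \<in> P" "y \<noteq> x"
        "\<And>v. v \<in> C \<Longrightarrow> (x, v) \<in> P \<Longrightarrow> v \<noteq> x \<Longrightarrow> (v, y) \<in> P \<Longrightarrow> v = y"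
        using ex_minimal[of "\<lambda>y. y \<in> C \<and> (x, y) \<in> P \<and> y \<noteq> x"] lt by blast
      obtain w where w: "covers P w x" "(w, y) \<in> P" using ex_cover y by metis
      then have xw: "(x, w) \<in> P" "w \<noteq> x" by (auto simp: covers_def)
      have "w \<in> C"
      proof (rule maximal_chain_insert[OF assms])
        show "w \<in> Field P" using xw by (auto intro: FieldI2)
        fix v assume v: "v \<in> C"
        show "(v, w) \<in> P \<or> (w, v) \<in> P"
        proof (cases "(x, v) \<in> P \<and> v \<noteq> x")
          case True
          then have "(y, v) \<in> P" using y(4)[OF v] cmp[OF v y(1)] rel_refl CF y(1) by blast
          then show ?thesis using w(2) trans by blast
        next
          case False
          then have "(v, x) \<in> P" using cmp[OF v x(1)] rel_refl CF x(1) by blast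
          then show ?thesis using xw(1) trans by blast
        qed
      qed
      then show ?case using rank_cover[OF w(1)] x(2) by force
    qed
    then show "{..n} \<subseteq> r ` C" by auto
  qed
  ultimately show ?thesis using card_image[of r C] by simp
qed

lemma minimal_in_iff: "minimal_in P x \<longleftrightarrow> x = z"
  unfolding minimal_in_def by (metis bot bot_in antisym in_Field(1))

lemma zero_hat_eq: "zero_hat P = z"
  by (simp add: zero_hat_def minimal_in_iff)

lemma graded: "graded_poset P"
proof -
  have "\<exists>!x. minimal_in P x" unfolding minimal_in_iff by blast
  moreover have "card C = card D" if "C \<in> maximal_chains P" "D \<in> maximal_chains P" for C D
    using that by (simp add: card_maximal_chain)
  ultimately show ?thesis
    unfolding graded_poset_def by (intro conjI ballI po finite_Field)
qed

lemma poset_rank_eq: "poset_rank P = n"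
proof -
  obtain C where C: "C \<in> maximal_chains P"
    using ex_maximal_chain[of "{}"] by (auto simp: Chains_def)
  show ?thesis unfolding poset_rank_def
    using card_maximal_chain C by (intro the_equality) auto
qed

lemma interval_ranked:
  assumes "(x, y) \<in> P"
  shows "ranked_poset (interval P x y) (\<lambda>w. r w - r x) x (r y - r x)"
proof -
  interpret I: finite_poset "interval P x y" unfolding interval_def by (rule finite_poset_Restr)
  show ?thesis
  proof
    show "x \<in> Field (interval P x y)"
      using assms rel_refl[of x] in_Field by (auto simp: Field_interval)
    show "(x, w) \<in> interval P x y" if "w \<in> Field (interval P x y)" for w
      using that rel_refl[of x] in_Field by (auto simp: Field_interval interval_iff)
    show "r v - r x = Suc (r u - r x)" if "covers (interval P x y) v u" for u v
    proof -
      have "(x, u) \<in> P" using that by (auto simp: covers_def interval_iff)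
      then show ?thesis using rank_cover[OF covers_interval[OF that]] rank_mono_le by fastforce
    qed
    show "r m - r x = r y - r x" if "maximal_in (interval P x y) m" for m
    proof -
      have "(x, m) \<in> P" "(m, y) \<in> P" and m: "(m, w) \<in> interval P x y \<Longrightarrow> w = m" for w
        using that by (auto simp: maximal_in_def Field_interval)
      then have "y = m" using rel_refl[of y] in_Field by (intro m) (auto simp: interval_iff)
      then show ?thesis by simp
    qed
  qed simp
qed

lemma rho_eq: "x \<in> Field P \<Longrightarrow> rho P x = r x"
  using ranked_poset.poset_rank_eq[OF interval_ranked[OF bot, of x]]
  by (simp add: rho_def zero_hat_eq rank_bot)

lemma poset_rank_interval: "(x, y) \<in> P \<Longrightarrow> poset_rank (interval P x y) = r y - r x"
  by (rule ranked_poset.poset_rank_eq[OF interval_ranked])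

lemma one_hat_eq:
  assumes "t \<in> Field P" "\<And>x. x \<in> Field P \<Longrightarrow> (x, t) \<in> P"
  shows "one_hat P = t" "r t = n" "\<exists>!m. maximal_in P m"
proof -
  have m: "maximal_in P m \<longleftrightarrow> m = t" for m
    unfolding maximal_in_def by (metis assms antisym in_Field(2))
  then show "one_hat P = t" "\<exists>!m. maximal_in P m" by (simp_all add: one_hat_def)
  show "r t = n" using m by (simp add: rank_max)
qed

text \<open>Covers in an order ideal are covers in \<open>P\<close>, as everything in between stays
  in the ideal; only the ranks of the maximal elements are new information.\<close>

lemma ranked_lower:
  assumes "X \<subseteq> Field P" "z \<in> X" and lower: "\<And>x y. (x, y) \<in> P \<Longrightarrow> y \<in> X \<Longrightarrow> x \<in> X"
    and max: "\<And>x. x \<in> X \<Longrightarrow> (\<And>y. (x, y) \<in> P \<Longrightarrow> y \<in> X \<Longrightarrow> y = x) \<Longrightarrow> r x = k"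
  shows "ranked_poset (Restr P X) r z k"
proof -
  interpret X: finite_poset "Restr P X" by (rule finite_poset_Restr)
  have F: "Field (Restr P X) = X" by (rule Field_Restr[OF assms(1)])
  show ?thesis
  proof
    show "r y = Suc (r x)" if "covers (Restr P X) y x" for x y
    proof (rule rank_cover)
      show "covers P y x"
        unfolding covers_def
      proof (intro conjI allI impI)
        fix w assume "(x, w) \<in> P \<and> (w, y) \<in> P"
        then show "w = x \<or> w = y" using that lower[of w y] by (auto simp: covers_def)
      qed (use that in \<open>auto simp: covers_def\<close>)
    qed
    show "r x = k" if "maximal_in (Restr P X) x" for x
      using that by (intro max) (auto simp: maximal_in_def F)
  qed (use assms(1,2) bot rank_bot in \<open>auto simp: F\<close>)
qed

end

text \<open>The equal length of maximal chains passes to every interval \<open>[0, x]\<close>, so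
  \<open>rho\<close> is well defined; it grows by one along a cover because a maximal chain below
  \<open>x\<close> is completed by the cover.\<close>

lemma graded_imp_ranked:
  assumes "graded_poset P"
  shows "ranked_poset P (rho P) (zero_hat P) (poset_rank P)"
proof -
  have "Partial_order P" "finite (Field P)" using assms unfolding graded_poset_def by blast+
  then interpret finite_poset P by (rule finite_poset.intro)
  let ?z = "zero_hat P"
  have ex1: "\<exists>!z. minimal_in P z"
    and same: "\<And>C D. C \<in> maximal_chains P \<Longrightarrow> D \<in> maximal_chains P \<Longrightarrow> card C = card D"
    using assms unfolding graded_poset_def by metis+
  note min = minimal_unique_imp_bot(1)[OF ex1] and bot = minimal_unique_imp_bot(2)[OF ex1]
  obtain M where M: "M \<in> maximal_chains P"
    using ex_maximal_chain[of "{}"] by (auto simp: Chains_def)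
  have fin: "finite C" if "C \<in> Chains P" for C
    using Chains_subset_Field[OF that] finite_Field finite_subset by blast
  have zF: "?z \<in> Field P" using min by (simp add: minimal_in_def)
  have "?z \<in> M" using Chains_subset_Field[of M] M bot
    by (intro maximal_chain_insert[OF M zF]) (auto simp: maximal_chains_def)
  then have Mpos: "card M > 0" using fin[of M] M by (auto simp: card_gt_0_iff maximal_chains_def)
  have rank: "card C = poset_rank P + 1" if "C \<in> maximal_chains P" for C
  proof -
    have "poset_rank P = card M - 1"
      unfolding poset_rank_def
    proof (rule the_equality)
      show "\<forall>C\<in>maximal_chains P. card C = card M - 1 + 1" using same[OF _ M] Mpos by simp
      show "m = card M - 1" if "\<forall>C\<in>maximal_chains P. card C = m + 1" for m using that M by simp
    qed
    then show ?thesis using same[OF that M] Mpos by simp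
  qed
  have rho: "card C = rho P x + 1" if "x \<in> Field P" "C \<in> maximal_chains (interval P ?z x)" for C x
  proof -
    interpret U: finite_poset "Restr P {w. (x, w) \<in> P}" by (rule finite_poset_Restr)
    obtain U where U: "U \<in> maximal_chains (Restr P {w. (x, w) \<in> P})"
      using U.ex_maximal_chain[of "{}"] by (auto simp: Chains_def)
    \<comment> \<open>The union is a maximal chain with \<open>poset_rank P + 1\<close> elements;
      \<open>x\<close> is counted twice.\<close>
    have *: "card D + card U = poset_rank P + 2 \<and> card D > 0"
      if D: "D \<in> maximal_chains (interval P ?z x)" for D
    proof -
      note DU = maximal_chains_interval[OF finite_poset_axioms bot[OF \<open>x \<in> Field P\<close>] U D bot]
      have "finite (D \<union> U)" using fin DU(1) by (auto simp: maximal_chains_def)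
      then have "finite D" "finite U" by auto
      then have "card D + card U = card (D \<union> U) + card (D \<inter> U)" by (rule card_Un_Int)
      moreover have "card D > 0" using DU(2) \<open>finite D\<close> by (auto simp: card_gt_0_iff)
      ultimately show ?thesis using rank[OF DU(1)] DU(2) by simp
    qed
    have "rho P x = card C - 1"
      unfolding rho_def poset_rank_def
    proof (rule the_equality)
      show "\<forall>D\<in>maximal_chains (interval P ?z x). card D = card C - 1 + 1"
        using *[OF that(2)] * by fastforce
      show "m = card C - 1" if "\<forall>D\<in>maximal_chains (interval P ?z x). card D = m + 1" for m
        using that \<open>C \<in> _\<close> by simp
    qed
    then show ?thesis using *[OF that(2)] by simp
  qed
  have interval_chain: "\<exists>C. C \<in> maximal_chains (interval P ?z x)" for x
  proof -
    interpret I: finite_poset "interval P ?z x" unfolding interval_def by (rule finite_poset_Restr)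
    show ?thesis using I.ex_maximal_chain[of "{}"] by (auto simp: Chains_def)
  qed
  show ?thesis
  proof
    show "?z \<in> Field P" by (rule zF)
    show "(?z, x) \<in> P" if "x \<in> Field P" for x using bot that .
    show "rho P ?z = 0"
    proof -
      have F: "Field (interval P ?z ?z) = {?z}"
        unfolding Field_interval using rel_refl[OF zF] antisym by blast
      interpret I: finite_poset "interval P ?z ?z" unfolding interval_def by (rule finite_poset_Restr)
      have "{?z} \<in> maximal_chains (interval P ?z ?z)"
        using I.Chains_subset_Field rel_refl[OF zF]
        by (auto simp: maximal_chains_def F) (auto simp: Chains_def interval_def)
      from rho[OF zF this] show ?thesis by simp
    qed
    show "rho P x = poset_rank P" if x: "maximal_in P x" for x
    proof -
      have xF: "x \<in> Field P" using x by (simp add: maximal_in_def)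
      obtain C where C: "C \<in> maximal_chains (interval P ?z x)" using interval_chain by blast
      have U: "{x} \<in> maximal_chains (Restr P {w. (x, w) \<in> P})"
      proof -
        have "{w. (x, w) \<in> P} = {x}" using x rel_refl[OF xF] by (auto simp: maximal_in_def)
        then show ?thesis using rel_refl[OF xF] by (auto simp: maximal_chains_def Chains_def)
      qed
      note CU = maximal_chains_interval[OF finite_poset_axioms bot[OF xF] U C bot]
      have "C \<union> {x} = C" using CU(2) by blast
      then show ?thesis using rank[OF CU(1)] rho[OF xF C] by simp
    qed
    show "rho P y = Suc (rho P x)" if cov: "covers P y x" for x y
    proof -
      have xy: "(x, y) \<in> P" "x \<noteq> y" using cov by (auto simp: covers_def)
      then have F: "x \<in> Field P" "y \<in> Field P" by (auto intro: FieldI1 FieldI2)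
      obtain C where C: "C \<in> maximal_chains (interval P ?z x)" using interval_chain by blast
      have I: "finite_poset (interval P ?z y)" unfolding interval_def by (rule finite_poset_Restr)
      \<comment> \<open>Inside \<open>[0, y]\<close> only \<open>x\<close> and \<open>y\<close> lie
        above \<open>x\<close>, so this pair is the upper half to be glued to a maximal chain of
        \<open>[0, x]\<close>.\<close>
      have U: "{x, y} \<in> maximal_chains (Restr (interval P ?z y) {w. (x, w) \<in> interval P ?z y})"
      proof -
        have "{w. (x, w) \<in> interval P ?z y} = {x, y}"
          using cov rel_refl[OF F(1)] rel_refl[OF F(2)] bot[OF F(1)] xy unfolding interval_iff covers_def by auto
        then show ?thesis using rel_refl[OF F(1)] rel_refl[OF F(2)] bot[OF F(1)] xy bot[OF F(2)]
          by (auto simp: maximal_chains_def Chains_def interval_def)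
      qed
      have eq: "interval (interval P ?z y) ?z x = interval P ?z x"
      proof (rule set_eqI)
        interpret I: finite_poset "interval P ?z y" by (rule I)
        fix p :: "'a \<times> 'a"
        obtain u v where p: "p = (u, v)" by (rule prod.exhaust)
        show "p \<in> interval (interval P ?z y) ?z x \<longleftrightarrow> p \<in> interval P ?z x"
          unfolding p I.interval_iff interval_iff
          using xy(1) rel_refl[OF zF] bot[OF in_Field(2)] trans by metis
      qed
      have "(?z, x) \<in> interval P ?z y" using xy(1) bot[OF F(1)] rel_refl[OF zF] by (auto simp: interval_iff)
      note CU = maximal_chains_interval[OF I this U, unfolded eq, OF C]
      have "C \<union> {x, y} \<in> maximal_chains (interval P ?z y)" "C \<inter> {x, y} = {x}"
        using CU rel_refl[OF zF] by (auto simp: Field_interval interval_iff)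
      moreover have "finite C" using \<open>C \<inter> _ = _\<close> rho[OF F(1) C] by (intro card_ge_0_finite) simp
      moreover have "C \<union> {x, y} = insert y C" using \<open>C \<inter> _ = _\<close> by blast
      moreover have "y \<notin> C" using \<open>C \<inter> _ = _\<close> xy(2) by (auto simp: set_eq_iff)
      ultimately have "card (insert y C) = rho P y + 1" "y \<notin> C" using rho[OF F(2)] by metis+
      then show ?thesis using rho[OF F(1) C] \<open>finite C\<close> by simp
    qed
  qed
qed

section \<open>The ab-index as a chain sum\<close>

text \<open>After exchanging the sums, each chain meets exactly one \<open>T\<close>, namely its own
  set of ranks.\<close>

lemma (in ranked_poset) flag_h_eq:
  assumes "finite S"
  shows "flag_h P S = (\<Sum>C | C \<in> Chains P \<and> C \<subseteq> Field P - {z}.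
    if r ` C \<subseteq> S then (- 1) ^ card (S - r ` C) else 0)"
proof -
  define X where "X = {C. C \<in> Chains P \<and> C \<subseteq> Field P - {z}}"
  have "finite X" unfolding X_def by (rule finite_chains_subset) (simp add: finite_Field)
  have f: "flag_f P T = card {C \<in> X. r ` C = T}" for T
  proof -
    have "rho P ` C = r ` C" if "C \<in> Chains P" for C
      using Chains_subset_Field[OF that] by (intro image_cong) (auto simp: rho_eq)
    then show ?thesis
      unfolding flag_f_def X_def zero_hat_eq using Chains_subset_Field
      by (intro arg_cong[where f = card]) auto
  qed
  have "flag_h P S = (\<Sum>T\<in>Pow S. \<Sum>C\<in>X. if r ` C = T then (- 1) ^ card (S - T) else 0)"
    unfolding flag_h_def f using \<open>finite X\<close>
    by (intro sum.cong refl) (simp add: sum.If_cases Int_def)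
  also have "\<dots> = (\<Sum>C\<in>X. \<Sum>T\<in>Pow S. if r ` C = T then (- 1) ^ card (S - T) else 0)"
    by (rule sum.swap)
  also have "\<dots> = (\<Sum>C\<in>X. if r ` C \<subseteq> S then (- 1) ^ card (S - r ` C) else 0)"
    using assms by (intro sum.cong refl) (simp add: sum.delta')
  finally show ?thesis by (simp add: X_def)
qed

text \<open>For a fixed chain, the signed words over all \<open>S\<close> containing its ranks
  combine to a single product by \<open>flag_weight_expand\<close>.\<close>

lemma (in ranked_poset) ab_index_eq_chain_sum:
  "ab_index P = (chain_sum P r (Field P - {z}) 1 (Suc n) :: (ab_letter, 'k::field_char_0) ncpoly)"
proof -
  define X where "X = {C. C \<in> Chains P \<and> C \<subseteq> Field P - {z}}"
  let ?m = "\<lambda>S. nc_monom (ab_word n S) :: (ab_letter, 'k) ncpoly"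
  have "ab_index P = (\<Sum>S\<in>Pow {1..n}. of_int (flag_h P S) * ?m S)"
    by (simp add: ab_index_def poset_rank_eq)
  also have "\<dots> = (\<Sum>S\<in>Pow {1..n}. \<Sum>C\<in>X. if r ` C \<subseteq> S then of_int ((- 1) ^ card (S - r ` C)) * ?m S else 0)"
  proof (rule sum.cong[OF refl])
    fix S assume "S \<in> Pow {1..n}"
    then have "finite S" by (auto intro: finite_subset)
    show "of_int (flag_h P S) * ?m S =
        (\<Sum>C\<in>X. if r ` C \<subseteq> S then of_int ((- 1) ^ card (S - r ` C)) * ?m S else 0)"
      unfolding flag_h_eq[OF \<open>finite S\<close>] X_def[symmetric] of_int_sum sum_distrib_right
      by (rule sum.cong) simp_all
  qed
  also have "\<dots> = (\<Sum>C\<in>X. \<Sum>S\<in>Pow {1..n}. if r ` C \<subseteq> S then of_int ((- 1) ^ card (S - r ` C)) * ?m S else 0)"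
    by (rule sum.swap)
  also have "\<dots> = (\<Sum>C\<in>X. flag_weight 1 (Suc n) (r ` C))"
  proof (rule sum.cong[OF refl])
    fix C assume "C \<in> X"
    then have "r x \<in> {1..n}" if "x \<in> C" for x
      using that rank_le[of x] rank_0[of x] unfolding X_def by fastforce
    then have "r ` C \<subseteq> {1..n}" by blast
    then have "r ` C \<inter> {1..n} = r ` C" by blast
    then show "(\<Sum>S\<in>Pow {1..n}. if r ` C \<subseteq> S then of_int ((- 1) ^ card (S - r ` C)) * ?m S else 0)
        = flag_weight 1 (Suc n) (r ` C)"
      unfolding flag_weight_expand
      by (subst sum.inter_filter[symmetric]) (simp_all add: Pow_def)
  qed
  finally show ?thesis by (simp add: chain_sum_def X_def)
qed

section \<open>Eulerian posets\<close>

lemma sum_sign_eq_0_iff: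
  assumes "finite A"
  shows "(\<Sum>x\<in>A. (- 1 :: int) ^ f x) = 0 \<longleftrightarrow> card {x \<in> A. even (f x)} = card {x \<in> A. odd (f x)}"
proof -
  have "(\<Sum>x\<in>A. (- 1 :: int) ^ f x) = (\<Sum>x\<in>A. if even (f x) then 1 else - 1)"
    by (rule sum.cong) auto
  also have "\<dots> = int (card {x \<in> A. even (f x)}) - int (card {x \<in> A. odd (f x)})"
    using assms by (simp add: sum.If_cases Int_def)
  finally show ?thesis by simp
qed

lemma (in ranked_poset) Eulerian_iff:
  "Eulerian P \<longleftrightarrow> (\<exists>!m. maximal_in P m) \<and>
    (\<forall>x y. (x, y) \<in> P \<and> x \<noteq> y \<longrightarrow> (\<Sum>w | (x, w) \<in> P \<and> (w, y) \<in> P. (- 1 :: int) ^ r w) = 0)"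
proof -
  have fin: "finite {w. (x, w) \<in> P \<and> (w, y) \<in> P}" for x y
    using finite_below by (rule finite_subset[rotated]) auto
  have pos: "0 < poset_rank (interval P x y) \<longleftrightarrow> x \<noteq> y" if "(x, y) \<in> P" for x y
    using that rank_mono[of x y] by (auto simp: poset_rank_interval)
  have "{w \<in> Field (interval P x y). even (rho P w)} =
      {w \<in> {w. (x, w) \<in> P \<and> (w, y) \<in> P}. even (r w)}"
    "{w \<in> Field (interval P x y). odd (rho P w)} =
      {w \<in> {w. (x, w) \<in> P \<and> (w, y) \<in> P}. odd (r w)}" for x y
    unfolding Field_interval using in_Field by (auto simp: rho_eq)
  then show ?thesis
    unfolding Eulerian_def sum_sign_eq_0_iff[OF fin]
    by (simp only: graded pos simp_thms cong: conj_cong)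
qed

text \<open>Ranks inside the interval start at 0 at \<open>x\<close>, which changes all signs by the
  common factor \<open>(- 1) ^ rho P x\<close>.\<close>

lemma lower_Eulerian_sum:
  assumes "lower_Eulerian P" "(x, y) \<in> P" "x \<noteq> y"
  shows "(\<Sum>w | (x, w) \<in> P \<and> (w, y) \<in> P. (- 1 :: int) ^ rho P w) = 0"
proof -
  interpret ranked_poset P "rho P" "zero_hat P" "poset_rank P"
    using assms(1) by (intro graded_imp_ranked) (simp add: lower_Eulerian_def)
  interpret I: ranked_poset "interval P x y" "\<lambda>w. rho P w - rho P x" x "rho P y - rho P x"
    by (rule interval_ranked[OF assms(2)])
  have F: "x \<in> Field P" "y \<in> Field P" using assms(2) by (auto intro: FieldI1 FieldI2)
  have "(x, y) \<in> interval P x y" using assms(2) rel_refl F by (auto simp: interval_iff)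
  moreover have "Eulerian (interval P x y)" using assms(1,2) by (simp add: lower_Eulerian_def)
  ultimately have "(\<Sum>w | (x, w) \<in> interval P x y \<and> (w, y) \<in> interval P x y.
      (- 1 :: int) ^ (rho P w - rho P x)) = 0"
    using I.Eulerian_iff assms(3) by blast
  also have "{w. (x, w) \<in> interval P x y \<and> (w, y) \<in> interval P x y} = {w. (x, w) \<in> P \<and> (w, y) \<in> P}"
    using rel_refl F by (auto simp: interval_iff)
  finally have *: "(\<Sum>w | (x, w) \<in> P \<and> (w, y) \<in> P. (- 1 :: int) ^ (rho P w - rho P x)) = 0" .
  have "(- 1 :: int) ^ rho P w = (- 1) ^ rho P x * (- 1) ^ (rho P w - rho P x)" if "(x, w) \<in> P" for w
    using rank_mono_le[OF that] by (simp flip: power_add)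
  then have "(\<Sum>w | (x, w) \<in> P \<and> (w, y) \<in> P. (- 1 :: int) ^ rho P w) =
      (\<Sum>w | (x, w) \<in> P \<and> (w, y) \<in> P. (- 1) ^ rho P x * (- 1) ^ (rho P w - rho P x))"
    by (intro sum.cong) auto
  then show ?thesis using * by (simp flip: sum_distrib_left)
qed

definition with_top :: "'p rel \<Rightarrow> 'p option rel" where
  "with_top P = dir_image P Some \<union> {(v, None) | v. v \<in> insert None (Some ` Field P)}"

text \<open>The boundaries of Eulerian posets of positive rank: \<open>eulerian_top\<close> is the Eulerian
  condition for the intervals ending in the missing top element.\<close>

locale eulerian_boundary = ranked_poset +
  assumes eulerian: "(x, y) \<in> P \<Longrightarrow> x \<noteq> y \<Longrightarrow>
      (\<Sum>w | (x, w) \<in> P \<and> (w, y) \<in> P. (- 1 :: int) ^ r w) = 0"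
    and eulerian_top: "x \<in> Field P \<Longrightarrow> (\<Sum>w | (x, w) \<in> P. (- 1 :: int) ^ r w) = (- 1) ^ n"
begin

lemma with_top_iff:
  "(u, v) \<in> with_top P \<longleftrightarrow> (case v of None \<Rightarrow> u \<in> insert None (Some ` Field P)
    | Some y \<Rightarrow> \<exists>x. u = Some x \<and> (x, y) \<in> P)"
  by (auto simp: with_top_def dir_image_def split: option.splits)

lemma Field_with_top: "Field (with_top P) = insert None (Some ` Field P)"
  unfolding Field_def[of "with_top P"]
proof (intro equalityI subsetI)
  fix v assume "v \<in> Domain (with_top P) \<union> Range (with_top P)"
  then show "v \<in> insert None (Some ` Field P)"
    by (cases v) (auto simp: with_top_iff in_Field split: option.splits)
next
  fix v assume "v \<in> insert None (Some ` Field P)"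
  then have "(v, None) \<in> with_top P" by (simp add: with_top_iff)
  then show "v \<in> Domain (with_top P) \<union> Range (with_top P)" by blast
qed

lemma ranked_with_top: "ranked_poset (with_top P) (case_option (Suc n) r) (Some z) (Suc n)"
proof
  show "Partial_order (with_top P)"
    unfolding order_on_defs
  proof (intro conjI)
    show "Refl (with_top P)"
      by (rule refl_onI) (auto simp: Field_with_top with_top_iff rel_refl split: option.splits)
    show "with_top P \<subseteq> Field (with_top P) \<times> Field (with_top P)"
      by (auto intro: FieldI1 FieldI2)
    show "trans (with_top P)"
      by (rule transI) (auto simp: with_top_iff in_Field split: option.splits intro: trans)
    show "antisym (with_top P)"
      by (rule antisymI) (auto simp: with_top_iff split: option.splits intro: antisym)
  qed
  show "finite (Field (with_top P))" by (simp add: Field_with_top finite_Field)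
  show "Some z \<in> Field (with_top P)" by (simp add: Field_with_top bot_in)
  show "(Some z, v) \<in> with_top P" if "v \<in> Field (with_top P)" for v
    using that by (auto simp: Field_with_top with_top_iff bot bot_in)
  show "case_option (Suc n) r (Some z) = 0" by (simp add: rank_bot)
  show "case_option (Suc n) r v = Suc (case_option (Suc n) r u)" if cov: "covers (with_top P) v u" for u v
  proof -
    obtain x where u: "u = Some x" "x \<in> Field P"
      using cov unfolding covers_def by (cases u; cases v) (auto simp: with_top_iff in_Field)
    show ?thesis
    proof (cases v)
      case None
      have "maximal_in P x"
        unfolding maximal_in_def
      proof (intro conjI allI impI)
        fix y assume "(x, y) \<in> P"
        then have "(u, Some y) \<in> with_top P" "(Some y, v) \<in> with_top P"
          by (auto simp: with_top_iff u None in_Field)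
        then show "y = x" using cov unfolding covers_def by (auto simp: None u)
      qed (rule u)
      then show ?thesis by (simp add: u None rank_max)
    next
      case (Some y)
      have "covers P y x"
        unfolding covers_def
      proof (intro conjI allI impI)
        fix w assume "(x, w) \<in> P \<and> (w, y) \<in> P"
        then have "(u, Some w) \<in> with_top P" "(Some w, v) \<in> with_top P"
          by (auto simp: with_top_iff u Some)
        then show "w = x \<or> w = y" using cov unfolding covers_def by (auto simp: Some u)
      qed (use cov in \<open>auto simp: covers_def with_top_iff u Some\<close>)
      then show ?thesis by (simp add: u Some rank_cover)
    qed
  qed
  show "case_option (Suc n) r m = Suc n" if "maximal_in (with_top P) m" for m
  proof -
    have "(m, None) \<in> with_top P" using that by (auto simp: maximal_in_def Field_with_top with_top_iff)
    then have "m = None" using that by (auto simp: maximal_in_def)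
    then show ?thesis by simp
  qed
qed

lemma one_hat_with_top: "one_hat (with_top P) = None"
  and ex1_maximal_with_top: "\<exists>!m. maximal_in (with_top P) m"
proof -
  interpret T: ranked_poset "with_top P" "case_option (Suc n) r" "Some z" "Suc n"
    by (rule ranked_with_top)
  have "None \<in> Field (with_top P)" "v \<in> Field (with_top P) \<Longrightarrow> (v, None) \<in> with_top P" for v
    by (simp_all add: Field_with_top with_top_iff)
  then show "one_hat (with_top P) = None" "\<exists>!m. maximal_in (with_top P) m"
    using T.one_hat_eq[of None] by blast+
qed

text \<open>In an interval ending at the new top, the old elements contribute
  \<open>(- 1) ^ n\<close> by \<open>eulerian_top\<close> and the top contributes the opposite
  sign.\<close>

lemma Eulerian_with_top: "Eulerian (with_top P)"
proof -
  interpret T: ranked_poset "with_top P" "case_option (Suc n) r" "Some z" "Suc n"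
    by (rule ranked_with_top)
  have "(\<Sum>w | (u, w) \<in> with_top P \<and> (w, v) \<in> with_top P. (- 1 :: int) ^ case_option (Suc n) r w) = 0"
    if uv: "(u, v) \<in> with_top P" "u \<noteq> v" for u v
  proof -
    obtain x where u: "u = Some x" "x \<in> Field P"
      using uv by (cases u; cases v) (auto simp: with_top_iff in_Field)
    show ?thesis
    proof (cases v)
      case None
      have "{w. (u, w) \<in> with_top P \<and> (w, v) \<in> with_top P} = insert None (Some ` {w. (x, w) \<in> P})"
      proof (rule set_eqI)
        fix w
        show "w \<in> {w. (u, w) \<in> with_top P \<and> (w, v) \<in> with_top P} \<longleftrightarrow>
            w \<in> insert None (Some ` {w. (x, w) \<in> P})"
          by (cases w) (auto simp: with_top_iff u None in_Field)
      qed
      then show ?thesis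
        using eulerian_top[OF u(2)] finite_above[of x] by (simp add: sum.reindex)
    next
      case (Some y)
      have "{w. (u, w) \<in> with_top P \<and> (w, v) \<in> with_top P} = Some ` {w. (x, w) \<in> P \<and> (w, y) \<in> P}"
      proof (rule set_eqI)
        fix w
        show "w \<in> {w. (u, w) \<in> with_top P \<and> (w, v) \<in> with_top P} \<longleftrightarrow>
            w \<in> Some ` {w. (x, w) \<in> P \<and> (w, y) \<in> P}"
          by (cases w) (auto simp: with_top_iff u Some)
      qed
      then show ?thesis
        using eulerian[of x y] uv by (simp add: sum.reindex u Some with_top_iff)
    qed
  qed
  then show ?thesis using T.Eulerian_iff ex1_maximal_with_top by blast
qed

end

section \<open>Existence of the cd-index for boundaries of Eulerian posets\<close>

lemma uminus_power_of_int: "(- p) ^ k = of_int ((- 1) ^ k) * (p :: 'a::ring_1) ^ k"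
  by (cases "even k") simp_all

lemma cd_polys_e_plus_uminus_e:
  "ab_e ^ k + (- ab_e) ^ k \<in> (cd_polys :: (ab_letter, 'k::field_char_0) ncpoly set)"
  unfolding uminus_power_of_int[of ab_e]
  using cd_polys_e_even[of k] cd_polys_of_int[of 0] by (cases "even k") (auto intro: cd_polys_add)

text \<open>The difference vanishes for even \<open>k\<close>; for odd \<open>k\<close> the product
  is twice an even power of e.\<close>

lemma cd_polys_e_minus_uminus_e:
  "(ab_e ^ k - (- ab_e) ^ k) * ab_e \<in> (cd_polys :: (ab_letter, 'k::field_char_0) ncpoly set)"
proof (cases "even k")
  case True
  then show ?thesis unfolding uminus_power_of_int[of ab_e] using cd_polys_of_int[of 0] by simp
next
  case False
  then have "(ab_e ^ k - (- ab_e) ^ k) * ab_e = (ab_e ^ Suc k + ab_e ^ Suc k :: (ab_letter, 'k) ncpoly)"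
    unfolding uminus_power_of_int[of ab_e] power_Suc2 by (simp add: distrib_right del: minus_diff_eq)
  then show ?thesis using False by (simp add: cd_polys_add cd_polys_e_even del: power_Suc minus_diff_eq)
qed

context eulerian_boundary
begin

text \<open>The ab-index of the poset of all elements above \<open>x\<close>, with ranks shifted by
  \<open>r x\<close>; at the bottom it is \<open>ab_index P\<close>.\<close>

definition upper_sum :: "'a \<Rightarrow> (ab_letter, 'k::field_char_0) ncpoly" where
  "upper_sum x = chain_sum P r {w. (x, w) \<in> P \<and> w \<noteq> x} (Suc (r x)) (Suc n)"

lemma upper_sum_rec:
  "(upper_sum x :: (ab_letter, 'k::field_char_0) ncpoly) = ab_e ^ (n - r x) +
    (\<Sum>w | (x, w) \<in> P \<and> w \<noteq> x. ab_e ^ (r w - Suc (r x)) * ab_b * upper_sum w)"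
proof -
  let ?U = "\<lambda>x. {w. (x, w) \<in> P \<and> w \<noteq> x}"
  have U: "{w \<in> ?U x. (y, w) \<in> P \<and> w \<noteq> y} = ?U y" if "y \<in> ?U x" for y
    using that antisym trans by blast
  have "finite (?U x)" using finite_above[of x] by (rule rev_finite_subset) auto
  moreover have "?U x \<subseteq> Field P" using in_Field by auto
  moreover have "Suc (r x) \<le> r y \<and> r y < Suc n" if "y \<in> ?U x" for y
    using that rank_mono[of x y] rank_le[of y] in_Field by auto
  ultimately have "(upper_sum x :: (ab_letter, 'k) ncpoly) = ab_e ^ (Suc n - Suc (r x)) +
    (\<Sum>y\<in>?U x. ab_e ^ (r y - Suc (r x)) * ab_b *
      chain_sum P r {w \<in> ?U x. (y, w) \<in> P \<and> w \<noteq> y} (Suc (r y)) (Suc n))"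
    unfolding upper_sum_def by (intro chain_sum_by_Min po rank_mono)
  also have "(\<Sum>y\<in>?U x. ab_e ^ (r y - Suc (r x)) * ab_b *
      chain_sum P r {w \<in> ?U x. (y, w) \<in> P \<and> w \<noteq> y} (Suc (r y)) (Suc n))
    = (\<Sum>y\<in>?U x. ab_e ^ (r y - Suc (r x)) * ab_b * (upper_sum y :: (ab_letter, 'k) ncpoly))"
    unfolding upper_sum_def by (rule sum.cong[OF HOL.refl]) (simp only: U)
  finally show ?thesis by simp
qed

text \<open>This is the Eulerian relation of \<open>[x, v]\<close> with the term of \<open>x\<close>
  on the other side and the sign of the rank just above \<open>x\<close> normalised to 1.\<close>

lemma sum_sign_between:
  assumes "(x, v) \<in> P" "x \<noteq> v"
  shows "(\<Sum>w | ((x, w) \<in> P \<and> w \<noteq> x) \<and> (w, v) \<in> P. (- 1 :: int) ^ (r w - Suc (r x))) = 1"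
proof -
  let ?A = "{w. ((x, w) \<in> P \<and> w \<noteq> x) \<and> (w, v) \<in> P}"
  have fin: "finite ?A" using finite_above[of x] by (rule rev_finite_subset) auto
  have "{w. (x, w) \<in> P \<and> (w, v) \<in> P} = insert x ?A" using assms rel_refl in_Field by blast
  then have "0 = (- 1 :: int) ^ r x + (\<Sum>w\<in>?A. (- 1) ^ r w)"
    using eulerian[OF assms] fin by simp
  also have "(\<Sum>w\<in>?A. (- 1 :: int) ^ r w) = (\<Sum>w\<in>?A. - ((- 1) ^ r x) * (- 1) ^ (r w - Suc (r x)))"
  proof (rule sum.cong[OF HOL.refl])
    fix w assume "w \<in> ?A"
    then have "r w = Suc (r x) + (r w - Suc (r x))" using rank_mono[of x w] by auto
    then have "(- 1 :: int) ^ r w = (- 1) ^ (Suc (r x) + (r w - Suc (r x)))" by simp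
    then show "(- 1 :: int) ^ r w = - ((- 1) ^ r x) * (- 1) ^ (r w - Suc (r x))"
      by (simp add: power_add)
  qed
  also have "\<dots> = - ((- 1) ^ r x) * (\<Sum>w\<in>?A. (- 1) ^ (r w - Suc (r x)))"
    by (rule sum_distrib_left[symmetric])
  finally have "(- 1 :: int) ^ r x * (1 - (\<Sum>w\<in>?A. (- 1) ^ (r w - Suc (r x)))) = 0"
    by (simp add: right_diff_distrib)
  then show ?thesis by simp
qed

text \<open>The analogue for the interval from \<open>x\<close> to the missing top; the subtracted
  sign is the one the top would have contributed.\<close>

lemma sum_sign_above:
  assumes "x \<in> Field P"
  shows "(\<Sum>w | (x, w) \<in> P \<and> w \<noteq> x. (- 1 :: int) ^ (r w - Suc (r x))) = 1 - (- 1) ^ (n - r x)"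
proof -
  let ?A = "{w. (x, w) \<in> P \<and> w \<noteq> x}"
  have fin: "finite ?A" using finite_above[of x] by (rule rev_finite_subset) auto
  have "{w. (x, w) \<in> P} = insert x ?A" using assms rel_refl by blast
  then have "(- 1 :: int) ^ n = (- 1 :: int) ^ r x + (\<Sum>w\<in>?A. (- 1) ^ r w)"
    using eulerian_top[OF assms] fin by simp
  also have "(\<Sum>w\<in>?A. (- 1 :: int) ^ r w) = (\<Sum>w\<in>?A. - ((- 1) ^ r x) * (- 1) ^ (r w - Suc (r x)))"
  proof (rule sum.cong[OF HOL.refl])
    fix w assume "w \<in> ?A"
    then have "r w = Suc (r x) + (r w - Suc (r x))" using rank_mono[of x w] by auto
    then have "(- 1 :: int) ^ r w = (- 1) ^ (Suc (r x) + (r w - Suc (r x)))" by simp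
    then show "(- 1 :: int) ^ r w = - ((- 1) ^ r x) * (- 1) ^ (r w - Suc (r x))"
      by (simp add: power_add)
  qed
  also have "(\<Sum>w\<in>?A. - ((- 1) ^ r x) * (- 1 :: int) ^ (r w - Suc (r x))) =
      - ((- 1) ^ r x) * (\<Sum>w\<in>?A. (- 1) ^ (r w - Suc (r x)))"
    by (rule sum_distrib_left[symmetric])
  also have "(- 1 :: int) ^ n = (- 1) ^ r x * (- 1) ^ (n - r x)"
    using rank_le[OF assms] by (simp flip: power_add)
  finally have "(- 1 :: int) ^ r x * (1 - (- 1) ^ (n - r x) - (\<Sum>w\<in>?A. (- 1) ^ (r w - Suc (r x)))) = 0"
    by (simp add: right_diff_distrib)
  then show ?thesis by simp
qed

text \<open>The recursion is invariant under \<open>ab_e \<mapsto> - ab_e\<close> (with \<open>ab_a + ab_b\<close> fixed); adding the two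
  versions leaves only even powers of \<open>ab_e\<close>, and \<open>ab_e\<^sup>2 = c\<^sup>2 - 2 d\<close>.\<close>

lemma upper_sum_in_cd_polys:
  assumes "x \<in> Field P"
  shows "upper_sum x \<in> (cd_polys :: (ab_letter, 'k::field_char_0) ncpoly set)"
  using assms
proof (induction "n - r x" arbitrary: x rule: less_induct)
  case less
  let ?e = "ab_e :: (ab_letter, 'k) ncpoly"
  let ?c = "ab_a + ab_b :: (ab_letter, 'k) ncpoly"
  let ?F = "upper_sum :: _ \<Rightarrow> (ab_letter, 'k) ncpoly"
  \<comment> \<open>Since 2 b = c - e, this is twice \<open>ab_b * ?F w\<close> with b eliminated.
    Replacing e by -e turns it into \<open>H w + ?e * (?F w + ?F w)\<close>.\<close>
  define H where "H w = ?c * ?F w - ?e * ?F w" for w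
  define U where "U x = {w. (x, w) \<in> P \<and> w \<noteq> x}" for x
  define m where "m = n - r x"
  define j where "j w = r w - Suc (r x)" for w
  have finU: "finite (U x)" for x
    unfolding U_def using finite_above[of x] by (rule rev_finite_subset) auto
  have bH: "ab_b * ?F w + ab_b * ?F w = H w" for w
    unfolding H_def by (simp add: algebra_simps)
  have rec: "?F x + ?F x = (?e ^ (n - r x) + ?e ^ (n - r x)) + (\<Sum>w\<in>U x. ?e ^ (r w - Suc (r x)) * H w)" for x
  proof -
    have "?F x + ?F x = (?e ^ (n - r x) + ?e ^ (n - r x)) +
        (\<Sum>w\<in>U x. ?e ^ (r w - Suc (r x)) * (ab_b * ?F w + ab_b * ?F w))"
      unfolding upper_sum_rec[of x] U_def
      by (simp only: distrib_left sum.distrib mult.assoc add_ac)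
    then show ?thesis by (simp only: bH)
  qed
  \<comment> \<open>This is \<open>rec\<close> with e replaced by -e, for the same polynomials. To
    prove it, \<open>rec\<close> is inserted for \<open>?F w + ?F w\<close>; the powers of e along x
    < w < v then combine to one that depends on v only, and the signs can be summed over w.\<close>
  have rec': "?F x + ?F x = ((- ?e) ^ m + (- ?e) ^ m) +
      (\<Sum>w\<in>U x. (- ?e) ^ j w * (H w + ?e * (?F w + ?F w)))"
  proof -
    have step: "(- ?e) ^ j w * (H w + ?e * (?F w + ?F w)) =
        of_int ((- 1) ^ j w) * (?e ^ m + ?e ^ m) +
        (\<Sum>v | v \<in> U x \<and> (w, v) \<in> P. of_int ((- 1) ^ j w) * (?e ^ j v * H v))"
      if w: "w \<in> U x" for w
    proof -
      have xw: "(x, w) \<in> P" "r x < r w" "r w \<le> n"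
        using w rank_mono[of x w] rank_le[of w] in_Field by (auto simp: U_def)
      \<comment> \<open>The element \<open>w\<close> itself accounts for the summand
        \<open>H w\<close>.\<close>
      have set: "{v. v \<in> U x \<and> (w, v) \<in> P} = insert w (U w)"
        unfolding U_def using w rel_refl[of w] trans antisym in_Field unfolding U_def by blast
      have pow: "?e ^ j w * (?e * ?e ^ (n - r w)) = ?e ^ m"
      proof -
        have "j w + Suc (n - r w) = m" using xw by (simp add: j_def m_def)
        then show ?thesis by (metis power_Suc power_add)
      qed
      have pow': "?e ^ j w * (?e * ?e ^ (r v - Suc (r w))) = ?e ^ j v" if "v \<in> U w" for v
      proof -
        have "r w < r v" using that rank_mono[of w v] by (auto simp: U_def)
        then have "j w + Suc (r v - Suc (r w)) = j v" using xw by (simp add: j_def)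
        then show ?thesis by (metis power_Suc power_add)
      qed
      have "?e ^ j w * (H w + ?e * (?F w + ?F w)) = ?e ^ j w * H w + (?e ^ m + ?e ^ m) +
          (\<Sum>v\<in>U w. ?e ^ j w * (?e * ?e ^ (r v - Suc (r w))) * H v)"
        unfolding rec[of w]
        by (simp only: distrib_left pow sum_distrib_left mult.assoc add_ac)
      also have "(\<Sum>v\<in>U w. ?e ^ j w * (?e * ?e ^ (r v - Suc (r w))) * H v) = (\<Sum>v\<in>U w. ?e ^ j v * H v)"
        by (rule sum.cong[OF HOL.refl]) (simp only: pow')
      also have "?e ^ j w * H w + (?e ^ m + ?e ^ m) + (\<Sum>v\<in>U w. ?e ^ j v * H v) =
          (?e ^ m + ?e ^ m) + (\<Sum>v\<in>insert w (U w). ?e ^ j v * H v)"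
        using finU[of w] by (subst sum.insert) (auto simp: U_def add_ac)
      finally show ?thesis
        unfolding uminus_power_of_int[of ?e] set
        by (simp only: mult.assoc sum_distrib_left[symmetric] distrib_left[symmetric])
    qed
    have "(\<Sum>w\<in>U x. (- ?e) ^ j w * (H w + ?e * (?F w + ?F w))) =
        (\<Sum>w\<in>U x. of_int ((- 1) ^ j w) * (?e ^ m + ?e ^ m)) +
        (\<Sum>w\<in>U x. \<Sum>v | v \<in> U x \<and> (w, v) \<in> P. of_int ((- 1) ^ j w) * (?e ^ j v * H v))"
      by (simp only: step sum.distrib cong: sum.cong)
    also have "(\<Sum>w\<in>U x. \<Sum>v | v \<in> U x \<and> (w, v) \<in> P. of_int ((- 1) ^ j w) * (?e ^ j v * H v)) =
        (\<Sum>v\<in>U x. \<Sum>w | w \<in> U x \<and> (w, v) \<in> P. of_int ((- 1) ^ j w) * (?e ^ j v * H v))"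
      by (rule sum.swap_restrict[OF finU finU])
    also have "\<dots> = (\<Sum>v\<in>U x. ?e ^ j v * H v)"
    proof (rule sum.cong[OF HOL.refl])
      fix v assume "v \<in> U x"
      then have "(\<Sum>w | w \<in> U x \<and> (w, v) \<in> P. (- 1 :: int) ^ j w) = 1"
        unfolding U_def j_def mem_Collect_eq by (intro sum_sign_between) auto
      then have "of_int (\<Sum>w | w \<in> U x \<and> (w, v) \<in> P. (- 1) ^ j w) * (?e ^ j v * H v) = ?e ^ j v * H v"
        by simp
      then show "(\<Sum>w | w \<in> U x \<and> (w, v) \<in> P. of_int ((- 1) ^ j w) * (?e ^ j v * H v)) = ?e ^ j v * H v"
        by (simp only: of_int_sum sum_distrib_right)
    qed
    \<comment> \<open>The relation up to the missing top supplies exactly the difference between the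
      two versions of the leading term.\<close>
    also have "(\<Sum>w\<in>U x. of_int ((- 1) ^ j w) * (?e ^ m + ?e ^ m)) =
        (?e ^ m + ?e ^ m) - ((- ?e) ^ m + (- ?e) ^ m)"
    proof -
      have "(\<Sum>w\<in>U x. of_int ((- 1) ^ j w) * (?e ^ m + ?e ^ m)) =
          of_int (\<Sum>w\<in>U x. (- 1) ^ j w) * (?e ^ m + ?e ^ m)"
        by (simp only: of_int_sum sum_distrib_right)
      also have "(\<Sum>w\<in>U x. (- 1 :: int) ^ j w) = 1 - (- 1) ^ m"
        unfolding U_def j_def m_def by (rule sum_sign_above[OF less.prems])
      finally show ?thesis
        unfolding uminus_power_of_int[of ?e] by (simp add: left_diff_distrib distrib_left)
    qed
    finally show ?thesis using rec[of x] by (simp add: m_def j_def)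
  qed
  have "of_int 4 * ?F x = (?F x + ?F x) + (?F x + ?F x)"
  proof -
    have "(of_int 4 :: (ab_letter, 'k) ncpoly) = (1 + 1) + (1 + 1)" by simp
    then show ?thesis by (simp only: distrib_right mult_1_left)
  qed
  also have "\<dots> = ((?e ^ m + ?e ^ m) + (\<Sum>w\<in>U x. ?e ^ j w * H w)) + (((- ?e) ^ m + (- ?e) ^ m) +
      (\<Sum>w\<in>U x. (- ?e) ^ j w * (H w + ?e * (?F w + ?F w))))"
    using rec[of x] rec' by (simp only: m_def j_def)
  also have "\<dots> = ((?e ^ m + (- ?e) ^ m) + (?e ^ m + (- ?e) ^ m)) +
      (\<Sum>w\<in>U x. ?e ^ j w * H w + (- ?e) ^ j w * (H w + ?e * (?F w + ?F w)))"
    by (simp only: sum.distrib add_ac)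
  \<comment> \<open>The two versions of \<open>H w\<close> are c F - e F and c F + e F; collecting c
    F and e F leaves coefficients in which only even powers of e survive.\<close>
  also have "(\<Sum>w\<in>U x. ?e ^ j w * H w + (- ?e) ^ j w * (H w + ?e * (?F w + ?F w))) =
      (\<Sum>w\<in>U x. (?e ^ j w + (- ?e) ^ j w) * (?c * ?F w) - (?e ^ j w - (- ?e) ^ j w) * ?e * ?F w)"
    by (rule sum.cong[OF HOL.refl]) (unfold H_def, simp only: ring_distribs mult.assoc, simp)
  finally have "of_int 4 * ?F x = ((?e ^ m + (- ?e) ^ m) + (?e ^ m + (- ?e) ^ m)) +
      (\<Sum>w\<in>U x. (?e ^ j w + (- ?e) ^ j w) * (?c * ?F w) - (?e ^ j w - (- ?e) ^ j w) * ?e * ?F w)" .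
  moreover have F: "?F w \<in> cd_polys" if "w \<in> U x" for w
    using that rank_mono[of x w] rank_le[of w] in_Field by (intro less.hyps) (auto simp: U_def)
  have "((?e ^ m + (- ?e) ^ m) + (?e ^ m + (- ?e) ^ m)) +
      (\<Sum>w\<in>U x. (?e ^ j w + (- ?e) ^ j w) * (?c * ?F w) - (?e ^ j w - (- ?e) ^ j w) * ?e * ?F w)
      \<in> cd_polys"
    by (rule cd_polys_add[OF cd_polys_add[OF cd_polys_e_plus_uminus_e cd_polys_e_plus_uminus_e] cd_polys_sum])
      (rule cd_polys_diff[OF cd_polys_mult[OF cd_polys_e_plus_uminus_e cd_polys_mult[OF cd_polys_c F]]
          cd_polys_mult[OF cd_polys_e_minus_uminus_e F]])
  ultimately have "of_int 4 * ?F x \<in> cd_polys" by (simp only:)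
  then show ?case by (rule cd_polys_cancel) simp
qed

lemma ab_index_in_cd_polys: "ab_index P \<in> (cd_polys :: (ab_letter, 'k::field_char_0) ncpoly set)"
proof -
  have "Field P - {z} = {w. (z, w) \<in> P \<and> w \<noteq> z}" using bot in_Field by blast
  then have "ab_index P = (upper_sum z :: (ab_letter, 'k) ncpoly)"
    by (simp add: ab_index_eq_chain_sum upper_sum_def rank_bot)
  then show ?thesis using upper_sum_in_cd_polys[OF bot_in] by simp
qed

end

section \<open>Strong formal subdivisions\<close>

text \<open>Both posets enter through rank functions and alternating sums only. In this form an
  interval with its shifted rank can serve as source and target of the identity map.\<close>

locale subdivision = G: ranked_poset \<Gamma> r z N + B: ranked_poset B s z' n
  for \<Gamma> :: "'p rel" and r z N and B :: "'q rel" and s z' n +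
  fixes \<phi> :: "'p \<Rightarrow> 'q"
  assumes eulerian_G: "(x, y) \<in> \<Gamma> \<Longrightarrow> x \<noteq> y \<Longrightarrow>
      (\<Sum>w | (x, w) \<in> \<Gamma> \<and> (w, y) \<in> \<Gamma>. (- 1 :: int) ^ r w) = 0"
    and eulerian_B: "(x', y') \<in> B \<Longrightarrow> x' \<noteq> y' \<Longrightarrow>
      (\<Sum>w | (x', w) \<in> B \<and> (w, y') \<in> B. (- 1 :: int) ^ s w) = 0"
    and surj: "\<phi> ` Field \<Gamma> = Field B"
    and mono: "(x, y) \<in> \<Gamma> \<Longrightarrow> (\<phi> x, \<phi> y) \<in> B"
    and rank_le: "y \<in> Field \<Gamma> \<Longrightarrow> r y \<le> s (\<phi> y)"
    and lift: "y \<in> Field \<Gamma> \<Longrightarrow> (\<phi> y, x') \<in> B \<Longrightarrow> \<exists>w. (y, w) \<in> \<Gamma> \<and> \<phi> w = x' \<and> r w = s x'"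
    and fibre: "y \<in> Field \<Gamma> \<Longrightarrow> (\<phi> y, x') \<in> B \<Longrightarrow>
      (\<Sum>w | (y, w) \<in> \<Gamma> \<and> \<phi> w = x'. (- 1 :: int) ^ r w) = (- 1) ^ s x'"
begin

lemma phi_in: "y \<in> Field \<Gamma> \<Longrightarrow> \<phi> y \<in> Field B"
  using surj by blast

lemma phi_bot: "\<phi> z = z'"
proof -
  obtain y where y: "y \<in> Field \<Gamma>" "\<phi> y = z'" using surj B.bot_in by (metis imageE)
  then have "(\<phi> z, z') \<in> B" using mono[OF G.bot[OF y(1)]] by simp
  moreover have "(z', \<phi> z) \<in> B" using B.bot phi_in G.bot_in by blast
  ultimately show ?thesis by (rule B.antisym)
qed

text \<open>As the map is rank-increasing, an element over the bottom has rank 0.\<close>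

lemma phi_eq_bot: "y \<in> Field \<Gamma> \<Longrightarrow> \<phi> y = z' \<longleftrightarrow> y = z"
  using rank_le[of y] G.rank_0[of y] phi_bot B.rank_bot by auto

text \<open>The transfer principle for signs: above \<open>y\<close>, each fibre counts as much as
  the single element of \<open>B\<close> under it, so alternating sums in \<Gamma> become sums in
  \<open>B\<close>.\<close>

lemma fibre_sum:
  assumes "y \<in> Field \<Gamma>" "\<And>x. x \<in> X \<Longrightarrow> (\<phi> y, x) \<in> B"
  shows "(\<Sum>w | (y, w) \<in> \<Gamma> \<and> \<phi> w \<in> X. (- 1 :: int) ^ r w) = (\<Sum>x\<in>X. (- 1) ^ s x)"
proof -
  have fin: "finite X" by (rule finite_subset[OF _ B.finite_above[of "\<phi> y"]]) (use assms(2) in auto)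
  have fin': "finite {w. (y, w) \<in> \<Gamma> \<and> \<phi> w \<in> X}"
    using G.finite_above[of y] by (rule rev_finite_subset) auto
  have "(\<Sum>w | (y, w) \<in> \<Gamma> \<and> \<phi> w \<in> X. (- 1 :: int) ^ r w) =
      (\<Sum>x\<in>X. \<Sum>w | w \<in> {w. (y, w) \<in> \<Gamma> \<and> \<phi> w \<in> X} \<and> \<phi> w = x. (- 1) ^ r w)"
    by (rule sum.group[symmetric]) (use fin fin' in auto)
  also have "\<dots> = (\<Sum>x\<in>X. \<Sum>w | (y, w) \<in> \<Gamma> \<and> \<phi> w = x. (- 1) ^ r w)"
    by (intro sum.cong) auto
  also have "\<dots> = (\<Sum>x\<in>X. (- 1) ^ s x)"
    using assms by (intro sum.cong fibre) auto
  finally show ?thesis .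
qed

section \<open>The parts of a subdivision and their boundaries\<close>

definition fibre_le :: "'q \<Rightarrow> 'p set" where
  "fibre_le x = {y \<in> Field \<Gamma>. (\<phi> y, x) \<in> B}"

definition fibre_less :: "'q \<Rightarrow> 'p set" where
  "fibre_less x = {y \<in> Field \<Gamma>. (\<phi> y, x) \<in> B \<and> \<phi> y \<noteq> x}"

lemma part_eq: "subdivision_part \<Gamma> B \<phi> x = Restr \<Gamma> (fibre_le x)"
  by (simp add: subdivision_part_def fibre_le_def)

lemma fibre_less_subset: "fibre_less x \<subseteq> fibre_le x"
  by (auto simp: fibre_less_def fibre_le_def)

lemma fibre_le_subset: "fibre_le x \<subseteq> Field \<Gamma>"
  by (auto simp: fibre_le_def)

lemma fibre_less_iff: "y \<in> fibre_less x \<longleftrightarrow> y \<in> fibre_le x \<and> \<phi> y \<noteq> x"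
  by (auto simp: fibre_less_def fibre_le_def)

lemma fibre_le_refl: "y \<in> fibre_le x \<Longrightarrow> (y, y) \<in> \<Gamma>"
  by (auto simp: fibre_le_def G.rel_refl)

lemma fibre_le_lower: "(y, w) \<in> \<Gamma> \<Longrightarrow> w \<in> fibre_le x \<Longrightarrow> y \<in> fibre_le x"
  unfolding fibre_le_def using mono B.trans G.in_Field by blast

lemma fibre_less_lower:
  assumes "(y, w) \<in> \<Gamma>" "w \<in> fibre_less x"
  shows "y \<in> fibre_less x"
proof -
  have "(\<phi> y, \<phi> w) \<in> B" "(\<phi> w, x) \<in> B" "\<phi> w \<noteq> x"
    using assms mono by (auto simp: fibre_less_def)
  then show ?thesis
    unfolding fibre_less_def using B.trans B.antisym G.in_Field[OF assms(1)] by blast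
qed

lemma Field_part: "Field (Restr \<Gamma> (fibre_le x)) = fibre_le x"
  by (rule G.Field_Restr) (rule fibre_le_subset)

lemma Field_Restr_less: "Field (Restr \<Gamma> (fibre_less x)) = fibre_less x"
  by (rule G.Field_Restr) (use fibre_le_subset fibre_less_subset in blast)

lemma bot_in_fibre_le: "x \<in> Field B \<Longrightarrow> z \<in> fibre_le x"
  by (simp add: fibre_le_def phi_bot G.bot_in B.bot)

lemma bot_in_fibre_less: "x \<in> Field B \<Longrightarrow> x \<noteq> z' \<Longrightarrow> z \<in> fibre_less x"
  by (auto simp: fibre_less_def phi_bot G.bot_in B.bot)

text \<open>By \<open>lift\<close>, every element of the part lies below one over \<open>x\<close>
  of rank \<open>s x\<close>, so all maximal elements have this rank.\<close>

lemma part_ranked: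
  assumes "x \<in> Field B"
  shows "ranked_poset (Restr \<Gamma> (fibre_le x)) r z (s x)"
proof (rule G.ranked_lower[OF fibre_le_subset bot_in_fibre_le[OF assms] fibre_le_lower])
  fix y assume y: "y \<in> fibre_le x" and max: "\<And>w. (y, w) \<in> \<Gamma> \<Longrightarrow> w \<in> fibre_le x \<Longrightarrow> w = y"
  obtain w where w: "(y, w) \<in> \<Gamma>" "\<phi> w = x" "r w = s x"
    using lift[of y x] y by (auto simp: fibre_le_def)
  then have "w \<in> fibre_le x" using B.rel_refl[OF assms] G.in_Field(2) by (simp add: fibre_le_def)
  then show "r y = s x" using max w by blast
qed

text \<open>Lifting a coatom of \<open>x\<close> above \<open>\<phi> y\<close>, instead of
  \<open>x\<close> itself, stays outside the fibre of \<open>x\<close> and loses just one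
  rank.\<close>

lemma ex_lift_coatom:
  assumes "y \<in> fibre_less x"
  obtains w where "(y, w) \<in> \<Gamma>" "w \<in> fibre_less x" "s x = Suc (r w)"
proof -
  obtain v where v: "covers B x v" "(\<phi> y, v) \<in> B"
    using B.ex_coatom[of "\<phi> y" x] assms by (auto simp: fibre_less_def)
  obtain w where w: "(y, w) \<in> \<Gamma>" "\<phi> w = v" "r w = s v"
    using lift[OF _ v(2)] assms by (auto simp: fibre_less_def)
  have "w \<in> fibre_less x"
    using w v(1) G.in_Field(2) by (auto simp: fibre_less_def covers_def)
  then show ?thesis using that w B.rank_cover[OF v(1)] by simp
qed

lemma fibre_less_maximal:
  assumes "y \<in> fibre_less x" "\<And>w. (y, w) \<in> \<Gamma> \<Longrightarrow> w \<in> fibre_less x \<Longrightarrow> w = y"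
  shows "s x = Suc (r y)"
  using ex_lift_coatom[OF assms(1)] assms(2) by metis

lemma boundary_ranked:
  assumes "x \<in> Field B" "x \<noteq> z'"
  shows "ranked_poset (Restr \<Gamma> (fibre_less x)) r z (s x - 1)"
proof (rule G.ranked_lower[OF _ bot_in_fibre_less[OF assms] fibre_less_lower])
  show "fibre_less x \<subseteq> Field \<Gamma>" using fibre_le_subset fibre_less_subset by blast
  show "r y = s x - 1"
    if "y \<in> fibre_less x" "\<And>w. (y, w) \<in> \<Gamma> \<Longrightarrow> w \<in> fibre_less x \<Longrightarrow> w = y" for y
    using fibre_less_maximal[OF that] by simp
qed

lemma ex1_iff_card: "finite A \<Longrightarrow> (\<exists>!v. v \<in> A) \<longleftrightarrow> card A = 1"
  by (auto simp: card_1_singleton_iff)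

text \<open>The covers of \<open>y\<close> are the elements strictly above it in the fibre of
  \<open>x\<close>. They all have rank \<open>s x\<close>, so the fibre condition counts them: there
  is one if \<open>y\<close> is outside the fibre, and there are two if \<open>y\<close> is in it,
  because its own opposite sign must be compensated.\<close>

lemma unique_cover_iff:
  assumes x: "x \<in> Field B" and y: "y \<in> fibre_le x" and rk: "s x = Suc (r y)"
  shows "(\<exists>!v. covers (Restr \<Gamma> (fibre_le x)) v y) \<longleftrightarrow> \<phi> y \<noteq> x"
proof -
  interpret P: ranked_poset "Restr \<Gamma> (fibre_le x)" r z "s x" by (rule part_ranked[OF x])
  let ?A = "{v. (y, v) \<in> \<Gamma> \<and> \<phi> v = x}"
  let ?A' = "{v. (y, v) \<in> \<Gamma> \<and> \<phi> v = x \<and> v \<noteq> y}"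
  have yF: "y \<in> Field \<Gamma>" "(\<phi> y, x) \<in> B" using y by (auto simp: fibre_le_def)
  have finA: "finite ?A" using G.finite_above[of y] by (rule rev_finite_subset) auto
  then have finA': "finite ?A'" by (rule rev_finite_subset) auto
  \<comment> \<open>Strict growth above \<open>y\<close> gives rank at least \<open>s x\<close>, and
    \<open>rank_le\<close> gives at most \<open>s x\<close>.\<close>
  have rA': "r v = s x" if "v \<in> ?A'" for v
    using that G.rank_mono[of y v] rank_le[of v] rk G.in_Field(2)[of y v] by auto
  have cov: "covers (Restr \<Gamma> (fibre_le x)) v y \<longleftrightarrow> v \<in> ?A'" for v
  proof
    assume c: "covers (Restr \<Gamma> (fibre_le x)) v y"
    then have v: "(y, v) \<in> \<Gamma>" "v \<in> fibre_le x" "v \<noteq> y" by (auto simp: covers_def)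
    have "r v = s x" using P.rank_cover[OF c] rk by simp
    then have "s x \<le> s (\<phi> v)" using rank_le[of v] v G.in_Field(2)[OF v(1)] by simp
    then have "\<phi> v = x" using B.rank_mono[of "\<phi> v" x] v(2) by (auto simp: fibre_le_def)
    then show "v \<in> ?A'" using v by simp
  next
    assume v: "v \<in> ?A'"
    then have "v \<in> fibre_le x" using B.rel_refl[OF x] G.in_Field(2)[of y v] by (auto simp: fibre_le_def)
    then show "covers (Restr \<Gamma> (fibre_le x)) v y"
      using v y rA'[OF v] rk by (intro P.rank_coverI) auto
  qed
  have sumA': "(\<Sum>w\<in>?A'. (- 1 :: int) ^ r w) = (- 1) ^ s x * int (card ?A')"
    by (simp only: rA' sum_constant cong: sum.cong) (simp add: mult.commute)
  have "card ?A' = 1 \<longleftrightarrow> \<phi> y \<noteq> x"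
  proof (cases "\<phi> y = x")
    case True
    then have "?A = insert y ?A'" using G.rel_refl[OF yF(1)] by auto
    then have "(- 1 :: int) ^ s x = (- 1) ^ r y + (- 1) ^ s x * int (card ?A')"
      using fibre[OF yF] sumA' finA' by simp
    then have "(- 1 :: int) ^ s x * (int (card ?A') - 2) = 0"
      by (simp add: rk algebra_simps)
    then show ?thesis using True by simp
  next
    case False
    then have "?A = ?A'" by auto
    then have "(- 1 :: int) ^ s x * (int (card ?A') - 1) = 0"
      using fibre[OF yF] sumA' by (simp add: algebra_simps)
    then show ?thesis using False by simp
  qed
  then show ?thesis unfolding cov using ex1_iff_card[OF finA'] by simp
qed

text \<open>By \<open>unique_cover_iff\<close> the boundary is generated by the elements of corank
  one not over \<open>x\<close>; by \<open>ex_lift_coatom\<close> these dominate everything not over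
  \<open>x\<close>.\<close>

lemma boundary_part:
  assumes x: "x \<in> Field B"
  shows "boundary (Restr \<Gamma> (fibre_le x)) = Restr \<Gamma> (fibre_less x)"
proof -
  interpret P: ranked_poset "Restr \<Gamma> (fibre_le x)" r z "s x" by (rule part_ranked[OF x])
  have "{y. \<exists>w\<in>Field (Restr \<Gamma> (fibre_le x)).
      Suc (rho (Restr \<Gamma> (fibre_le x)) w) = poset_rank (Restr \<Gamma> (fibre_le x)) \<and>
      (\<exists>!v. covers (Restr \<Gamma> (fibre_le x)) v w) \<and> (y, w) \<in> Restr \<Gamma> (fibre_le x)} =
    {y. \<exists>w\<in>fibre_le x. Suc (r w) = s x \<and> \<phi> w \<noteq> x \<and> (y, w) \<in> Restr \<Gamma> (fibre_le x)}"
  proof (unfold Field_part P.poset_rank_eq, intro Collect_cong bex_cong HOL.refl)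
    fix y w assume w: "w \<in> fibre_le x"
    have "rho (Restr \<Gamma> (fibre_le x)) w = r w" by (rule P.rho_eq) (simp only: Field_part w)
    then show "(Suc (rho (Restr \<Gamma> (fibre_le x)) w) = s x \<and>
        (\<exists>!v. covers (Restr \<Gamma> (fibre_le x)) v w) \<and> (y, w) \<in> Restr \<Gamma> (fibre_le x)) =
      (Suc (r w) = s x \<and> \<phi> w \<noteq> x \<and> (y, w) \<in> Restr \<Gamma> (fibre_le x))"
      using unique_cover_iff[OF x w] by (simp only:) metis
  qed
  also have "\<dots> = fibre_less x"
  proof (intro equalityI subsetI)
    fix y assume "y \<in> {y. \<exists>w\<in>fibre_le x. Suc (r w) = s x \<and> \<phi> w \<noteq> x \<and> (y, w) \<in> Restr \<Gamma> (fibre_le x)}"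
    then show "y \<in> fibre_less x"
      using fibre_less_lower[of y _ x] by (auto simp: fibre_le_def fibre_less_def)
  next
    fix y assume y: "y \<in> fibre_less x"
    obtain w where w: "(y, w) \<in> \<Gamma>" "w \<in> fibre_less x" "s x = Suc (r w)"
      by (rule ex_lift_coatom[OF y])
    then have "w \<in> fibre_le x" "y \<in> fibre_le x" "\<phi> w \<noteq> x"
      using y fibre_less_subset by (auto simp: fibre_less_def)
    then show "y \<in> {y. \<exists>w\<in>fibre_le x. Suc (r w) = s x \<and> \<phi> w \<noteq> x \<and> (y, w) \<in> Restr \<Gamma> (fibre_le x)}"
      using w by auto
  qed
  finally have "boundary (Restr \<Gamma> (fibre_le x)) = Restr (Restr \<Gamma> (fibre_le x)) (fibre_less x)"
    unfolding boundary_def by (rule arg_cong)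
  also have "\<dots> = Restr \<Gamma> (fibre_less x)" using fibre_less_subset by blast
  finally show ?thesis .
qed

text \<open>The sum transfers to the interval from \<open>\<phi> y\<close> to \<open>x\<close>
  without its top \<open>x\<close>, whose complete alternating sum vanishes.\<close>

lemma sum_sign_fibre_less:
  assumes "y \<in> fibre_less x"
  shows "(\<Sum>w | (y, w) \<in> \<Gamma> \<and> w \<in> fibre_less x. (- 1 :: int) ^ r w) = - ((- 1) ^ s x)"
proof -
  let ?X = "{v. (\<phi> y, v) \<in> B \<and> (v, x) \<in> B \<and> v \<noteq> x}"
  have y: "y \<in> Field \<Gamma>" "(\<phi> y, x) \<in> B" "\<phi> y \<noteq> x" using assms by (auto simp: fibre_less_def)
  have eq: "{w. (y, w) \<in> \<Gamma> \<and> w \<in> fibre_less x} = {w. (y, w) \<in> \<Gamma> \<and> \<phi> w \<in> ?X}"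
    using mono G.in_Field by (auto simp: fibre_less_def)
  have "{v. (\<phi> y, v) \<in> B \<and> (v, x) \<in> B} = insert x ?X"
    using y B.rel_refl B.in_Field by auto
  moreover have "finite ?X" using B.finite_above[of "\<phi> y"] by (rule rev_finite_subset) auto
  ultimately have "(- 1) ^ s x + (\<Sum>v\<in>?X. (- 1 :: int) ^ s v) = 0"
    using eulerian_B[OF y(2,3)] by simp
  then show ?thesis unfolding eq by (subst fibre_sum[OF y(1)]) auto
qed

text \<open>The sum transfers to the whole interval from \<open>\<phi> y\<close> to
  \<open>x\<close>, which contributes only if it is a single point.\<close>

lemma sum_sign_fibre_le:
  assumes "y \<in> fibre_le x"
  shows "(\<Sum>w | (y, w) \<in> \<Gamma> \<and> w \<in> fibre_le x. (- 1 :: int) ^ r w) = (if \<phi> y = x then (- 1) ^ s x else 0)"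
proof -
  let ?X = "{v. (\<phi> y, v) \<in> B \<and> (v, x) \<in> B}"
  have y: "y \<in> Field \<Gamma>" "(\<phi> y, x) \<in> B" using assms by (auto simp: fibre_le_def)
  have eq: "{w. (y, w) \<in> \<Gamma> \<and> w \<in> fibre_le x} = {w. (y, w) \<in> \<Gamma> \<and> \<phi> w \<in> ?X}"
    using mono G.in_Field by (auto simp: fibre_le_def)
  have "(\<Sum>w | (y, w) \<in> \<Gamma> \<and> w \<in> fibre_le x. (- 1 :: int) ^ r w) = (\<Sum>v\<in>?X. (- 1) ^ s v)"
    unfolding eq by (rule fibre_sum[OF y(1)]) auto
  moreover have "?X = {x}" if "\<phi> y = x" using that y B.antisym by auto
  ultimately show ?thesis using eulerian_B[OF y(2)] by auto
qed

lemma eulerian_Restr: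
  assumes "\<And>y w. (y, w) \<in> \<Gamma> \<Longrightarrow> w \<in> X \<Longrightarrow> y \<in> X" "(y, w) \<in> \<Gamma>" "y \<in> X" "w \<in> X" "y \<noteq> w"
  shows "(\<Sum>v | (y, v) \<in> Restr \<Gamma> X \<and> (v, w) \<in> Restr \<Gamma> X. (- 1 :: int) ^ r v) = 0"
proof -
  have "{v. (y, v) \<in> Restr \<Gamma> X \<and> (v, w) \<in> Restr \<Gamma> X} = {v. (y, v) \<in> \<Gamma> \<and> (v, w) \<in> \<Gamma>}"
    using assms by auto
  then show ?thesis using eulerian_G assms by simp
qed

lemma boundary_eulerian:
  assumes "x \<in> Field B" "x \<noteq> z'"
  shows "eulerian_boundary (Restr \<Gamma> (fibre_less x)) r z (s x - 1)"
proof -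
  interpret P: ranked_poset "Restr \<Gamma> (fibre_less x)" r z "s x - 1" by (rule boundary_ranked[OF assms])
  have pos: "s x = Suc (s x - 1)" using B.rank_0[OF assms(1)] assms(2) by simp
  show ?thesis
  proof
    show "(\<Sum>v | (y, v) \<in> Restr \<Gamma> (fibre_less x) \<and> (v, w) \<in> Restr \<Gamma> (fibre_less x). (- 1 :: int) ^ r v) = 0"
      if "(y, w) \<in> Restr \<Gamma> (fibre_less x)" "y \<noteq> w" for y w
      using that by (intro eulerian_Restr[OF fibre_less_lower]) auto
    show "(\<Sum>w | (y, w) \<in> Restr \<Gamma> (fibre_less x). (- 1 :: int) ^ r w) = (- 1) ^ (s x - 1)"
      if "y \<in> Field (Restr \<Gamma> (fibre_less x))" for y
    proof -
      have y: "y \<in> fibre_less x" using that by (simp only: Field_Restr_less)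
      then have "{w. (y, w) \<in> Restr \<Gamma> (fibre_less x)} = {w. (y, w) \<in> \<Gamma> \<and> w \<in> fibre_less x}" by auto
      moreover have "- ((- 1 :: int) ^ s x) = (- 1) ^ (s x - 1)" by (subst pos) simp
      ultimately show ?thesis using sum_sign_fibre_less[OF y] by simp
    qed
  qed
qed

section \<open>Semisuspensions and near-Eulerian parts\<close>

abbreviation susp :: "'q \<Rightarrow> 'p option rel" where
  "susp x \<equiv> semisuspension (Restr \<Gamma> (fibre_le x))"

lemma susp_iff:
  assumes "x \<in> Field B"
  shows "(u, v) \<in> susp x \<longleftrightarrow> (case v of None \<Rightarrow> u \<in> insert None (Some ` fibre_less x)
    | Some w \<Rightarrow> \<exists>y. u = Some y \<and> y \<in> fibre_le x \<and> w \<in> fibre_le x \<and> (y, w) \<in> \<Gamma>)"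
  unfolding semisuspension_def boundary_part[OF assms] Field_Restr_less
  by (auto simp: dir_image_def split: option.splits)

lemma Field_susp:
  assumes "x \<in> Field B"
  shows "Field (susp x) = insert None (Some ` fibre_le x)"
  unfolding Field_def[of "susp x"]
proof (intro equalityI subsetI)
  fix v assume "v \<in> Domain (susp x) \<union> Range (susp x)"
  then show "v \<in> insert None (Some ` fibre_le x)"
    using fibre_less_subset[of x]
    by (cases v) (auto simp: susp_iff[OF assms] split: option.splits)
next
  fix v assume "v \<in> insert None (Some ` fibre_le x)"
  then have "(v, v) \<in> susp x"
    by (auto simp: susp_iff[OF assms] fibre_le_refl)
  then show "v \<in> Domain (susp x) \<union> Range (susp x)" by blast
qed

lemma susp_ranked:
  assumes x: "x \<in> Field B" "x \<noteq> z'"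
  shows "ranked_poset (susp x) (case_option (s x) r) (Some z) (s x)"
proof
  interpret P: ranked_poset "Restr \<Gamma> (fibre_le x)" r z "s x" by (rule part_ranked[OF x(1)])
  note iff = susp_iff[OF x(1)] and F = Field_susp[OF x(1)]
  show "Partial_order (susp x)"
    unfolding order_on_defs
  proof (intro conjI)
    show "Refl (susp x)"
      by (intro refl_onI) (auto simp: F iff fibre_le_refl)
    show "susp x \<subseteq> Field (susp x) \<times> Field (susp x)"
      by (auto intro: FieldI1 FieldI2)
    show "trans (susp x)"
      by (rule transI) (auto simp: iff split: option.splits intro: G.trans fibre_less_lower)
    show "antisym (susp x)"
      by (rule antisymI) (auto simp: iff split: option.splits intro: G.antisym)
  qed
  show "finite (Field (susp x))"
    using finite_subset[OF fibre_le_subset G.finite_Field] by (simp add: F)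
  show "Some z \<in> Field (susp x)" by (simp add: F bot_in_fibre_le x)
  show "(Some z, v) \<in> susp x" if "v \<in> Field (susp x)" for v
    using that fibre_le_subset bot_in_fibre_le[OF x(1)] bot_in_fibre_less[OF x]
    by (auto simp: F iff G.bot subset_iff)
  show "case_option (s x) r (Some z) = 0" by (simp add: G.rank_bot)
  show "case_option (s x) r v = Suc (case_option (s x) r u)" if cov: "covers (susp x) v u" for u v
  proof -
    obtain y where u: "u = Some y"
      using cov unfolding covers_def by (cases u; cases v) (auto simp: iff)
    show ?thesis
    proof (cases v)
      case None
      have "y \<in> fibre_less x" using cov by (auto simp: covers_def iff u None)
      moreover have "w = y" if "(y, w) \<in> \<Gamma>" "w \<in> fibre_less x" for w
      proof -
        have "(u, Some w) \<in> susp x" "(Some w, v) \<in> susp x"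
          using that \<open>y \<in> fibre_less x\<close> fibre_less_subset by (auto simp: iff u None)
        then show ?thesis using cov unfolding covers_def by (auto simp: None u)
      qed
      ultimately show ?thesis using fibre_less_maximal by (simp add: u None)
    next
      case (Some w)
      have "covers (Restr \<Gamma> (fibre_le x)) w y"
        unfolding covers_def
      proof (intro conjI allI impI)
        fix t assume "(y, t) \<in> Restr \<Gamma> (fibre_le x) \<and> (t, w) \<in> Restr \<Gamma> (fibre_le x)"
        then have "(u, Some t) \<in> susp x" "(Some t, v) \<in> susp x"
          by (auto simp: iff u Some)
        then show "t = y \<or> t = w" using cov unfolding covers_def by (auto simp: Some u)
      qed (use cov in \<open>auto simp: covers_def iff u Some\<close>)
      then show ?thesis by (simp add: u Some P.rank_cover)
    qed
  qed
  show "case_option (s x) r m = s x" if max: "maximal_in (susp x) m" for m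
  proof (cases m)
    case (Some y)
    have "maximal_in (Restr \<Gamma> (fibre_le x)) y"
      unfolding maximal_in_def
    proof (intro conjI allI impI)
      show "y \<in> Field (Restr \<Gamma> (fibre_le x))"
        using max by (auto simp: maximal_in_def F Some Field_part)
      fix w assume "(y, w) \<in> Restr \<Gamma> (fibre_le x)"
      then have "(m, Some w) \<in> susp x" by (auto simp: iff Some)
      then show "w = y" using max by (auto simp: maximal_in_def Some)
    qed
    then show ?thesis by (simp add: Some P.rank_max)
  qed simp
qed

text \<open>The new element repairs exactly what fails in the part: above an element not over
  \<open>x\<close> the old signs cancel and \<open>None\<close> supplies \<open>(- 1) ^ s x\<close>;
  above an element over \<open>x\<close> the old signs already give this value, and
  \<open>None\<close> is not there. Intervals ending in \<open>None\<close> are settled by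
  \<open>sum_sign_fibre_less\<close>.\<close>

lemma susp_eulerian:
  assumes x: "x \<in> Field B" "x \<noteq> z'"
  shows "eulerian_boundary (susp x) (case_option (s x) r) (Some z) (s x)"
proof -
  interpret P: ranked_poset "susp x" "case_option (s x) r" "Some z" "s x" by (rule susp_ranked[OF x])
  note iff = susp_iff[OF x(1)] and F = Field_susp[OF x(1)]
  have fin: "finite {w. (y, w) \<in> \<Gamma> \<and> Q w}" for y Q
    using G.finite_above[of y] by (rule rev_finite_subset) auto
  show ?thesis
  proof
    fix u v assume uv: "(u, v) \<in> susp x" "u \<noteq> v"
    show "(\<Sum>w | (u, w) \<in> susp x \<and> (w, v) \<in> susp x. (- 1 :: int) ^ case_option (s x) r w) = 0"
    proof -
      obtain y where u: "u = Some y"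
        using uv by (cases u; cases v) (auto simp: iff)
      show ?thesis
      proof (cases v)
        case None
        then have y: "y \<in> fibre_less x" using uv by (auto simp: iff u)
        have "{w. (u, w) \<in> susp x \<and> (w, v) \<in> susp x} =
            insert None (Some ` {w. (y, w) \<in> \<Gamma> \<and> w \<in> fibre_less x})" (is "?L = ?R")
        proof (rule set_eqI)
          fix w
          show "w \<in> ?L \<longleftrightarrow> w \<in> ?R"
            using y fibre_less_subset[of x] by (cases w) (auto simp: iff u None)
        qed
        then show ?thesis
          using sum_sign_fibre_less[OF y] fin[of y] by (simp add: sum.reindex)
      next
        case (Some w)
        have yw: "y \<in> fibre_le x" "w \<in> fibre_le x" "(y, w) \<in> \<Gamma>" "y \<noteq> w"
          using uv by (auto simp: iff u Some)
        have "{t. (u, t) \<in> susp x \<and> (t, v) \<in> susp x} =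
            Some ` {t. (y, t) \<in> Restr \<Gamma> (fibre_le x) \<and> (t, w) \<in> Restr \<Gamma> (fibre_le x)}" (is "?L = ?R")
        proof (rule set_eqI)
          fix t
          show "t \<in> ?L \<longleftrightarrow> t \<in> ?R" by (cases t) (auto simp: iff u Some)
        qed
        then have "(\<Sum>w | (u, w) \<in> susp x \<and> (w, v) \<in> susp x. (- 1 :: int) ^ case_option (s x) r w) =
            (\<Sum>t | (y, t) \<in> Restr \<Gamma> (fibre_le x) \<and> (t, w) \<in> Restr \<Gamma> (fibre_le x). (- 1) ^ r t)"
          by (simp add: sum.reindex)
        then show ?thesis using eulerian_Restr[OF fibre_le_lower yw(3,1,2,4)] by simp
      qed
    qed
  next
    fix u assume uF: "u \<in> Field (susp x)"
    show "(\<Sum>w | (u, w) \<in> susp x. (- 1 :: int) ^ case_option (s x) r w) = (- 1) ^ s x"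
    proof (cases u)
      case None
      have "{w. (u, w) \<in> susp x} = {None}"
        by (rule set_eqI, rename_tac w, case_tac w) (auto simp: iff None)
      then show ?thesis by simp
    next
      case (Some y)
      then have y: "y \<in> fibre_le x" using uF by (auto simp: F)
      have "{w. (u, w) \<in> susp x} = (if \<phi> y = x then {} else {None}) \<union>
          Some ` {w. (y, w) \<in> \<Gamma> \<and> w \<in> fibre_le x}" (is "?L = ?R")
      proof (rule set_eqI)
        fix w
        show "w \<in> ?L \<longleftrightarrow> w \<in> ?R"
          using y by (cases w) (auto simp: iff Some fibre_less_iff)
      qed
      then show ?thesis
        using sum_sign_fibre_le[OF y] fin[of y] by (simp add: sum.reindex)
    qed
  qed
qed

text \<open>The witness is the semisuspension with a top: \<open>Some None\<close> is the suspension
  point, \<open>None\<close> the top, and \<open>Some (Some y)\<close> the old elements, in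
  agreement with the embedding in \<open>near_Eulerian\<close>. This selects the first branch of
  \<open>cd_index\<close>.\<close>

lemma near_Eulerian_part:
  assumes x: "x \<in> Field B" "x \<noteq> z'"
  shows "near_Eulerian (Restr \<Gamma> (fibre_le x))"
proof -
  interpret P: ranked_poset "Restr \<Gamma> (fibre_le x)" r z "s x" by (rule part_ranked[OF x(1)])
  interpret S: eulerian_boundary "susp x" "case_option (s x) r" "Some z" "s x" by (rule susp_eulerian[OF x])
  interpret T: ranked_poset "with_top (susp x)" "case_option (Suc (s x)) (case_option (s x) r)"
      "Some (Some z)" "Suc (s x)"
    by (rule S.ranked_with_top)
  note iff = susp_iff[OF x(1)] and F = Field_susp[OF x(1)]
  let ?Q = "with_top (susp x)"
  have q: "Some None \<in> Field ?Q" by (simp add: S.Field_with_top F)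
  have "dir_image (Restr \<Gamma> (fibre_le x)) (\<lambda>y. Some (Some y)) =
      Restr ?Q (Field ?Q - {Some None, one_hat ?Q})"
  proof (rule set_eqI)
    fix p :: "'p option option \<times> 'p option option"
    obtain u v where p: "p = (u, v)" by (rule prod.exhaust)
    have FQ: "Field ?Q - {Some None, one_hat ?Q} = (Some \<circ> Some) ` fibre_le x"
      unfolding S.one_hat_with_top S.Field_with_top F by auto
    show "p \<in> dir_image (Restr \<Gamma> (fibre_le x)) (\<lambda>y. Some (Some y)) \<longleftrightarrow>
        p \<in> Restr ?Q (Field ?Q - {Some None, one_hat ?Q})"
      unfolding FQ p by (auto simp: dir_image_def S.with_top_iff iff)
  qed
  then show ?thesis
    unfolding near_Eulerian_def
    using P.graded S.Eulerian_with_top T.poset_rank_eq P.poset_rank_eq q T.rho_eq[OF q]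
    by (intro conjI exI[of _ ?Q] exI[of _ "Some None"]) simp_all
qed

end

section \<open>The ab-indices of the parts of a subdivision\<close>

lemma flag_weight_refl [simp]: "flag_weight j j T = 1"
  by (simp add: flag_weight_def)

lemma cd_to_ab_injD:
  "nc_subst cd_to_ab p = (nc_subst cd_to_ab q :: (ab_letter, 'k::field_char_0) ncpoly) \<Longrightarrow> p = q"
  by (rule injD[OF inj_cd_to_ab])

section \<open>Chains below an element and between two elements\<close>

context ranked_poset
begin

definition lower_sum :: "'p \<Rightarrow> (ab_letter, 'k::field_char_0) ncpoly" where
  "lower_sum y = chain_sum P r {w. (w, y) \<in> P \<and> w \<noteq> y \<and> w \<noteq> z} 1 (r y)"

text \<open>Because \<open>X\<close> is an order ideal, the inner sums do not depend on it. The same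
  \<open>lower_sum y\<close> therefore occurs in all parts and boundaries containing
  \<open>y\<close>, which makes them comparable.\<close>

lemma chain_sum_lower_ideal:
  assumes "X \<subseteq> Field P" and lower: "\<And>w y. (w, y) \<in> P \<Longrightarrow> y \<in> X \<Longrightarrow> w \<in> X"
    and less: "\<And>y. y \<in> X \<Longrightarrow> r y < j"
  shows "(chain_sum P r (X - {z}) 1 j :: (ab_letter, 'k::field_char_0) ncpoly) =
    ab_e ^ (j - 1) + (\<Sum>y\<in>X - {z}. lower_sum y * ab_b * ab_e ^ (j - Suc (r y)))"
proof -
  have "finite (X - {z})" using assms(1) finite_Field finite_subset by auto
  moreover have "X - {z} \<subseteq> Field P" using assms(1) by blast
  moreover have "1 \<le> r y \<and> r y < j" if "y \<in> X - {z}" for y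
    using that less[of y] rank_0[of y] assms(1) by auto
  ultimately have "(chain_sum P r (X - {z}) 1 j :: (ab_letter, 'k) ncpoly) = ab_e ^ (j - 1) +
      (\<Sum>y\<in>X - {z}. chain_sum P r {w \<in> X - {z}. (w, y) \<in> P \<and> w \<noteq> y} 1 (r y) * ab_b * ab_e ^ (j - Suc (r y)))"
    by (intro chain_sum_by_Max po rank_mono)
  also have "(\<Sum>y\<in>X - {z}. chain_sum P r {w \<in> X - {z}. (w, y) \<in> P \<and> w \<noteq> y} 1 (r y) * ab_b * ab_e ^ (j - Suc (r y)))
    = (\<Sum>y\<in>X - {z}. (lower_sum y :: (ab_letter, 'k) ncpoly) * ab_b * ab_e ^ (j - Suc (r y)))"
  proof (rule sum.cong[OF HOL.refl])
    fix y assume "y \<in> X - {z}"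
    then have "{w \<in> X - {z}. (w, y) \<in> P \<and> w \<noteq> y} = {w. (w, y) \<in> P \<and> w \<noteq> y \<and> w \<noteq> z}"
      using lower by blast
    then show "chain_sum P r {w \<in> X - {z}. (w, y) \<in> P \<and> w \<noteq> y} 1 (r y) * ab_b * ab_e ^ (j - Suc (r y))
      = (lower_sum y :: (ab_letter, 'k) ncpoly) * ab_b * ab_e ^ (j - Suc (r y))"
      by (simp only: lower_sum_def)
  qed
  finally show ?thesis .
qed

text \<open>The ab-index of the interval from \<open>x\<close> to \<open>t\<close> without
  \<open>t\<close>; for x \<noteq> t in an Eulerian poset it is the cd-index of
  \<open>[x, t]\<close> in the variables a and b.\<close>

definition between_sum :: "'p \<Rightarrow> 'p \<Rightarrow> (ab_letter, 'k::field_char_0) ncpoly" where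
  "between_sum x t = chain_sum P r {v. (x, v) \<in> P \<and> v \<noteq> x \<and> (v, t) \<in> P \<and> v \<noteq> t} (Suc (r x)) (r t)"

lemma between_sum_rec:
  "(between_sum x t :: (ab_letter, 'k::field_char_0) ncpoly) = ab_e ^ (r t - Suc (r x)) +
    (\<Sum>v | (x, v) \<in> P \<and> v \<noteq> x \<and> (v, t) \<in> P \<and> v \<noteq> t. ab_e ^ (r v - Suc (r x)) * ab_b * between_sum v t)"
proof -
  let ?U = "\<lambda>x. {v. (x, v) \<in> P \<and> v \<noteq> x \<and> (v, t) \<in> P \<and> v \<noteq> t}"
  have U: "{w \<in> ?U x. (v, w) \<in> P \<and> w \<noteq> v} = ?U v" if "v \<in> ?U x" for v
    using that antisym trans by blast
  have "finite (?U x)" using finite_above[of x] by (rule rev_finite_subset) auto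
  moreover have "?U x \<subseteq> Field P" using in_Field by auto
  moreover have "Suc (r x) \<le> r v \<and> r v < r t" if "v \<in> ?U x" for v
    using that rank_mono[of x v] rank_mono[of v t] by auto
  ultimately have "(between_sum x t :: (ab_letter, 'k) ncpoly) = ab_e ^ (r t - Suc (r x)) +
    (\<Sum>v\<in>?U x. ab_e ^ (r v - Suc (r x)) * ab_b *
      chain_sum P r {w \<in> ?U x. (v, w) \<in> P \<and> w \<noteq> v} (Suc (r v)) (r t))"
    unfolding between_sum_def by (intro chain_sum_by_Min po rank_mono)
  also have "(\<Sum>v\<in>?U x. ab_e ^ (r v - Suc (r x)) * ab_b *
      chain_sum P r {w \<in> ?U x. (v, w) \<in> P \<and> w \<noteq> v} (Suc (r v)) (r t))
    = (\<Sum>v\<in>?U x. ab_e ^ (r v - Suc (r x)) * ab_b * (between_sum v t :: (ab_letter, 'k) ncpoly))"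
    unfolding between_sum_def by (rule sum.cong[OF HOL.refl]) (simp only: U)
  finally show ?thesis .
qed

text \<open>A witness \<open>Q\<close> would have rank 1 and its \<open>q\<close> would be the
  bottom; the element coming from \<open>P\<close> would then lie strictly between bottom and top.
  So a singleton takes the second branch of \<open>cd_index\<close>.\<close>

lemma not_near_Eulerian_rank_0:
  assumes "n = 0"
  shows "\<not> near_Eulerian P"
proof
  assume "near_Eulerian P"
  then obtain Q :: "'p option option rel" and q where Q: "Eulerian Q" "poset_rank Q = 1" "q \<in> Field Q"
      "rho Q q = 0" and img: "dir_image P (\<lambda>y. Some (Some y)) = Restr Q (Field Q - {q, one_hat Q})"
    unfolding near_Eulerian_def poset_rank_eq by (auto simp: assms)
  interpret Q: ranked_poset Q "rho Q" "zero_hat Q" 1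
    using graded_imp_ranked[of Q] Q(1,2) by (simp add: Eulerian_def)
  have q: "q = zero_hat Q" using Q.rank_0[OF Q(3)] Q(4) by simp
  let ?v = "Some (Some z)"
  have "(?v, ?v) \<in> dir_image P (\<lambda>y. Some (Some y))"
    using rel_refl[OF bot_in] by (auto simp: dir_image_def)
  then have v: "?v \<in> Field Q" "?v \<noteq> q" "?v \<noteq> one_hat Q" unfolding img by auto
  obtain m where m: "maximal_in Q m" "(?v, m) \<in> Q" using Q.ex_maximal_above[OF v(1)] .
  have "\<exists>!m. maximal_in Q m" using Q(1) by (simp add: Eulerian_def)
  then have "one_hat Q = m" unfolding one_hat_def using m(1) by (metis the1_equality)
  then have "rho Q ?v < 1" using Q.rank_mono[OF m(2)] v(3) Q.rank_max[OF m(1)] by simp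
  then show False using Q.rank_0[OF v(1)] v(2) q by simp
qed

lemma cd_index_rank_0:
  assumes "n = 0"
  shows "(cd_index P :: (cd_letter, 'k::field_char_0) ncpoly) = 1"
proof -
  have "x = z" if "x \<in> Field P" for x
    using rank_le[OF that] rank_0[OF that] assms by simp
  then have "Field P = {z}" using bot_in by blast
  moreover have "{C \<in> Chains P. C = {}} = {{}}" by (auto simp: Chains_def)
  ultimately have 1: "(ab_index P :: (ab_letter, 'k) ncpoly) = 1"
    by (simp add: ab_index_eq_chain_sum assms chain_sum_def)
  have "ab_index P \<in> (cd_polys :: (ab_letter, 'k) ncpoly set)"
    unfolding 1 using cd_polys_of_int[of 1] by simp
  from nc_subst_cd_index_bd[OF this]
  have "nc_subst cd_to_ab (cd_index_bd P) = (1 :: (ab_letter, 'k) ncpoly)" by (simp only: 1)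
  then have "(cd_index_bd P :: (cd_letter, 'k) ncpoly) = 1"
    by (intro cd_to_ab_injD) simp
  then show ?thesis using not_near_Eulerian_rank_0[OF assms] by (simp add: cd_index_def)
qed

end

section \<open>Local cd-indices in the variables a and b\<close>

context subdivision
begin

lemma finite_fibre_le: "finite (fibre_le x)"
  using fibre_le_subset G.finite_Field by (rule finite_subset)

lemma ab_index_boundary:
  assumes "x \<in> Field B" "x \<noteq> z'"
  shows "ab_index (Restr \<Gamma> (fibre_less x)) = chain_sum \<Gamma> r (fibre_less x - {z}) 1 (s x)"
  using ranked_poset.ab_index_eq_chain_sum[OF boundary_ranked[OF assms]] B.rank_0[OF assms(1)] assms(2)
  by (simp only: Field_Restr_less) (simp add: chain_sum_Restr)

text \<open>A chain avoiding the new element is a chain of the part; a chain containing it is a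
  chain of the boundary together with a b at the last position \<open>s x\<close>.\<close>

lemma ab_index_susp:
  assumes x: "x \<in> Field B" "x \<noteq> z'"
  shows "(ab_index (susp x) :: (ab_letter, 'k::field_char_0) ncpoly) =
    chain_sum \<Gamma> r (fibre_le x - {z}) 1 (Suc (s x)) + chain_sum \<Gamma> r (fibre_less x - {z}) 1 (s x) * ab_b"
proof -
  interpret S: ranked_poset "susp x" "case_option (s x) r" "Some z" "s x" by (rule susp_ranked[OF x])
  note iff = susp_iff[OF x(1)] and F = Field_susp[OF x(1)]
  let ?w = "flag_weight 1 (Suc (s x)) :: _ \<Rightarrow> (ab_letter, 'k) ncpoly"
  let ?r = "case_option (s x) r"
  let ?A = "{C. C \<in> Chains \<Gamma> \<and> C \<subseteq> fibre_le x - {z}}"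
  let ?A' = "{C. C \<in> Chains \<Gamma> \<and> C \<subseteq> fibre_less x - {z}}"
  let ?X = "{C. C \<in> Chains (susp x) \<and> C \<subseteq> Field (susp x) - {Some z}}"
  have pos: "1 \<le> s x" using B.rank_0[OF x(1)] x(2) by simp
  have finA: "finite ?A" "finite ?A'"
    using finite_fibre_le[of x] fibre_less_subset[of x]
    by (auto intro!: finite_chains_subset intro: finite_subset)
  have X: "?X = (`) Some ` ?A \<union> (\<lambda>C. insert None (Some ` C)) ` ?A'"
  proof (intro equalityI subsetI)
    fix C assume C: "C \<in> ?X"
    define D where "D = Some -` C"
    have "(y, w) \<in> \<Gamma> \<or> (w, y) \<in> \<Gamma>" if "y \<in> D" "w \<in> D" for y w
    proof -
      have "(Some y, Some w) \<in> susp x \<or> (Some w, Some y) \<in> susp x"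
        using that C unfolding D_def Chains_def by blast
      then show ?thesis by (auto simp: iff)
    qed
    then have D: "D \<subseteq> fibre_le x - {z}" "D \<in> Chains \<Gamma>"
      using C unfolding D_def by (auto simp: F Chains_def)
    show "C \<in> (`) Some ` ?A \<union> (\<lambda>C. insert None (Some ` C)) ` ?A'"
    proof (cases "None \<in> C")
      case True
      have "y \<in> fibre_less x" if "y \<in> D" for y
      proof -
        have "(Some y, None) \<in> susp x \<or> (None, Some y) \<in> susp x"
          using that True C unfolding D_def Chains_def by blast
        then show ?thesis by (auto simp: iff)
      qed
      then have "D \<in> ?A'" using D by auto
      moreover have "C = insert None (Some ` D)"
      proof (rule set_eqI)
        fix u show "u \<in> C \<longleftrightarrow> u \<in> insert None (Some ` D)"
          using True by (cases u) (auto simp: D_def)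
      qed
      ultimately show ?thesis by blast
    next
      case False
      have "C = Some ` D"
      proof (rule set_eqI)
        fix u show "u \<in> C \<longleftrightarrow> u \<in> Some ` D"
          using False by (cases u) (auto simp: D_def)
      qed
      then show ?thesis using D by blast
    qed
  next
    fix C assume "C \<in> (`) Some ` ?A \<union> (\<lambda>C. insert None (Some ` C)) ` ?A'"
    then consider D where "D \<in> ?A" "C = Some ` D" | D where "D \<in> ?A'" "C = insert None (Some ` D)"
      by blast
    then show "C \<in> ?X"
    proof cases
      case 1
      then show ?thesis by (auto simp: Chains_def F iff subset_iff)
    next
      case 2
      then show ?thesis using fibre_less_subset[of x] by (auto simp: Chains_def F iff subset_iff)
    qed
  qed
  have "ab_index (susp x) = (\<Sum>C\<in>?X. ?w (?r ` C))"
    by (simp add: S.ab_index_eq_chain_sum chain_sum_def)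
  also have "\<dots> = (\<Sum>C\<in>(`) Some ` ?A. ?w (?r ` C)) + (\<Sum>C\<in>(\<lambda>C. insert None (Some ` C)) ` ?A'. ?w (?r ` C))"
    unfolding X using finA by (intro sum.union_disjoint) auto
  also have "(\<Sum>C\<in>(`) Some ` ?A. ?w (?r ` C)) = (\<Sum>C\<in>?A. ?w (r ` C))"
    by (subst sum.reindex) (auto simp: inj_on_def inj_image_eq_iff image_image)
  also have "(\<Sum>C\<in>(\<lambda>C. insert None (Some ` C)) ` ?A'. ?w (?r ` C)) = (\<Sum>C\<in>?A'. ?w (insert (s x) (r ` C)))"
  proof (subst sum.reindex)
    show "inj_on (\<lambda>C. insert None (Some ` C)) ?A'"
    proof (rule inj_onI)
      fix C D :: "'p set" assume "insert None (Some ` C) = insert None (Some ` D)"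
      then have "Some -` insert None (Some ` C) = Some -` insert None (Some ` D)" by simp
      then show "C = D" by (simp add: vimage_insert vimage_def image_iff)
    qed
  qed (simp add: image_image)
  also have "\<dots> = (\<Sum>C\<in>?A'. flag_weight 1 (s x) (r ` C)) * ab_b"
    unfolding sum_distrib_right using pos by (intro sum.cong) (simp_all add: flag_weight_split)
  finally show ?thesis by (simp add: chain_sum_def)
qed

text \<open>The ab-index of the part minus that of its boundary times a, after the chains not ending
  over \<open>x\<close> have been cancelled.\<close>

definition local_ab :: "'q \<Rightarrow> (ab_letter, 'k::field_char_0) ncpoly" where
  "local_ab x = (\<Sum>y | y \<in> Field \<Gamma> \<and> \<phi> y = x. G.lower_sum y * ab_b * ab_e ^ (s x - r y)) -
    chain_sum \<Gamma> r (fibre_less x - {z}) 1 (s x) * ab_b"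

lemma fibre_less_rank:
  assumes "y \<in> fibre_less x"
  shows "r y < s x"
proof -
  have "s (\<phi> y) < s x" "y \<in> Field \<Gamma>" using assms B.rank_mono by (auto simp: fibre_less_def)
  then show ?thesis using rank_le[of y] by simp
qed

lemma chain_sum_fibre_less:
  assumes "x \<in> Field B" "x \<noteq> z'"
  shows "(chain_sum \<Gamma> r (fibre_less x - {z}) 1 (s x) :: (ab_letter, 'k::field_char_0) ncpoly) =
    ab_e ^ (s x - 1) + (\<Sum>y\<in>fibre_less x - {z}. G.lower_sum y * ab_b * ab_e ^ (s x - Suc (r y)))"
proof (rule G.chain_sum_lower_ideal[OF _ fibre_less_lower fibre_less_rank])
  show "fibre_less x \<subseteq> Field \<Gamma>" using fibre_le_subset fibre_less_subset by blast
qed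

lemma nc_subst_bd_boundary:
  assumes x: "x \<in> Field B" "x \<noteq> z'"
  shows "nc_subst cd_to_ab (cd_index_bd (boundary (Restr \<Gamma> (fibre_le x)))) =
    (chain_sum \<Gamma> r (fibre_less x - {z}) 1 (s x) :: (ab_letter, 'k::field_char_0) ncpoly)"
  unfolding boundary_part[OF x(1)] ab_index_boundary[OF x, symmetric]
  by (rule nc_subst_cd_index_bd) (rule eulerian_boundary.ab_index_in_cd_polys[OF boundary_eulerian[OF x]])

text \<open>Let \<Psi> be the ab-index of the boundary. The part contributes \<Psi> e plus the
  chains ending over \<open>x\<close>, the suspension point adds \<Psi> b, and \<Psi> c is
  subtracted; e + b - c = -b leaves \<open>local_ab\<close>.\<close>

lemma nc_subst_local_cd_index:
  assumes x: "x \<in> Field B" "x \<noteq> z'"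
  shows "nc_subst cd_to_ab (local_cd_index (Restr \<Gamma> (fibre_le x))) =
    (local_ab x :: (ab_letter, 'k::field_char_0) ncpoly)"
proof -
  define F where "F = {y. y \<in> Field \<Gamma> \<and> \<phi> y = x}"
  define L where "L = fibre_less x - {z}"
  let ?u = "G.lower_sum :: _ \<Rightarrow> (ab_letter, 'k) ncpoly"
  let ?Psi = "chain_sum \<Gamma> r L 1 (s x) :: (ab_letter, 'k) ncpoly"
  have pos: "poset_rank (Restr \<Gamma> (fibre_le x)) \<noteq> 0" "1 \<le> s x"
    using ranked_poset.poset_rank_eq[OF part_ranked[OF x(1)]] B.rank_0[OF x(1)] x(2) by simp_all
  have split: "fibre_le x - {z} = L \<union> F" "L \<inter> F = {}"
    using x B.rel_refl[OF x(1)] phi_bot by (auto simp: L_def F_def fibre_less_def fibre_le_def)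
  have fin: "finite L" "finite F"
    using finite_fibre_le[of x] split(1) by (metis finite_Diff finite_Un)+
  have rL: "r y < s x" if "y \<in> L" for y
    using that by (simp add: L_def fibre_less_rank)
  have "(chain_sum \<Gamma> r (fibre_le x - {z}) 1 (Suc (s x)) :: (ab_letter, 'k) ncpoly) =
      ab_e ^ (Suc (s x) - 1) + (\<Sum>y\<in>fibre_le x - {z}. ?u y * ab_b * ab_e ^ (Suc (s x) - Suc (r y)))"
  proof (rule G.chain_sum_lower_ideal[OF fibre_le_subset fibre_le_lower])
    show "r y < Suc (s x)" if "y \<in> fibre_le x" for y
      using that rank_le[of y] B.rank_mono_le[of "\<phi> y" x] by (auto simp: fibre_le_def)
  qed
  also have "\<dots> = ab_e ^ s x + (\<Sum>y\<in>L. ?u y * ab_b * ab_e ^ (s x - r y)) + (\<Sum>y\<in>F. ?u y * ab_b * ab_e ^ (s x - r y))"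
    unfolding split(1) using fin split(2) by (simp add: sum.union_disjoint add.assoc)
  \<comment> \<open>The empty chain and the chains ending in the boundary are precisely the chains
    of the boundary, now with a further e at position \<open>s x\<close>.\<close>
  also have "ab_e ^ s x + (\<Sum>y\<in>L. ?u y * ab_b * ab_e ^ (s x - r y)) = ?Psi * ab_e"
  proof -
    have "(\<Sum>y\<in>L. ?u y * ab_b * ab_e ^ (s x - r y)) = (\<Sum>y\<in>L. ?u y * ab_b * ab_e ^ (s x - Suc (r y)) * ab_e)"
    proof (rule sum.cong[OF HOL.refl])
      fix y assume "y \<in> L"
      then have "s x - r y = Suc (s x - Suc (r y))" using rL[of y] by simp
      then show "?u y * ab_b * ab_e ^ (s x - r y) = ?u y * ab_b * ab_e ^ (s x - Suc (r y)) * ab_e"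
        by (simp only: power_Suc2 mult.assoc)
    qed
    moreover have "ab_e ^ s x = ab_e ^ (s x - 1) * (ab_e :: (ab_letter, 'k) ncpoly)"
      using pos(2) by (metis One_nat_def Suc_pred less_eq_Suc_le power_Suc2)
    ultimately show ?thesis
      unfolding L_def chain_sum_fibre_less[OF x] distrib_right sum_distrib_right by simp
  qed
  finally have part: "chain_sum \<Gamma> r (fibre_le x - {z}) 1 (Suc (s x)) =
      ?Psi * ab_e + (\<Sum>y\<in>F. ?u y * ab_b * ab_e ^ (s x - r y))" .
  have "nc_subst cd_to_ab (cd_index_bd (susp x)) = (ab_index (susp x) :: (ab_letter, 'k) ncpoly)"
    by (rule nc_subst_cd_index_bd) (rule eulerian_boundary.ab_index_in_cd_polys[OF susp_eulerian[OF x]])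
  then have "nc_subst cd_to_ab (local_cd_index (Restr \<Gamma> (fibre_le x))) =
      ?Psi * ab_e + (\<Sum>y\<in>F. ?u y * ab_b * ab_e ^ (s x - r y)) + ?Psi * ab_b - ?Psi * (ab_a + ab_b)"
    using pos(1) by (simp add: local_cd_index_def nc_subst_bd_boundary[OF x] ab_index_susp[OF x] part L_def
        del: One_nat_def)
  also have "\<dots> = (\<Sum>y\<in>F. ?u y * ab_b * ab_e ^ (s x - r y)) - ?Psi * ab_b"
    by (simp add: distrib_left right_diff_distrib)
  finally show ?thesis by (simp add: local_ab_def F_def L_def)
qed

lemma local_cd_index_bot: "local_cd_index (Restr \<Gamma> (fibre_le z')) = 1"
  using ranked_poset.poset_rank_eq[OF part_ranked[OF B.bot_in]] B.rank_bot
  by (simp add: local_cd_index_def)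

lemma cd_index_part:
  assumes "x \<in> Field B" "x \<noteq> z'"
  shows "cd_index (Restr \<Gamma> (fibre_le x)) =
    local_cd_index (Restr \<Gamma> (fibre_le x)) + cd_index_bd (boundary (Restr \<Gamma> (fibre_le x)))"
  by (simp add: cd_index_def near_Eulerian_part[OF assms])

text \<open>Collecting the terms belonging to a fixed \<open>y\<close>, the sum over \<open>x\<close> collapses by the recursion for
  \<open>between_sum\<close>.\<close>

lemma sum_local_ab:
  assumes t: "t \<in> Field B" "t \<noteq> z'" and top: "\<And>x. x \<in> Field B \<Longrightarrow> (x, t) \<in> B"
  shows "(chain_sum \<Gamma> r (fibre_less t - {z}) 1 (s t) :: (ab_letter, 'k::field_char_0) ncpoly) =
    B.between_sum z' t + (\<Sum>x\<in>Field B - {t, z'}. local_ab x * B.between_sum x t)"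
proof -
  let ?u = "G.lower_sum :: _ \<Rightarrow> (ab_letter, 'k) ncpoly"
  let ?g = "\<lambda>x. B.between_sum x t :: (ab_letter, 'k) ncpoly"
  let ?e = "ab_e :: (ab_letter, 'k) ncpoly"
  let ?b = "ab_b :: (ab_letter, 'k) ncpoly"
  define D where "D = Field B - {t, z'}"
  define Y where "Y = fibre_less t - {z}"
  have finD: "finite D" by (simp add: D_def B.finite_Field)
  have finY: "finite Y" using finite_fibre_le[of t] fibre_less_subset[of t] finite_subset by (auto simp: Y_def)
  have Y: "y \<in> Field \<Gamma> \<and> \<phi> y \<in> D" if "y \<in> Y" for y
    using that phi_in[of y] phi_eq_bot[of y] by (auto simp: Y_def D_def fibre_less_def)
  have Y': "y \<in> Y" if "y \<in> Field \<Gamma>" "\<phi> y \<in> D" for y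
    using that top phi_bot by (auto simp: Y_def D_def fibre_less_def)
  have x: "x \<in> Field B" "x \<noteq> z'" "x \<noteq> t" "(x, t) \<in> B" if "x \<in> D" for x
    using that top by (auto simp: D_def)
  have fib: "{y. y \<in> Field \<Gamma> \<and> \<phi> y = x} = {y \<in> Y. \<phi> y = x}" if "x \<in> D" for x
    using that Y Y' by blast
  \<comment> \<open>An image below some x \<noteq> t cannot be \<open>t\<close>, so these elements
    lie in the fixed set \<open>Y\<close>; this is what permits exchanging the sums over
    \<open>x\<close> and \<open>y\<close>.\<close>
  have less: "fibre_less x - {z} = {y. y \<in> Y \<and> ((\<phi> y, x) \<in> B \<and> \<phi> y \<noteq> x)}" if "x \<in> D" for x
  proof -
    have *: "\<phi> y \<in> D" if "y \<in> Field \<Gamma>" "(\<phi> y, x) \<in> B" "y \<noteq> z" for y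
      using that \<open>x \<in> D\<close> x[OF \<open>x \<in> D\<close>] phi_eq_bot[of y] phi_in[of y] B.antisym[of x t]
      by (auto simp: D_def)
    show ?thesis
    proof (intro equalityI subsetI)
      fix y assume "y \<in> fibre_less x - {z}"
      then have y: "y \<in> Field \<Gamma>" "(\<phi> y, x) \<in> B" "\<phi> y \<noteq> x" "y \<noteq> z" by (auto simp: fibre_less_def)
      then show "y \<in> {y. y \<in> Y \<and> ((\<phi> y, x) \<in> B \<and> \<phi> y \<noteq> x)}" using Y'[OF y(1) *[OF y(1,2,4)]] by simp
    next
      fix y assume y: "y \<in> {y. y \<in> Y \<and> ((\<phi> y, x) \<in> B \<and> \<phi> y \<noteq> x)}"
      then have "y \<in> Field \<Gamma>" "y \<noteq> z" using Y[of y] by (auto simp: Y_def)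
      then show "y \<in> fibre_less x - {z}" using y by (simp add: fibre_less_def)
    qed
  qed
  have above: "{x. (v, x) \<in> B \<and> x \<noteq> v \<and> (x, t) \<in> B \<and> x \<noteq> t} = {x. x \<in> D \<and> ((v, x) \<in> B \<and> v \<noteq> x)}"
    if "v \<in> insert z' D" for v
    using that top B.in_Field B.bot B.antisym by (auto simp: D_def)
  have s_le: "s v < s x" if "(v, x) \<in> B" "v \<noteq> x" for v x using B.rank_mono that .
  \<comment> \<open>\<open>between_sum_rec\<close> solved for its leading power. It is applied at
    the bottom and at \<open>\<phi> y\<close> for each \<open>y\<close>.\<close>
  have rec: "?g v - (\<Sum>x | x \<in> D \<and> ((v, x) \<in> B \<and> v \<noteq> x). ?e ^ (s x - Suc (s v)) * ?b * ?g x) =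
      ?e ^ (s t - Suc (s v))" if "v \<in> insert z' D" for v
    using B.between_sum_rec[of v t] unfolding above[OF that] by (simp add: algebra_simps)
  have "(\<Sum>x\<in>D. local_ab x * ?g x) =
      (\<Sum>x\<in>D. (\<Sum>y | y \<in> Y \<and> \<phi> y = x. ?u y * ?b * ?e ^ (s x - r y) * ?g x) - ?e ^ (s x - 1) * ?b * ?g x -
        (\<Sum>y | y \<in> Y \<and> ((\<phi> y, x) \<in> B \<and> \<phi> y \<noteq> x). ?u y * ?b * ?e ^ (s x - Suc (r y)) * ?b * ?g x))"
  proof (rule sum.cong[OF HOL.refl])
    fix x assume xD: "x \<in> D"
    show "local_ab x * ?g x =
        (\<Sum>y | y \<in> Y \<and> \<phi> y = x. ?u y * ?b * ?e ^ (s x - r y) * ?g x) - ?e ^ (s x - 1) * ?b * ?g x -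
        (\<Sum>y | y \<in> Y \<and> ((\<phi> y, x) \<in> B \<and> \<phi> y \<noteq> x). ?u y * ?b * ?e ^ (s x - Suc (r y)) * ?b * ?g x)"
      unfolding local_ab_def fib[OF xD] less[OF xD]
        chain_sum_fibre_less[OF x(1,2)[OF xD], unfolded less[OF xD]]
      by (simp only: left_diff_distrib distrib_right sum_distrib_right diff_diff_eq)
  qed
  also have "\<dots> = (\<Sum>x\<in>D. \<Sum>y | y \<in> Y \<and> \<phi> y = x. ?u y * ?b * ?e ^ (s x - r y) * ?g x) -
      (\<Sum>x\<in>D. ?e ^ (s x - 1) * ?b * ?g x) -
      (\<Sum>x\<in>D. \<Sum>y | y \<in> Y \<and> ((\<phi> y, x) \<in> B \<and> \<phi> y \<noteq> x). ?u y * ?b * ?e ^ (s x - Suc (r y)) * ?b * ?g x)"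
    by (simp only: sum_subtractf)
  also have "(\<Sum>x\<in>D. \<Sum>y | y \<in> Y \<and> \<phi> y = x. ?u y * ?b * ?e ^ (s x - r y) * ?g x) =
      (\<Sum>x\<in>D. \<Sum>y | y \<in> Y \<and> \<phi> y = x. ?u y * ?b * ?e ^ (s (\<phi> y) - r y) * ?g (\<phi> y))"
    by (intro sum.cong) auto
  also have "\<dots> = (\<Sum>y\<in>Y. ?u y * ?b * ?e ^ (s (\<phi> y) - r y) * ?g (\<phi> y))"
    using finD finY Y by (intro sum.group) auto
  also have "(\<Sum>x\<in>D. \<Sum>y | y \<in> Y \<and> ((\<phi> y, x) \<in> B \<and> \<phi> y \<noteq> x). ?u y * ?b * ?e ^ (s x - Suc (r y)) * ?b * ?g x) =
      (\<Sum>y\<in>Y. \<Sum>x | x \<in> D \<and> ((\<phi> y, x) \<in> B \<and> \<phi> y \<noteq> x). ?u y * ?b * ?e ^ (s x - Suc (r y)) * ?b * ?g x)"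
    by (rule sum.swap_restrict[OF finD finY])
  \<comment> \<open>These terms stem from the empty chains of the boundaries; they are
    \<open>rec\<close> at the bottom, whose rank is 0.\<close>
  also have "(\<Sum>x\<in>D. ?e ^ (s x - 1) * ?b * ?g x) = ?g z' - ?e ^ (s t - 1)"
  proof -
    have "{x. x \<in> D \<and> ((z', x) \<in> B \<and> z' \<noteq> x)} = D" using B.bot by (auto simp: D_def)
    then show ?thesis using rec[of z'] by (simp add: B.rank_bot algebra_simps)
  qed
  also have "(\<Sum>y\<in>Y. ?u y * ?b * ?e ^ (s (\<phi> y) - r y) * ?g (\<phi> y)) - (?g z' - ?e ^ (s t - 1)) -
      (\<Sum>y\<in>Y. \<Sum>x | x \<in> D \<and> ((\<phi> y, x) \<in> B \<and> \<phi> y \<noteq> x). ?u y * ?b * ?e ^ (s x - Suc (r y)) * ?b * ?g x) =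
    ?e ^ (s t - 1) - ?g z' + (\<Sum>y\<in>Y. ?u y * ?b * ?e ^ (s (\<phi> y) - r y) * ?g (\<phi> y) -
      (\<Sum>x | x \<in> D \<and> ((\<phi> y, x) \<in> B \<and> \<phi> y \<noteq> x). ?u y * ?b * ?e ^ (s x - Suc (r y)) * ?b * ?g x))"
    by (simp only: sum_subtractf) (simp only: algebra_simps)
  also have "(\<Sum>y\<in>Y. ?u y * ?b * ?e ^ (s (\<phi> y) - r y) * ?g (\<phi> y) -
      (\<Sum>x | x \<in> D \<and> ((\<phi> y, x) \<in> B \<and> \<phi> y \<noteq> x). ?u y * ?b * ?e ^ (s x - Suc (r y)) * ?b * ?g x)) =
    (\<Sum>y\<in>Y. ?u y * ?b * ?e ^ (s t - Suc (r y)))"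
  proof (rule sum.cong[OF HOL.refl])
    fix y assume y: "y \<in> Y"
    let ?v = "\<phi> y"
    have v: "?v \<in> D" "r y \<le> s ?v" using Y[OF y] rank_le by auto
    \<comment> \<open>Because r y \<le> s (\<phi> y) < s x, the power splits at the rank of
      \<open>\<phi> y\<close>; the first part is independent of \<open>x\<close> and comes out of
      the sum.\<close>
    have e: "?e ^ (s x - Suc (r y)) = ?e ^ (s ?v - r y) * ?e ^ (s x - Suc (s ?v))" if "s ?v < s x" for x
    proof -
      have "s x - Suc (r y) = (s ?v - r y) + (s x - Suc (s ?v))" using that v(2) by simp
      then show ?thesis by (simp only: power_add)
    qed
    have "(\<Sum>x | x \<in> D \<and> ((?v, x) \<in> B \<and> ?v \<noteq> x). ?u y * ?b * ?e ^ (s x - Suc (r y)) * ?b * ?g x) =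
        (\<Sum>x | x \<in> D \<and> ((?v, x) \<in> B \<and> ?v \<noteq> x).
          ?u y * ?b * ?e ^ (s ?v - r y) * (?e ^ (s x - Suc (s ?v)) * ?b * ?g x))"
    proof (rule sum.cong[OF HOL.refl])
      fix x assume "x \<in> {x. x \<in> D \<and> ((?v, x) \<in> B \<and> ?v \<noteq> x)}"
      then have "s ?v < s x" using s_le by blast
      then show "?u y * ?b * ?e ^ (s x - Suc (r y)) * ?b * ?g x =
          ?u y * ?b * ?e ^ (s ?v - r y) * (?e ^ (s x - Suc (s ?v)) * ?b * ?g x)"
        by (simp only: e mult.assoc)
    qed
    also have "\<dots> = ?u y * ?b * ?e ^ (s ?v - r y) *
        (\<Sum>x | x \<in> D \<and> ((?v, x) \<in> B \<and> ?v \<noteq> x). ?e ^ (s x - Suc (s ?v)) * ?b * ?g x)"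
      by (rule sum_distrib_left[symmetric])
    finally have "?u y * ?b * ?e ^ (s ?v - r y) * ?g ?v -
        (\<Sum>x | x \<in> D \<and> ((?v, x) \<in> B \<and> ?v \<noteq> x). ?u y * ?b * ?e ^ (s x - Suc (r y)) * ?b * ?g x) =
        ?u y * ?b * ?e ^ (s ?v - r y) * ?e ^ (s t - Suc (s ?v))"
      using rec[of ?v] v(1) by (simp flip: right_diff_distrib)
    moreover have "?e ^ (s t - Suc (r y)) = ?e ^ (s ?v - r y) * ?e ^ (s t - Suc (s ?v))"
      by (rule e[OF s_le[OF x(4,3)[OF v(1)]]])
    ultimately show "?u y * ?b * ?e ^ (s ?v - r y) * ?g ?v -
        (\<Sum>x | x \<in> D \<and> ((?v, x) \<in> B \<and> ?v \<noteq> x). ?u y * ?b * ?e ^ (s x - Suc (r y)) * ?b * ?g x) =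
        ?u y * ?b * ?e ^ (s t - Suc (r y))"
      by (simp only: mult.assoc)
  qed
  \<comment> \<open>Only the expansion of the boundary of \<Gamma> by largest elements is
    left.\<close>
  also have "?e ^ (s t - 1) - ?g z' + (\<Sum>y\<in>Y. ?u y * ?b * ?e ^ (s t - Suc (r y))) =
      chain_sum \<Gamma> r (fibre_less t - {z}) 1 (s t) - ?g z'"
    unfolding chain_sum_fibre_less[OF t] Y_def by (simp add: algebra_simps)
  finally show ?thesis by (simp add: D_def)
qed

end

text \<open>The identity is a subdivision whose local ab-index vanishes.\<close>

lemma (in ranked_poset) nc_subst_cd_index_interval:
  assumes eulerian: "\<And>x y. (x, y) \<in> P \<Longrightarrow> x \<noteq> y \<Longrightarrow>
      (\<Sum>w | (x, w) \<in> P \<and> (w, y) \<in> P. (- 1 :: int) ^ r w) = 0"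
    and xt: "(x, t) \<in> P" "x \<noteq> t"
  shows "nc_subst cd_to_ab (cd_index (interval P x t)) =
    (between_sum x t :: (ab_letter, 'k::field_char_0) ncpoly)"
proof -
  let ?I = "interval P x t"
  let ?r = "\<lambda>w. r w - r x"
  interpret I: ranked_poset ?I ?r x "r t - r x" by (rule interval_ranked[OF xt(1)])
  have eul: "(\<Sum>w | (u, w) \<in> ?I \<and> (w, v) \<in> ?I. (- 1 :: int) ^ (r w - r x)) = 0"
    if uv: "(u, v) \<in> ?I" "u \<noteq> v" for u v
  proof -
    have P: "(u, v) \<in> P" "(x, u) \<in> P" "(v, t) \<in> P" using uv by (simp_all add: interval_iff)
    have "(- 1 :: int) ^ (r w - r x) = (- 1) ^ r x * (- 1) ^ r w" if "(u, w) \<in> P" for w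
    proof -
      have "r w = r x + (r w - r x)" using rank_mono_le[OF trans[OF P(2) that]] by simp
      then have "(- 1 :: int) ^ r w = (- 1) ^ r x * (- 1) ^ (r w - r x)" by (metis power_add)
      moreover have "(- 1 :: int) ^ r x * (- 1) ^ r x = 1" by (simp flip: power_mult_distrib)
      ultimately show ?thesis by (simp only: mult.assoc[symmetric] mult_1_left)
    qed
    moreover have "{w. (u, w) \<in> ?I \<and> (w, v) \<in> ?I} = {w. (u, w) \<in> P \<and> (w, v) \<in> P}"
      unfolding interval_iff using P trans by blast
    ultimately have "(\<Sum>w | (u, w) \<in> ?I \<and> (w, v) \<in> ?I. (- 1 :: int) ^ (r w - r x)) =
        (\<Sum>w | (u, w) \<in> P \<and> (w, v) \<in> P. (- 1) ^ r x * (- 1) ^ r w)"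
      by (intro sum.cong) auto
    then show ?thesis using eulerian[OF P(1) uv(2)] by (simp flip: sum_distrib_left)
  qed
  interpret S: subdivision ?I ?r x "r t - r x" ?I ?r x "r t - r x" "\<lambda>w. w"
  proof
    fix y x' assume "(y, x') \<in> ?I"
    then show "\<exists>w. (y, w) \<in> ?I \<and> w = x' \<and> r w - r x = r x' - r x" by simp
    have "{w. (y, w) \<in> ?I \<and> w = x'} = {x'}" using \<open>(y, x') \<in> ?I\<close> by auto
    then show "(\<Sum>w | (y, w) \<in> ?I \<and> w = x'. (- 1 :: int) ^ (r w - r x)) = (- 1) ^ (r x' - r x)" by simp
  qed (use eul in simp_all)
  have tF: "t \<in> Field ?I" using xt rel_refl in_Field by (simp add: Field_interval)
  have le: "(w, t) \<in> ?I" if "w \<in> Field ?I" for w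
    using that rel_refl[OF in_Field(2)] by (auto simp: Field_interval interval_iff)
  have fib: "S.fibre_le t = Field ?I" "S.fibre_less t = Field ?I - {t}"
    unfolding S.fibre_le_def S.fibre_less_def using le by auto
  have part: "Restr ?I (S.fibre_le t) = ?I" unfolding fib by (auto intro: FieldI1 FieldI2)
  have A: "Field ?I - {t} - {x} = {v. (x, v) \<in> P \<and> v \<noteq> x \<and> (v, t) \<in> P \<and> v \<noteq> t}"
    unfolding Field_interval by auto
  have chain: "(chain_sum ?I ?r (Field ?I - {t} - {x}) 1 (r t - r x) :: (ab_letter, 'k) ncpoly) = between_sum x t"
  proof -
    have "(chain_sum ?I ?r (Field ?I - {t} - {x}) 1 (r t - r x) :: (ab_letter, 'k) ncpoly) =
        chain_sum P ?r (Field ?I - {t} - {x}) 1 (r t - r x)"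
      unfolding interval_def by (rule chain_sum_Restr) (auto simp: Field_def)
    also have "\<dots> = chain_sum P r (Field ?I - {t} - {x}) (1 + r x) (r t - r x + r x)"
      by (rule chain_sum_shift[symmetric]) (use rank_mono_le in \<open>auto simp: Field_interval\<close>)
    also have "\<dots> = between_sum x t"
      unfolding between_sum_def A using rank_mono_le[OF xt(1)] by simp
    finally show ?thesis .
  qed
  have "{w. (w, t) \<in> ?I \<and> w \<noteq> t \<and> w \<noteq> x} = Field ?I - {t} - {x}"
    using le by (auto intro: FieldI1)
  moreover have "{y. y \<in> Field ?I \<and> y = t} = {t}" using tF by auto
  \<comment> \<open>The fibre over \<open>t\<close> is \<open>t\<close> alone, with exponent 0, and
    the elements below it are exactly the boundary; the two terms of \<open>local_ab\<close> are
    equal.\<close>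
  ultimately have "S.local_ab t = (0 :: (ab_letter, 'k) ncpoly)"
    by (simp add: S.local_ab_def I.lower_sum_def fib(2))
  then show ?thesis
    using S.nc_subst_local_cd_index[OF tF xt(2)[symmetric], where ?'k = 'k]
      S.nc_subst_bd_boundary[OF tF xt(2)[symmetric], where ?'k = 'k]
      S.cd_index_part[OF tF xt(2)[symmetric], where ?'a = 'k]
    unfolding part fib(2) chain by simp
qed

theorem theorem1p1:
  fixes \<Gamma> :: "'p rel" and B :: "'q rel" and \<phi> :: "'p \<Rightarrow> 'q"
  assumes "lower_Eulerian \<Gamma>"
    and "Eulerian B"
    and "strong_formal_subdivision \<Gamma> B \<phi>"
    and "subdivision_rank \<Gamma> B = 0"
  shows "(cd_index \<Gamma> :: (cd_letter, 'k::field_char_0) ncpoly) =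
    (\<Sum>x \<in> Field B.
       local_cd_index (subdivision_part \<Gamma> B \<phi> x) * cd_index (interval B x (one_hat B)))"
proof -
  interpret G: ranked_poset \<Gamma> "rho \<Gamma>" "zero_hat \<Gamma>" "poset_rank \<Gamma>"
    by (rule graded_imp_ranked) (use assms(1) in \<open>simp add: lower_Eulerian_def\<close>)
  interpret B: ranked_poset B "rho B" "zero_hat B" "poset_rank B"
    by (rule graded_imp_ranked) (use assms(2) in \<open>simp add: Eulerian_def\<close>)
  have eulerian_B: "(\<Sum>w | (x, w) \<in> B \<and> (w, y) \<in> B. (- 1 :: int) ^ rho B w) = 0"
    if "(x, y) \<in> B" "x \<noteq> y" for x y
    using assms(2) that unfolding B.Eulerian_iff by blast
  have sub: "\<phi> ` Field \<Gamma> = Field B" "\<And>y y'. (y, y') \<in> \<Gamma> \<Longrightarrow> (\<phi> y, \<phi> y') \<in> B"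
    "\<And>y. y \<in> Field \<Gamma> \<Longrightarrow> rho \<Gamma> y \<le> rho B (\<phi> y)"
    "\<And>y x. y \<in> Field \<Gamma> \<Longrightarrow> x \<in> Field B \<Longrightarrow> (\<phi> y, x) \<in> B \<Longrightarrow>
      (\<exists>y'. (y, y') \<in> \<Gamma> \<and> \<phi> y' = x \<and> rho \<Gamma> y' = rho B x) \<and>
      (\<Sum>y' | (y, y') \<in> \<Gamma> \<and> \<phi> y' = x. (- 1 :: int) ^ rho \<Gamma> y') = (- 1) ^ rho B x"
    using assms(3) unfolding strong_formal_subdivision_def by blast+
  interpret S: subdivision \<Gamma> "rho \<Gamma>" "zero_hat \<Gamma>" "poset_rank \<Gamma>"
      B "rho B" "zero_hat B" "poset_rank B" \<phi>
  proof
    show "(\<Sum>w | (x, w) \<in> \<Gamma> \<and> (w, y) \<in> \<Gamma>. (- 1 :: int) ^ rho \<Gamma> w) = 0"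
      if "(x, y) \<in> \<Gamma>" "x \<noteq> y" for x y
      using lower_Eulerian_sum[OF assms(1) that] .
  qed (use eulerian_B sub B.in_Field in blast)+
  have "\<exists>!m. maximal_in B m" using assms(2) by (simp add: Eulerian_def)
  then obtain t where t: "maximal_in B t" "\<And>m. maximal_in B m \<Longrightarrow> m = t" by blast
  have tB: "t \<in> Field B" using t(1) by (simp add: maximal_in_def)
  have top: "(x, t) \<in> B" if "x \<in> Field B" for x
    using B.ex_maximal_above[OF that] t(2) by metis
  have one: "one_hat B = t" by (rule B.one_hat_eq(1)[OF tB top])
  have "S.fibre_le t = Field \<Gamma>" using top S.phi_in by (auto simp: S.fibre_le_def)
  then have part: "Restr \<Gamma> (S.fibre_le t) = \<Gamma>" by (auto intro: FieldI1 FieldI2)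
  have tt: "(cd_index (interval B t t) :: (cd_letter, 'k) ncpoly) = 1"
    by (rule ranked_poset.cd_index_rank_0[OF B.interval_ranked[OF top[OF tB]]]) simp
  let ?l = "\<lambda>x. local_cd_index (Restr \<Gamma> (S.fibre_le x)) :: (cd_letter, 'k) ncpoly"
  let ?c = "\<lambda>x. cd_index (interval B x t) :: (cd_letter, 'k) ncpoly"
  have "cd_index \<Gamma> = (\<Sum>x\<in>Field B. ?l x * ?c x)"
  proof (cases "t = zero_hat B")
    case True
    \<comment> \<open>Here \<Gamma> is a singleton as well, and every factor is 1.\<close>
    have "Field B = {t}" using top B.bot B.antisym tB unfolding True by blast
    moreover have "(cd_index (Restr \<Gamma> (S.fibre_le t)) :: (cd_letter, 'k) ncpoly) = 1"
      by (rule ranked_poset.cd_index_rank_0[OF S.part_ranked[OF tB]]) (simp add: True B.rank_bot)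
    then have "cd_index \<Gamma> = (1 :: (cd_letter, 'k) ncpoly)" by (simp only: part)
    moreover have "?l t = 1" using S.local_cd_index_bot True by simp
    ultimately show ?thesis using tt by simp
  next
    case False
    let ?D = "Field B - {t, zero_hat B}"
    have "nc_subst cd_to_ab (?c x) = (B.between_sum x t :: (ab_letter, 'k) ncpoly)"
      if "x \<in> Field B - {t}" for x
      using that by (intro B.nc_subst_cd_index_interval eulerian_B top) auto
    moreover have "nc_subst cd_to_ab (?l x) = (S.local_ab x :: (ab_letter, 'k) ncpoly)" if "x \<in> ?D" for x
      using that by (intro S.nc_subst_local_cd_index) auto
    ultimately have "nc_subst cd_to_ab (cd_index_bd (boundary \<Gamma>)) =
        (nc_subst cd_to_ab (?c (zero_hat B) + (\<Sum>x\<in>?D. ?l x * ?c x)) :: (ab_letter, 'k) ncpoly)"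
      using S.nc_subst_bd_boundary[OF tB False, where ?'k = 'k] S.sum_local_ab[OF tB False top, where ?'k = 'k]
        B.bot_in False by (simp add: part)
    then have bd: "cd_index_bd (boundary \<Gamma>) = ?c (zero_hat B) + (\<Sum>x\<in>?D. ?l x * ?c x)"
      by (rule cd_to_ab_injD)
    have "Field B = insert t (insert (zero_hat B) ?D)" using tB B.bot_in by blast
    then have "(\<Sum>x\<in>Field B. ?l x * ?c x) = (\<Sum>x\<in>insert t (insert (zero_hat B) ?D). ?l x * ?c x)"
      by (rule sum.cong) (rule HOL.refl)
    also have "\<dots> = ?l t * ?c t + (?l (zero_hat B) * ?c (zero_hat B) + (\<Sum>x\<in>?D. ?l x * ?c x))"
      using False B.finite_Field by simp
    \<comment> \<open>The cd-index of \<open>[t, t]\<close> and the local cd-index over the bottom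
      are both 1.\<close>
    also have "\<dots> = ?l t + cd_index_bd (boundary \<Gamma>)"
      by (simp add: tt bd S.local_cd_index_bot)
    finally show ?thesis
      using S.cd_index_part[OF tB False, where ?'a = 'k] by (simp add: part)
  qed
  then show ?thesis by (simp add: one S.part_eq)
qed

end
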